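(* Let $E$ and $F$ be directed graphs with no sinks, both satisfying Conditions (K), (W) and ($\infty$). Let $\Gamma,\Lambda$ be subgroups with $\mathsf{D}(\llbracket\mathcal{G}_E\rrbracket)\le\Gamma\le\llbracket\mathcal{G}_E\rrbracket$ and $\mathsf{D}(\llbracket\mathcal{G}_F\rrbracket)\le\Lambda\le\llbracket\mathcal{G}_F\rrbracket$. If $\Gamma\cong\Lambda$ as abstract groups, then $\mathcal{G}_E\cong\mathcal{G}_F$ as topological groupoids. In particular the following are equivalent: (1) $\mathcal{G}_E\cong\mathcal{G}_F$ as topological groupoids; (2) $\llbracket\mathcal{G}_E\rrbracket\cong\llbracket\mathcal{G}_F\rrbracket$ as abstract groups; (3) $\mathsf{D}(\llbracket\mathcal{G}_E\rrbracket)\cong\mathsf{D}(\llbracket\mathcal{G}_F\rrbracket)$ as abstract groups.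
   Context: A graph $E=(E^0,E^1,r,s)$; finite paths $\mu=e_1\cdots e_n$ with $r(e_i)=s(e_{i+1})$, vertices being paths of length $0$; $E^*$ is the set of finite paths, $vE^*w$ the paths from $v$ to $w$, $vE^1$ the edges with source $v$. A sink is $v$ with $vE^1=\emptyset$; an infinite emitter has $vE^1$ infinite; singular vertices are sinks and infinite emitters. Write $v\ge w$ if $vE^*w\ne\emptyset$. A cycle is a path of positive length with $r(\mu)=s(\mu)$; a return path is a cycle $e_1\cdots e_n$ with $r(e_i)\neq r(e_n)$ for $i<n$. Condition (K): for each vertex $v$ there is either no return path based at $v$ or at least two distinct return paths based at $v$. An infinite path $x=x_1x_2\cdots$ is wandering if each vertex occurs as $s(x_i)$ for only finitely many $i$. Condition (W): for every wandering infinite path $x$, $|s(x)E^*r(x_n)|\ge2$ for some $n$. Condition ($\infty$): for every infinite emitter $v$ the set $\{e\in vE^1: r(e)\ge v\}$ is infinite. Boundary path space $\partial E=E^\infty\cup\{\mu\in E^*: r(\mu)\text{ singular}\}$ with basis $Z(\mu)\setminus\bigcup_{e\in F}Z(\mu e)$ ($Z(\mu)=\{\mu x\in\partial E\}$, $F\subseteq r(\mu)E^1$ finite); shift $\sigma_E$ deletes the first edge. Graph groupoid $\mathcal{G}_E=\{(x,m-n,y): |x|\ge m,|y|\ge n,\sigma_E^m(x)=\sigma_E^n(y)\}$ with $(x,k,y)(y,l,z)=(x,k+l,z)$, $(x,k,y)^{-1}=(y,-k,x)$, unit space $\partial E$, and topology generated by $\{(x,m-n,y):x\in U,y\in V,\sigma_E^m(x)=\sigma_E^n(y)\}$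 for open $U,V$ on which $\sigma_E^m,\sigma_E^n$ are injective with equal images. For an effective ample groupoid $\mathcal{G}$, $\llbracket\mathcal{G}\rrbracket$ is the group of homeomorphisms $\pi_U=r|_U\circ(s|_U)^{-1}$ of $\mathcal{G}^{(0)}$ for full open bisections $U$ with compact support of $\pi_U$; $\mathsf{D}(\cdot)$ is the commutator subgroup. (Condition (K) implies every cycle has an exit, so $\mathcal{G}_E$ is effective.) *)

theory Defs
  imports "HOL-Analysis.Analysis" "HOL-Algebra.Algebra"
begin

record ('v, 'e) graph =
  verts :: "'v set"
  edges :: "'e set"
  rng   :: "'e \<Rightarrow> 'v"
  src   :: "'e \<Rightarrow> 'v"

definition wf_graph :: "('v, 'e) graph \<Rightarrow> bool" where
  "wf_graph E \<longleftrightarrow> src E ` edges E \<subseteq> verts E \<and> rng E ` edges E \<subseteq> verts E"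

definition out_edges :: "('v, 'e) graph \<Rightarrow> 'v \<Rightarrow> 'e set" where
  "out_edges E v = {e \<in> edges E. src E e = v}"

definition is_sink :: "('v, 'e) graph \<Rightarrow> 'v \<Rightarrow> bool" where
  "is_sink E v \<longleftrightarrow> out_edges E v = {}"

definition infinite_emitter :: "('v, 'e) graph \<Rightarrow> 'v \<Rightarrow> bool" where
  "infinite_emitter E v \<longleftrightarrow> infinite (out_edges E v)"

definition singular :: "('v, 'e) graph \<Rightarrow> 'v \<Rightarrow> bool" where
  "singular E v \<longleftrightarrow> is_sink E v \<or> infinite_emitter E v"

definition no_sinks :: "('v, 'e) graph \<Rightarrow> bool" where
  "no_sinks E \<longleftrightarrow> (\<forall>v\<in>verts E. \<not> is_sink E v)"

definition edge_path :: "('v, 'e) graph \<Rightarrow> 'e list \<Rightarrow> bool" where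
  "edge_path E es \<longleftrightarrow> set es \<subseteq> edges E \<and>
     (\<forall>i. Suc i < length es \<longrightarrow> rng E (es ! i) = src E (es ! Suc i))"

text \<open>The set v E^* w of finite paths from v to w (the vertex v, represented by the
  empty list, is the unique path of length 0 from v to v).\<close>
definition paths_from_to :: "('v, 'e) graph \<Rightarrow> 'v \<Rightarrow> 'v \<Rightarrow> 'e list set" where
  "paths_from_to E v w = {es. v \<in> verts E \<and> w \<in> verts E \<and> edge_path E es \<and>
      (es = [] \<longrightarrow> v = w) \<and> (es \<noteq> [] \<longrightarrow> src E (hd es) = v \<and> rng E (last es) = w)}"

definition reaches :: "('v, 'e) graph \<Rightarrow> 'v \<Rightarrow> 'v \<Rightarrow> bool" where
  "reaches E v w \<longleftrightarrow> paths_from_to E v w \<noteq> {}"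

definition return_path :: "('v, 'e) graph \<Rightarrow> 'v \<Rightarrow> 'e list \<Rightarrow> bool" where
  "return_path E v es \<longleftrightarrow> es \<noteq> [] \<and> es \<in> paths_from_to E v v \<and>
     (\<forall>i. Suc i < length es \<longrightarrow> rng E (es ! i) \<noteq> rng E (last es))"

definition condition_K :: "('v, 'e) graph \<Rightarrow> bool" where
  "condition_K E \<longleftrightarrow> (\<forall>v\<in>verts E. (\<nexists>\<mu>. return_path E v \<mu>) \<or>
      (\<exists>\<mu> \<nu>. return_path E v \<mu> \<and> return_path E v \<nu> \<and> \<mu> \<noteq> \<nu>))"

text \<open>Infinite paths x = x_1 x_2 ..., indexed from 0 here.\<close>
definition inf_path :: "('v, 'e) graph \<Rightarrow> (nat \<Rightarrow> 'e) \<Rightarrow> bool" where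
  "inf_path E x \<longleftrightarrow> (\<forall>i. x i \<in> edges E) \<and> (\<forall>i. rng E (x i) = src E (x (Suc i)))"

definition wandering :: "('v, 'e) graph \<Rightarrow> (nat \<Rightarrow> 'e) \<Rightarrow> bool" where
  "wandering E x \<longleftrightarrow> inf_path E x \<and> (\<forall>v. finite {i. src E (x i) = v})"

definition condition_W :: "('v, 'e) graph \<Rightarrow> bool" where
  "condition_W E \<longleftrightarrow> (\<forall>x. wandering E x \<longrightarrow>
     (\<exists>n \<mu> \<nu>. \<mu> \<in> paths_from_to E (src E (x 0)) (rng E (x n)) \<and>
               \<nu> \<in> paths_from_to E (src E (x 0)) (rng E (x n)) \<and> \<mu> \<noteq> \<nu>))"

definition condition_infty :: "('v, 'e) graph \<Rightarrow> bool" where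
  "condition_infty E \<longleftrightarrow> (\<forall>v\<in>verts E. infinite_emitter E v \<longrightarrow>
     infinite {e \<in> out_edges E v. reaches E (rng E e) v})"

text \<open>A path is either a finite path (source vertex, edge list; the empty list gives the
  vertex itself as a path of length 0) or an infinite path.\<close>
datatype ('v, 'e) bpath = FinP 'v "'e list" | InfP "nat \<Rightarrow> 'e"

fun fin_path :: "('v, 'e) graph \<Rightarrow> ('v, 'e) bpath \<Rightarrow> bool" where
  "fin_path E (FinP v es) \<longleftrightarrow> v \<in> verts E \<and> edge_path E es \<and> (es \<noteq> [] \<longrightarrow> src E (hd es) = v)"
| "fin_path E (InfP x) \<longleftrightarrow> False"

fun path_range :: "('v, 'e) graph \<Rightarrow> ('v, 'e) bpath \<Rightarrow> 'v" where
  "path_range E (FinP v es) = (if es = [] then v else rng E (last es))"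
| "path_range E (InfP x) = undefined"

fun path_len :: "('v, 'e) bpath \<Rightarrow> enat" where
  "path_len (FinP v es) = enat (length es)"
| "path_len (InfP x) = \<infinity>"

definition boundary :: "('v, 'e) graph \<Rightarrow> ('v, 'e) bpath set" where
  "boundary E = {InfP x | x. inf_path E x} \<union>
                {\<mu>. fin_path E \<mu> \<and> singular E (path_range E \<mu>)}"

fun extends :: "('v, 'e) graph \<Rightarrow> ('v, 'e) bpath \<Rightarrow> ('v, 'e) bpath \<Rightarrow> bool" where
  "extends E (FinP v es) (FinP w fs) \<longleftrightarrow> v = w \<and> (\<exists>zs. fs = es @ zs)"
| "extends E (FinP v es) (InfP x) \<longleftrightarrow> v = src E (x 0) \<and> es = map x [0..<length es]"
| "extends E (InfP x) y \<longleftrightarrow> False"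

definition cyl :: "('v, 'e) graph \<Rightarrow> ('v, 'e) bpath \<Rightarrow> ('v, 'e) bpath set" where
  "cyl E \<mu> = {y \<in> boundary E. extends E \<mu> y}"

fun path_snoc :: "('v, 'e) bpath \<Rightarrow> 'e \<Rightarrow> ('v, 'e) bpath" where
  "path_snoc (FinP v es) e = FinP v (es @ [e])"
| "path_snoc (InfP x) e = InfP x"

definition boundary_basis :: "('v, 'e) graph \<Rightarrow> ('v, 'e) bpath set set" where
  "boundary_basis E = {cyl E \<mu> - (\<Union>e\<in>F. cyl E (path_snoc \<mu> e)) | \<mu> F.
      fin_path E \<mu> \<and> finite F \<and> F \<subseteq> out_edges E (path_range E \<mu>)}"

definition boundary_top :: "('v, 'e) graph \<Rightarrow> ('v, 'e) bpath topology" where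
  "boundary_top E = topology_generated_by (boundary_basis E)"

text \<open>The shift map \<sigma>^m (meaningful for paths of length \<ge> m).\<close>
fun shift :: "('v, 'e) graph \<Rightarrow> nat \<Rightarrow> ('v, 'e) bpath \<Rightarrow> ('v, 'e) bpath" where
  "shift E m (InfP x) = InfP (\<lambda>i. x (i + m))"
| "shift E m (FinP v es) =
     (if m = 0 then FinP v es
      else if m < length es then FinP (src E (es ! m)) (drop m es)
      else FinP (path_range E (FinP v es)) [])"

type_synonym ('v, 'e) garrow = "('v, 'e) bpath \<times> int \<times> ('v, 'e) bpath"

definition graph_groupoid :: "('v, 'e) graph \<Rightarrow> ('v, 'e) garrow set" where
  "graph_groupoid E = {(x, int m - int n, y) | x y m n.
      x \<in> boundary E \<and> y \<in> boundary E \<and> path_len x \<ge> enat m \<and> path_len y \<ge> enat n \<and>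
      shift E m x = shift E n y}"

definition g_src :: "('v, 'e) garrow \<Rightarrow> ('v, 'e) bpath" where
  "g_src g = snd (snd g)"

definition g_rng :: "('v, 'e) garrow \<Rightarrow> ('v, 'e) bpath" where
  "g_rng g = fst g"

definition g_mult :: "('v, 'e) garrow \<Rightarrow> ('v, 'e) garrow \<Rightarrow> ('v, 'e) garrow" where
  "g_mult g h = (fst g, fst (snd g) + fst (snd h), snd (snd h))"

definition groupoid_basis :: "('v, 'e) graph \<Rightarrow> ('v, 'e) garrow set set" where
  "groupoid_basis E = {{(x, int m - int n, y) | x y. x \<in> U \<and> y \<in> V \<and> shift E m x = shift E n y}
     | U V m n. openin (boundary_top E) U \<and> openin (boundary_top E) V \<and>
        (\<forall>x\<in>U. path_len x \<ge> enat m) \<and> (\<forall>y\<in>V. path_len y \<ge> enat n) \<and>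
        inj_on (shift E m) U \<and> inj_on (shift E n) V \<and> shift E m ` U = shift E n ` V}"

definition groupoid_top :: "('v, 'e) graph \<Rightarrow> ('v, 'e) garrow topology" where
  "groupoid_top E = subtopology (topology_generated_by (groupoid_basis E)) (graph_groupoid E)"

definition groupoid_iso ::
  "('v, 'e) graph \<Rightarrow> ('w, 'f) graph \<Rightarrow> (('v, 'e) garrow \<Rightarrow> ('w, 'f) garrow) \<Rightarrow> bool" where
  "groupoid_iso E F \<phi> \<longleftrightarrow>
     bij_betw \<phi> (graph_groupoid E) (graph_groupoid F) \<and>
     homeomorphic_map (groupoid_top E) (groupoid_top F) \<phi> \<and>
     (\<forall>g\<in>graph_groupoid E. \<forall>h\<in>graph_groupoid E.
        (g_src g = g_rng h \<longleftrightarrow> g_src (\<phi> g) = g_rng (\<phi> h)) \<and>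
        (g_src g = g_rng h \<longrightarrow> \<phi> (g_mult g h) = g_mult (\<phi> g) (\<phi> h)))"

definition groupoids_isomorphic :: "('v, 'e) graph \<Rightarrow> ('w, 'f) graph \<Rightarrow> bool" where
  "groupoids_isomorphic E F \<longleftrightarrow> (\<exists>\<phi>. groupoid_iso E F \<phi>)"

definition full_open_bisection :: "('v, 'e) graph \<Rightarrow> ('v, 'e) garrow set \<Rightarrow> bool" where
  "full_open_bisection E U \<longleftrightarrow> openin (groupoid_top E) U \<and>
     inj_on g_src U \<and> inj_on g_rng U \<and>
     g_src ` U = boundary E \<and> g_rng ` U = boundary E"

text \<open>\<pi>_U = r|_U \<circ> (s|_U)^{-1}, taken as a function extensional on \<partial>E;
  its support closure{x. \<pi>_U x \<noteq> x} must be compact.\<close>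
definition full_group_carrier :: "('v, 'e) graph \<Rightarrow> (('v, 'e) bpath \<Rightarrow> ('v, 'e) bpath) set" where
  "full_group_carrier E = {\<pi>. \<pi> \<in> extensional (boundary E) \<and>
     (\<exists>U. full_open_bisection E U \<and> (\<forall>x\<in>boundary E. \<exists>k. (\<pi> x, k, x) \<in> U)) \<and>
     compactin (boundary_top E) (boundary_top E closure_of {x \<in> boundary E. \<pi> x \<noteq> x})}"

definition full_group :: "('v, 'e) graph \<Rightarrow> (('v, 'e) bpath \<Rightarrow> ('v, 'e) bpath) monoid" where
  "full_group E = \<lparr> carrier = full_group_carrier E,
                    mult = (\<lambda>\<pi> \<rho>. compose (boundary E) \<pi> \<rho>),
                    one = restrict id (boundary E) \<rparr>"

definition commutator_subgroup :: "('a, 'b) monoid_scheme \<Rightarrow> 'a set" where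
  "commutator_subgroup G = derived G (carrier G)"

end

theory Submission
  imports Defs
begin

text \<open>
  The first half is a reconstruction argument in the style of Rubin, following Belk, Elliott and
  Matucci: if a group of homeomorphisms moves every point inside every neighbourhood of it and the
  supports are compact and open, then inclusion of supports can be expressed in the language of groups.
  By compactness the points of the space are the maximal families of group elements whose supports
  have the finite intersection property, so a group isomorphism is induced by a homeomorphism.

  Conditions (K), (W) and (\<open>\<infinity>\<close>) say exactly what is needed to find, arbitrarily close to a
  boundary path, a different one with a common tail.  Hence there are transpositions along arrows of
  the groupoid with arbitrarily small support, and their commutators are 3-cycles in the commutator
  subgroup.  These make the reconstruction applicable to every group between the commutator subgroup
  and the full group, and they show that every arrow is the germ of an element of the commutator
  subgroup, so that the groupoid is recovered from the action as a groupoid of germs.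
\<close>

section \<open>Reconstructing a space from a group of homeomorphisms\<close>

text \<open>Commutation alone cannot detect disjoint supports, since powers of one element commute.
  The test uses elements \<open>[f1, [f2, h]]\<close> with \<open>f1\<close>, \<open>f2\<close>
  commuting with \<open>g\<close>: such an element is a product of four conjugates of
  \<open>h\<close> and its inverse by elements commuting with \<open>g\<close>. If it commutes with
  \<open>g\<close> too, its support is invariant under \<open>g\<close>; when \<open>h\<close> lives
  in a small set that \<open>g\<close> carries through five disjoint places, four conjugates cannot
  fill such a support. Short orbits of \<open>g\<close> escape this count, which is why only
  \<open>g ^ 12\<close> is controlled and why elements with nontrivial twelfth power are needed in
  every nonempty open set.

  Of the elements of the groups in question, only products of commutators are known. A transposition
  need not be among them, while a 3-cycle always is, but it requires a third point of the same orbit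
  nearby. Producing such points is the task of the graph conditions. The same points show that two
  different iterates of the shift never agree on a nonempty open set, so a homeomorphism determines
  the integer of each of its arrows; otherwise germs could not recover the groupoid.\<close>

text \<open>Here \<open>c\<close> and \<open>k\<close> are the commutators \<open>[f2, h]\<close> and \<open>[f1, c]\<close>, introduced by the equations
  that characterize them in order to avoid inverses.\<close>

definition alg_disjoint :: "('a, 'b) monoid_scheme \<Rightarrow> 'a \<Rightarrow> 'a \<Rightarrow> bool" where
  "alg_disjoint G f g \<longleftrightarrow> (\<forall>h\<in>carrier G. f \<otimes>\<^bsub>G\<^esub> h \<noteq> h \<otimes>\<^bsub>G\<^esub> f \<longrightarrow>
     (\<exists>f1\<in>carrier G. \<exists>f2\<in>carrier G. \<exists>c\<in>carrier G. \<exists>k\<in>carrier G.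
        f1 \<otimes>\<^bsub>G\<^esub> g = g \<otimes>\<^bsub>G\<^esub> f1 \<and> f2 \<otimes>\<^bsub>G\<^esub> g = g \<otimes>\<^bsub>G\<^esub> f2 \<and>
        f2 \<otimes>\<^bsub>G\<^esub> h = c \<otimes>\<^bsub>G\<^esub> h \<otimes>\<^bsub>G\<^esub> f2 \<and> f1 \<otimes>\<^bsub>G\<^esub> c = k \<otimes>\<^bsub>G\<^esub> c \<otimes>\<^bsub>G\<^esub> f1 \<and>
        k \<noteq> \<one>\<^bsub>G\<^esub> \<and> k \<otimes>\<^bsub>G\<^esub> g = g \<otimes>\<^bsub>G\<^esub> k))"

text \<open>The exponent 12 is divisible by all orbit lengths up to 4: a point moved by \<open>k ^ 12\<close> has at least
  five distinct iterates under \<open>k\<close>, one more than the number of conjugates of \<open>h\<close> in \<open>[f1, [f2, h]]\<close>.\<close>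

definition supp_le :: "('a, 'b) monoid_scheme \<Rightarrow> 'a \<Rightarrow> 'a \<Rightarrow> bool" where
  "supp_le G g f \<longleftrightarrow> (\<forall>k\<in>carrier G. alg_disjoint G f k \<longrightarrow>
     g \<otimes>\<^bsub>G\<^esub> (k [^]\<^bsub>G\<^esub> (12::nat)) = (k [^]\<^bsub>G\<^esub> (12::nat)) \<otimes>\<^bsub>G\<^esub> g)"

text \<open>The element \<open>g\<close> certifies that the supports of the members of
  \<open>B\<close> have a common part with interior, which is the finite intersection property in
  purely algebraic terms. Nonemptiness of \<open>A\<close> provides one compact support in which the
  whole intersection can be taken.\<close>

definition centered :: "('a, 'b) monoid_scheme \<Rightarrow> 'a set \<Rightarrow> bool" where
  "centered G A \<longleftrightarrow> A \<subseteq> carrier G \<and> A \<noteq> {} \<and>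
     (\<forall>B. finite B \<and> B \<subseteq> A \<longrightarrow> (\<exists>g\<in>carrier G. g \<noteq> \<one>\<^bsub>G\<^esub> \<and> (\<forall>f\<in>B. supp_le G g f)))"

definition max_centered :: "('a, 'b) monoid_scheme \<Rightarrow> 'a set \<Rightarrow> bool" where
  "max_centered G A \<longleftrightarrow> centered G A \<and> (\<forall>A'. centered G A' \<and> A \<subseteq> A' \<longrightarrow> A' = A)"

text \<open>Openness of the supports makes every finite intersection of supports around a point a
  neighbourhood of that point. The last assumption supplies, inside every nonempty open set, an
  element that survives the twelfth power in \<open>supp_le\<close>.\<close>

locale rubin_action = group G for G (structure) +
  fixes T :: "'x topology" and act :: "'a \<Rightarrow> 'x \<Rightarrow> 'x"
  assumes hausdorff: "Hausdorff_space T"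
    and act_cont: "g \<in> carrier G \<Longrightarrow> continuous_map T T (act g)"
    and act_one: "x \<in> topspace T \<Longrightarrow> act \<one> x = x"
    and act_mult: "g \<in> carrier G \<Longrightarrow> h \<in> carrier G \<Longrightarrow> x \<in> topspace T \<Longrightarrow>
                   act (g \<otimes> h) x = act g (act h x)"
    and faithful: "g \<in> carrier G \<Longrightarrow> h \<in> carrier G \<Longrightarrow> (\<And>x. x \<in> topspace T \<Longrightarrow> act g x = act h x) \<Longrightarrow> g = h"
    and supp_compact: "g \<in> carrier G \<Longrightarrow> compactin T (T closure_of {x \<in> topspace T. act g x \<noteq> x})"
    and supp_open: "g \<in> carrier G \<Longrightarrow> openin T (T closure_of {x \<in> topspace T. act g x \<noteq> x})"
    and locally_moving: "openin T U \<Longrightarrow> x \<in> U \<Longrightarrow>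
      \<exists>g\<in>carrier G. act g x \<noteq> x \<and> T closure_of {x \<in> topspace T. act g x \<noteq> x} \<subseteq> U"
    and exponent12: "openin T U \<Longrightarrow> x \<in> U \<Longrightarrow>
      \<exists>g\<in>carrier G. g [^] (12::nat) \<noteq> \<one> \<and> {x \<in> topspace T. act g x \<noteq> x} \<subseteq> U"
begin

definition moved :: "'a \<Rightarrow> 'x set" where
  "moved g = {x \<in> topspace T. act g x \<noteq> x}"

definition supp :: "'a \<Rightarrow> 'x set" where
  "supp g = T closure_of moved g"

lemma act_closed: "g \<in> carrier G \<Longrightarrow> x \<in> topspace T \<Longrightarrow> act g x \<in> topspace T"
  using act_cont by (auto simp: continuous_map_def)

lemma act_inv_l: "g \<in> carrier G \<Longrightarrow> x \<in> topspace T \<Longrightarrow> act (inv g) (act g x) = x"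
  by (metis act_mult act_one inv_closed l_inv)

lemma act_inv_r: "g \<in> carrier G \<Longrightarrow> x \<in> topspace T \<Longrightarrow> act g (act (inv g) x) = x"
  by (metis act_mult act_one inv_closed r_inv)

lemma act_inj: "g \<in> carrier G \<Longrightarrow> x \<in> topspace T \<Longrightarrow> y \<in> topspace T \<Longrightarrow> act g x = act g y \<Longrightarrow> x = y"
  by (metis act_inv_l)

lemma act_homeo: "g \<in> carrier G \<Longrightarrow> homeomorphic_map T T (act g)"
  unfolding homeomorphic_map_maps homeomorphic_maps_def
  by (rule exI[of _ "act (inv g)"]) (auto intro: act_cont simp: act_inv_l act_inv_r)

lemma moved_subset: "moved g \<subseteq> topspace T"
  by (auto simp: moved_def)

lemma moved_open: 
  assumes "g \<in> carrier G"
  shows "openin T (moved g)"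
proof -
  have "closedin T {x \<in> topspace T. act g x = id x}"
    by (rule closedin_continuous_maps_eq[OF hausdorff act_cont[OF assms] continuous_map_id])
  then have "openin T (topspace T - {x \<in> topspace T. act g x = id x})" by blast
  moreover have "topspace T - {x \<in> topspace T. act g x = id x} = moved g"
    by (auto simp: moved_def)
  ultimately show ?thesis by simp
qed

lemma moved_subset_supp: "moved g \<subseteq> supp g"
  unfolding supp_def by (rule closure_of_subset) (rule moved_subset)

lemma moved_inv: "g \<in> carrier G \<Longrightarrow> moved (inv g) = moved g"
  unfolding moved_def by (metis act_inv_l act_inv_r)

lemma act_fixed: "x \<in> topspace T \<Longrightarrow> x \<notin> moved g \<Longrightarrow> act g x = x"
  by (auto simp: moved_def)

lemma act_fixed_inv: "g \<in> carrier G \<Longrightarrow> x \<in> topspace T \<Longrightarrow> x \<notin> moved g \<Longrightarrow> act (inv g) x = x"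
  by (metis act_fixed moved_inv)

lemma moved_invariant: "g \<in> carrier G \<Longrightarrow> x \<in> moved g \<Longrightarrow> act g x \<in> moved g"
  unfolding moved_def using act_closed act_inj by blast

section \<open>Algebraic detection of disjoint supports\<close>

lemma commute_if_disjoint:
  assumes g: "g \<in> carrier G" and h: "h \<in> carrier G" and d: "moved g \<inter> moved h = {}"
  shows "g \<otimes> h = h \<otimes> g"
proof (rule faithful)
  fix x assume x: "x \<in> topspace T"
  have "act g (act h x) = act h (act g x)"
  proof (cases "x \<in> moved h")
    case True
    then have "x \<notin> moved g" "act h x \<notin> moved g"
      using d moved_invariant[OF h] by blast+
    then show ?thesis using act_fixed x act_closed h by metis
  next
    case False
    show ?thesis
    proof (cases "x \<in> moved g")
      case True
      then have "act g x \<notin> moved h" using d moved_invariant[OF g] by blast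
      then show ?thesis using act_fixed x act_closed g False by metis
    next
      case False': False
      show ?thesis using act_fixed x False False' by metis
    qed
  qed
  then show "act (g \<otimes> h) x = act (h \<otimes> g) x" using act_mult g h x by simp
qed (use g h in auto)

text \<open>Separate \<open>x\<close> from its image under \<open>h\<close> and pull the second
  neighbourhood back along \<open>h\<close>.\<close>

lemma separate:
  assumes h: "h \<in> carrier G" and x: "act h x \<noteq> x" "openin T O'" "x \<in> O'"
  obtains U where "openin T U" "x \<in> U" "U \<subseteq> O'" "\<And>y. y \<in> U \<Longrightarrow> act h y \<notin> U"
proof -
  have xt: "x \<in> topspace T" using x openin_subset by blast
  then obtain A B where AB: "openin T A" "openin T B" "x \<in> A" "act h x \<in> B" "disjnt A B"
    using hausdorff x(1) act_closed[OF h xt] unfolding Hausdorff_space_def by metis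
  let ?U = "O' \<inter> A \<inter> {y \<in> topspace T. act h y \<in> B}"
  have "openin T {y \<in> topspace T. act h y \<in> B}"
    using openin_continuous_map_preimage[OF act_cont[OF h] AB(2)] .
  then have "openin T ?U" using x(2) AB(1) by blast
  then show ?thesis
    by (rule that) (use x AB xt in \<open>auto simp: disjnt_iff\<close>)
qed

text \<open>\<open>f2\<close> lives on a set that \<open>f1\<close> displaces, so it moves
  \<open>x\<close> and fixes the image of \<open>x\<close> under \<open>f1\<close>; the two products
  already differ at \<open>x\<close>.\<close>

lemma noncommuting:
  assumes "openin T U" "x \<in> U"
  obtains f1 f2 where "f1 \<in> carrier G" "f2 \<in> carrier G" "moved f1 \<subseteq> U" "moved f2 \<subseteq> U"
    "f1 \<otimes> f2 \<noteq> f2 \<otimes> f1"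
proof -
  obtain f1 where f1: "f1 \<in> carrier G" "act f1 x \<noteq> x" "moved f1 \<subseteq> U"
    using locally_moving[OF assms] moved_subset_supp unfolding supp_def moved_def by blast
  obtain V where V: "openin T V" "x \<in> V" "V \<subseteq> U" "\<And>y. y \<in> V \<Longrightarrow> act f1 y \<notin> V"
    using separate[OF f1(1,2) assms] by blast
  obtain f2 where f2: "f2 \<in> carrier G" "act f2 x \<noteq> x" "moved f2 \<subseteq> V"
    using locally_moving[OF V(1,2)] moved_subset_supp unfolding supp_def moved_def by blast
  have xt: "x \<in> topspace T" using assms openin_subset by blast
  have "act f2 (act f1 x) = act f1 x"
    using V(2,4) f2(3) act_fixed act_closed[OF f1(1) xt] by blast
  then have "act (f1 \<otimes> f2) x \<noteq> act (f2 \<otimes> f1) x"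
    using act_mult f1 f2 xt by (metis act_closed act_inj)
  then show ?thesis using that[OF f1(1) f2(1) f1(3)] f2(3) V(3) by fastforce
qed

text \<open>A set \<open>U\<close> of points moved by \<open>f\<close> is displaced by
  \<open>h\<close>, and \<open>f1\<close>, \<open>f2\<close> live on \<open>U\<close>. Then
  \<open>[f2, h]\<close> is \<open>f2\<close> times \<open>q\<close>, a conjugate of the inverse of
  \<open>f2\<close> by \<open>h\<close>. As \<open>q\<close> lives on the image of \<open>U\<close>,
  it commutes with \<open>f1\<close>, and the double commutator collapses to
  \<open>[f1, f2]\<close>, a nontrivial element supported away from \<open>g\<close>.\<close>

lemma alg_disjoint_if_disjoint:
  assumes f: "f \<in> carrier G" and g: "g \<in> carrier G" and d: "moved f \<inter> moved g = {}"
  shows "alg_disjoint G f g"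
  unfolding alg_disjoint_def
proof (intro ballI impI)
  fix h assume h: "h \<in> carrier G" and nc: "f \<otimes> h \<noteq> h \<otimes> f"
  obtain x where x: "x \<in> moved f" "x \<in> moved h"
    using commute_if_disjoint[OF f h] nc by blast
  obtain U where U: "openin T U" "x \<in> U" "U \<subseteq> moved f" "\<And>y. y \<in> U \<Longrightarrow> act h y \<notin> U"
    using separate[OF h _ moved_open[OF f] x(1)] x(2) by (auto simp: moved_def)
  obtain f1 f2 where ff: "f1 \<in> carrier G" "f2 \<in> carrier G" "moved f1 \<subseteq> U" "moved f2 \<subseteq> U"
    "f1 \<otimes> f2 \<noteq> f2 \<otimes> f1"
    using noncommuting[OF U(1,2)] by blast
  have c1: "f1 \<otimes> g = g \<otimes> f1" and c2: "f2 \<otimes> g = g \<otimes> f2"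
    using commute_if_disjoint ff(1-4) g U(3) d by blast+
  define q where "q = h \<otimes> inv f2 \<otimes> inv h"
  have q: "q \<in> carrier G" using h ff by (simp add: q_def)
  have qh: "q \<otimes> h = h \<otimes> inv f2" using h ff by (simp add: q_def m_assoc)
  have "moved q \<inter> moved f1 = {}"
  proof (rule ccontr)
    assume "moved q \<inter> moved f1 \<noteq> {}"
    then obtain y where y: "y \<in> moved q" "y \<in> moved f1" by blast
    have yt: "y \<in> topspace T" using y moved_subset by blast
    define z where "z = act (inv h) y"
    have zt: "z \<in> topspace T" "act h z = y" using yt h by (auto simp: z_def act_closed act_inv_r)
    have "act q y = act h (act (inv f2) z)"
      unfolding q_def z_def using h ff yt by (simp add: act_mult act_closed)
    then have "act (inv f2) z \<noteq> z" using y(1) zt by (auto simp: moved_def)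
    then have "z \<in> moved f2" using act_fixed_inv[OF ff(2)] zt by blast
    then have "z \<in> U" using ff(4) by blast
    then have "y \<notin> U" using U(4) zt(2) by blast
    then show False using y(2) ff(3) by blast
  qed
  then have qc: "q \<otimes> f1 = f1 \<otimes> q" using commute_if_disjoint q ff(1) by blast
  define k where "k = f1 \<otimes> f2 \<otimes> inv f1 \<otimes> inv f2"
  have k: "k \<in> carrier G" using ff by (simp add: k_def)
  have kf: "k \<otimes> f2 \<otimes> f1 = f1 \<otimes> f2"
    using ff by (simp add: k_def m_assoc)
  have "f2 \<otimes> h = f2 \<otimes> q \<otimes> h \<otimes> f2"
  proof -
    have "f2 \<otimes> q \<otimes> h \<otimes> f2 = f2 \<otimes> (q \<otimes> h) \<otimes> f2" using ff h q by (simp add: m_assoc)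
    also have "\<dots> = f2 \<otimes> h" unfolding qh using ff h by (simp add: m_assoc)
    finally show ?thesis by simp
  qed
  moreover have "f1 \<otimes> (f2 \<otimes> q) = k \<otimes> (f2 \<otimes> q) \<otimes> f1"
  proof -
    have "k \<otimes> (f2 \<otimes> q) \<otimes> f1 = k \<otimes> f2 \<otimes> (q \<otimes> f1)" using ff k q by (simp add: m_assoc)
    also have "\<dots> = k \<otimes> f2 \<otimes> f1 \<otimes> q" unfolding qc using ff k q by (simp add: m_assoc)
    finally show ?thesis unfolding kf using ff q by (simp add: m_assoc)
  qed
  moreover have "k \<noteq> \<one>" using kf ff by auto
  moreover have "k \<otimes> g = g \<otimes> k"
  proof -
    have "moved k \<inter> moved g = {}"
    proof -
      have "act k y = y" if y: "y \<in> moved g" for y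
      proof -
        have yt: "y \<in> topspace T" and y': "y \<notin> moved f1" "y \<notin> moved f2"
          using y d U(3) ff(3,4) moved_subset by blast+
        then show ?thesis
          unfolding k_def using ff(1,2) by (simp add: act_mult act_fixed act_fixed_inv)
      qed
      then show ?thesis by (auto simp: moved_def)
    qed
    then show ?thesis by (rule commute_if_disjoint[OF k g])
  qed
  ultimately show "\<exists>f1\<in>carrier G. \<exists>f2\<in>carrier G. \<exists>c\<in>carrier G. \<exists>k\<in>carrier G.
        f1 \<otimes> g = g \<otimes> f1 \<and> f2 \<otimes> g = g \<otimes> f2 \<and>
        f2 \<otimes> h = c \<otimes> h \<otimes> f2 \<and> f1 \<otimes> c = k \<otimes> c \<otimes> f1 \<and> k \<noteq> \<one> \<and> k \<otimes> g = g \<otimes> k"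
    using ff(1,2) c1 c2 q k by blast
qed

lemma act_pow_closed: "g \<in> carrier G \<Longrightarrow> x \<in> topspace T \<Longrightarrow> act (g [^] (n::nat)) x \<in> topspace T"
  by (simp add: act_closed)

lemma act_pow_add:
  "g \<in> carrier G \<Longrightarrow> x \<in> topspace T \<Longrightarrow> act (g [^] (m + n :: nat)) x = act (g [^] m) (act (g [^] n) x)"
  by (metis act_mult nat_pow_closed nat_pow_mult)

lemma act_pow_fixed:
  assumes "g \<in> carrier G" "x \<in> topspace T" "act (g [^] d) x = x"
  shows "act (g [^] (d * n :: nat)) x = x"
  by (induction n) (use assms in \<open>simp_all add: act_one act_pow_add act_pow_closed\<close>)

lemma moved_pow: "g \<in> carrier G \<Longrightarrow> moved (g [^] (n::nat)) \<subseteq> moved g"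
  using act_pow_fixed[of g _ 1 n] by (auto simp: moved_def)

lemma act_commute: "f \<otimes> g = g \<otimes> f \<Longrightarrow> f \<in> carrier G \<Longrightarrow> g \<in> carrier G \<Longrightarrow> x \<in> topspace T \<Longrightarrow>
  act f (act g x) = act g (act f x)"
  by (metis act_mult)

lemma inv_commute:
  assumes "t \<in> carrier G" "g \<in> carrier G" "t \<otimes> g = g \<otimes> t"
  shows "inv t \<otimes> g = g \<otimes> inv t"
proof -
  have "inv t \<otimes> g = inv t \<otimes> (g \<otimes> t) \<otimes> inv t" using assms(1,2) by (simp add: m_assoc)
  also have "\<dots> = g \<otimes> inv t" unfolding assms(3)[symmetric] using assms(1,2) by (simp add: m_assoc[symmetric])
  finally show ?thesis .
qed

text \<open>Five iterates under \<open>g\<close> compete for four places. The double commutator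
  \<open>k\<close> is built from four conjugates of \<open>h\<close> and its inverse, so every point
  that it moves is carried into \<open>U\<close> by an element of \<open>?S\<close>. Since
  \<open>k\<close> commutes with \<open>g\<close>, all iterates of a moved point are moved, and two
  of five iterates are carried into \<open>U\<close> by the same element, which commutes with
  \<open>g\<close> as well. So some power of \<open>g\<close> with exponent between 1 and 4 takes a
  point of \<open>U\<close> into \<open>U\<close>, against the choice of \<open>U\<close>.\<close>

lemma disjoint_if_alg_disjoint:
  assumes f: "f \<in> carrier G" and g: "g \<in> carrier G" and ad: "alg_disjoint G f g"
  shows "moved f \<inter> moved (g [^] (12::nat)) = {}"
proof (rule ccontr)
  assume "moved f \<inter> moved (g [^] (12::nat)) \<noteq> {}"
  then obtain x where xf: "x \<in> moved f" and x12: "act (g [^] (12::nat)) x \<noteq> x" and xt: "x \<in> topspace T"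
    by (auto simp: moved_def)
  \<comment> \<open>The exponents 1, 2, 3 and 4 used below divide 12, so none of these powers of
    \<open>g\<close> fixes \<open>x\<close>.\<close>
  have gd: "act (g [^] d) x \<noteq> x" if "d dvd 12" for d :: nat
    using that x12 act_pow_fixed[OF g xt] by (metis dvdE)
  have gc: "g [^] (d::nat) \<in> carrier G" for d using g by simp
  obtain U0 where U0: "openin T U0" "x \<in> U0" "U0 \<subseteq> topspace T" "\<And>y. y \<in> U0 \<Longrightarrow> act f y \<notin> U0"
    using separate[OF f _ openin_topspace xt] xf by (auto simp: moved_def)
  obtain U1 where U1: "openin T U1" "x \<in> U1" "U1 \<subseteq> U0" "\<And>y. y \<in> U1 \<Longrightarrow> act (g [^] (1::nat)) y \<notin> U1"
    using separate[OF gc gd U0(1,2), of 1] by (metis one_dvd)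
  obtain U2 where U2: "openin T U2" "x \<in> U2" "U2 \<subseteq> U1" "\<And>y. y \<in> U2 \<Longrightarrow> act (g [^] (2::nat)) y \<notin> U2"
    using separate[OF gc gd U1(1,2), of 2] by auto
  obtain U3 where U3: "openin T U3" "x \<in> U3" "U3 \<subseteq> U2" "\<And>y. y \<in> U3 \<Longrightarrow> act (g [^] (3::nat)) y \<notin> U3"
    using separate[OF gc gd U2(1,2), of 3] by auto
  obtain U where U: "openin T U" "x \<in> U" "U \<subseteq> U3" "\<And>y. y \<in> U \<Longrightarrow> act (g [^] (4::nat)) y \<notin> U"
    using separate[OF gc gd U3(1,2), of 4] by auto
  have Ug: "act (g [^] d) y \<notin> U" if "y \<in> U" "d \<in> {1..4}" for d :: nat and y
  proof -
    have "d = 1 \<or> d = 2 \<or> d = 3 \<or> d = 4" using that(2) by auto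
    then show ?thesis
    proof (elim disjE)
      assume "d = 1"
      then show ?thesis using that(1) U(3) U3(3) U2(3) U1(4) by (metis subsetD)
    next
      assume "d = 2"
      then show ?thesis using that(1) U(3) U3(3) U2(4) by (metis subsetD)
    next
      assume "d = 3"
      then show ?thesis using that(1) U(3) U3(4) by (metis subsetD)
    next
      assume "d = 4"
      then show ?thesis using that(1) U(4) by metis
    qed
  qed
  have Uf: "act f y \<notin> U" if "y \<in> U" for y
    using that U(3) U3(3) U2(3) U1(3) U0(4) by (metis subsetD)
  obtain h where h: "h \<in> carrier G" "act h x \<noteq> x" "moved h \<subseteq> U"
    using locally_moving[OF U(1,2)] moved_subset_supp unfolding supp_def moved_def by blast
  have "act (f \<otimes> h) x \<noteq> act (h \<otimes> f) x"
  proof -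
    have "act h (act f x) = act f x" 
      using Uf[OF U(2)] h(3) act_fixed act_closed[OF f xt] by blast
    then show ?thesis using h f xt by (metis act_mult act_closed act_inj)
  qed
  then have "f \<otimes> h \<noteq> h \<otimes> f" by auto
  then obtain f1 f2 c k where ff: "f1 \<in> carrier G" "f2 \<in> carrier G" "c \<in> carrier G" "k \<in> carrier G"
      "f1 \<otimes> g = g \<otimes> f1" "f2 \<otimes> g = g \<otimes> f2"
      "f2 \<otimes> h = c \<otimes> h \<otimes> f2" "f1 \<otimes> c = k \<otimes> c \<otimes> f1" "k \<noteq> \<one>" "k \<otimes> g = g \<otimes> k"
    using ad h(1) unfolding alg_disjoint_def by metis
  \<comment> \<open>\<open>c\<close> is the conjugate of \<open>h\<close> by \<open>f2\<close> times
    the inverse of \<open>h\<close>, so it can move \<open>p\<close> only if \<open>p\<close> or its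
    preimage under \<open>f2\<close> lies in \<open>U\<close>. The same argument for
    \<open>k\<close> doubles the number of places to four.\<close>
  have c_fix: "act c p = p" if p: "p \<in> topspace T" "p \<notin> U" "act (inv f2) p \<notin> U" for p
  proof -
    define q where "q = act (inv f2) p"
    have q: "q \<in> topspace T" "act f2 q = p" using p ff by (auto simp: q_def act_closed act_inv_r)
    have "act h q = q" using p(3) h(3) q act_fixed by (auto simp: q_def)
    moreover have "act h p = p" using p h(3) act_fixed by blast
    moreover have "act f2 (act h q) = act c (act h (act f2 q))"
      using arg_cong[OF ff(7), of "\<lambda>w. act w q"] q p(1) ff(1-4) h by (simp add: act_mult act_closed)
    ultimately show ?thesis using q by metis
  qed
  have k_fix: "act k p = p" if p: "p \<in> topspace T" "p \<notin> U" "act (inv f2) p \<notin> U"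
     "act (inv f1) p \<notin> U" "act (inv f2) (act (inv f1) p) \<notin> U" for p
  proof -
    define q where "q = act (inv f1) p"
    have q: "q \<in> topspace T" "act f1 q = p" using p ff by (auto simp: q_def act_closed act_inv_r)
    have "act c q = q" using c_fix p q by (auto simp: q_def)
    moreover have "act c p = p" using c_fix p by blast
    moreover have "act f1 (act c q) = act k (act c (act f1 q))"
      using arg_cong[OF ff(8), of "\<lambda>w. act w q"] q p(1) ff(1-4) h by (simp add: act_mult act_closed)
    ultimately show ?thesis using q by metis
  qed
  obtain p where p: "p \<in> topspace T" "act k p \<noteq> p"
    using faithful[OF ff(4) one_closed] ff(9) act_one by metis
  define P where "P a = act (g [^] (a::nat)) p" for a
  have Pt: "P a \<in> topspace T" for a using p g by (simp add: P_def act_pow_closed)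
  have gcomm: "t \<otimes> (g [^] (a::nat)) = (g [^] a) \<otimes> t" if "t \<in> carrier G" "t \<otimes> g = g \<otimes> t" for t a
    using that g by (simp add: group_commutes_pow)
  \<comment> \<open>Commuting with \<open>g\<close> makes the set of points moved by
    \<open>k\<close> invariant under \<open>g\<close>.\<close>
  have Pk: "act k (P a) \<noteq> P a" for a
  proof
    assume "act k (P a) = P a"
    then have "act (g [^] a) (act k p) = act (g [^] a) p"
      unfolding P_def using act_commute[OF gcomm[OF ff(4,10)] ff(4) gc p(1)] by simp
    then show False using p act_inj[OF gc] act_closed[OF ff(4)] by blast
  qed
  have i1: "inv f1 \<otimes> g = g \<otimes> inv f1"
    by (rule inv_commute[OF ff(1) g ff(5)])
  have i2: "inv f2 \<otimes> g = g \<otimes> inv f2"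
    by (rule inv_commute[OF ff(2) g ff(6)])
  let ?S = "{\<one>, inv f2, inv f1, inv f2 \<otimes> inv f1}"
  have S: "t \<in> carrier G \<and> t \<otimes> g = g \<otimes> t" if "t \<in> ?S" for t
  proof -
    have "inv f2 \<otimes> inv f1 \<otimes> g = g \<otimes> (inv f2 \<otimes> inv f1)"
      using i1 i2 ff(1,2) g by (metis inv_closed m_assoc)
    then show ?thesis using that i1 i2 ff(1,2) g by auto
  qed
  have "\<exists>t\<in>?S. act t (P a) \<in> U" for a
    using k_fix[OF Pt, of a] Pk[of a] ff(1,2) Pt[of a] by (auto simp: act_one act_mult)
  then obtain t where t: "\<And>a. t a \<in> ?S" "\<And>a. act (t a) (P a) \<in> U" by metis
  \<comment> \<open>Pigeonhole: five exponents and at most four elements of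
    \<open>?S\<close>.\<close>
  have "\<not> inj_on t {0..4::nat}"
  proof
    assume "inj_on t {0..4::nat}"
    then have "card {0..4::nat} \<le> card ?S" using t(1) by (intro card_inj_on_le) auto
    also have "\<dots> \<le> 4" by (simp add: card_insert_if)
    finally show False by simp
  qed
  then obtain a b where ab: "a < b" "b \<le> 4" "t a = t b"
    unfolding inj_on_def by (metis atLeastAtMost_iff linorder_neqE_nat)
  have ta: "t a \<in> carrier G" "t a \<otimes> g = g \<otimes> t a" using S t(1) by blast+
  have "P b = act (g [^] (b - a)) (P a)"
    unfolding P_def using ab(1) act_pow_add[OF g p(1), of "b - a" a] by simp
  then have "act (t b) (P b) = act (g [^] (b - a)) (act (t a) (P a))"
    using act_commute[OF gcomm[OF ta] ta(1) gc Pt] ab(3) by simp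
  moreover have "b - a \<in> {1..4}" using ab by auto
  ultimately show False using t(2)[of a] t(2)[of b] Ug by metis
qed

section \<open>Inclusion of supports in the language of groups\<close>

lemma supp_closed: "closedin T (supp g)"
  by (simp add: supp_def)

lemma supp_openin: "g \<in> carrier G \<Longrightarrow> openin T (supp g)"
  using supp_open by (simp add: supp_def moved_def)

lemma supp_compactin: "g \<in> carrier G \<Longrightarrow> compactin T (supp g)"
  using supp_compact by (simp add: supp_def moved_def)

text \<open>The points moved by a twelfth power form an open set, so missing the moved points of
  \<open>f\<close> amounts to missing their closure. Conversely, a point moved by \<open>g\<close>
  outside \<open>supp f\<close> has a neighbourhood that \<open>g\<close> displaces. An element
  \<open>k\<close> supported there is algebraically disjoint from \<open>f\<close>, and if its
  twelfth power is nontrivial, that power does not commute with \<open>g\<close>.\<close>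

lemma supp_le_iff:
  assumes g: "g \<in> carrier G" and f: "f \<in> carrier G"
  shows "supp_le G g f \<longleftrightarrow> supp g \<subseteq> supp f"
proof
  assume le: "supp g \<subseteq> supp f"
  show "supp_le G g f"
    unfolding supp_le_def
  proof (intro ballI impI)
    fix k assume k: "k \<in> carrier G" "alg_disjoint G f k"
    have kc: "k [^] (12::nat) \<in> carrier G" using k by simp
    have "moved (k [^] (12::nat)) \<inter> moved f = {}" using disjoint_if_alg_disjoint[OF f k] by blast
    then have "moved (k [^] (12::nat)) \<inter> supp f = {}"
      unfolding supp_def using openin_Int_closure_of_eq_empty[OF moved_open[OF kc]] by blast
    then have "moved g \<inter> moved (k [^] (12::nat)) = {}"
      using le moved_subset_supp by blast
    then show "g \<otimes> (k [^] (12::nat)) = (k [^] (12::nat)) \<otimes> g"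
      by (rule commute_if_disjoint[OF g kc])
  qed
next
  assume le: "supp_le G g f"
  have "moved g \<subseteq> supp f"
  proof (rule ccontr)
    assume "\<not> moved g \<subseteq> supp f"
    then obtain x where x: "x \<in> moved g - supp f" by blast
    have "openin T (moved g - supp f)" using moved_open[OF g] supp_closed by (rule openin_diff)
    then obtain U where U: "openin T U" "x \<in> U" "U \<subseteq> moved g - supp f" "\<And>y. y \<in> U \<Longrightarrow> act g y \<notin> U"
      using separate[OF g _ _ x] x by (auto simp: moved_def)
    obtain k where k: "k \<in> carrier G" "k [^] (12::nat) \<noteq> \<one>" "moved k \<subseteq> U"
      using exponent12[OF U(1,2)] by (auto simp: moved_def)
    have "moved f \<inter> moved k = {}" using k(3) U(3) moved_subset_supp by blast
    then have "alg_disjoint G f k" using alg_disjoint_if_disjoint f k by blast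
    then have c: "g \<otimes> (k [^] (12::nat)) = (k [^] (12::nat)) \<otimes> g" using le k unfolding supp_le_def by blast
    have kc: "k [^] (12::nat) \<in> carrier G" using k by simp
    obtain y where y: "y \<in> topspace T" "act (k [^] (12::nat)) y \<noteq> y"
      using faithful[OF kc one_closed] k(2) act_one by metis
    have "y \<in> U" using y moved_pow[OF k(1)] k(3) by (auto simp: moved_def)
    then have "act g y \<notin> moved (k [^] (12::nat))" using U(4) moved_pow[OF k(1)] k(3) by blast
    then have "act (k [^] (12::nat)) (act g y) = act g y" using act_fixed act_closed[OF g y(1)] by blast
    then show False using act_commute[OF c g kc y(1)] act_inj[OF g] y act_closed[OF kc] by metis
  qed
  then show "supp g \<subseteq> supp f" unfolding supp_def[of g] by (rule closure_of_minimal[OF _ supp_closed])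
qed

section \<open>Points as maximal centered families\<close>

definition point_family :: "'x \<Rightarrow> 'a set" where
  "point_family x = {f \<in> carrier G. x \<in> supp f}"

lemma supp_in:
  assumes "openin T U" "x \<in> U"
  obtains g where "g \<in> carrier G" "x \<in> supp g" "supp g \<subseteq> U" "g \<noteq> \<one>"
proof -
  obtain g where g: "g \<in> carrier G" "act g x \<noteq> x" "supp g \<subseteq> U"
    using locally_moving[OF assms] unfolding supp_def moved_def by blast
  have xt: "x \<in> topspace T" using assms openin_subset by blast
  then have "x \<in> supp g" using g moved_subset_supp by (auto simp: moved_def)
  moreover have "g \<noteq> \<one>" using g act_one xt by blast
  ultimately show ?thesis using that g by blast
qed

text \<open>Here openness of the supports is essential: finitely many supports containing
  \<open>x\<close> intersect in a neighbourhood of \<open>x\<close>, and a nontrivial element can be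
  supported inside it.\<close>

lemma point_family_centered:
  assumes "x \<in> topspace T"
  shows "centered G (point_family x)"
  unfolding centered_def
proof (intro conjI allI impI)
  show "point_family x \<subseteq> carrier G" by (auto simp: point_family_def)
  show "point_family x \<noteq> {}" using supp_in[OF openin_topspace assms] unfolding point_family_def by blast
  fix B assume B: "finite B \<and> B \<subseteq> point_family x"
  \<comment> \<open>Intersecting with the space takes care of empty \<open>B\<close>, for which the
    intersection of supports alone is the universe of the type.\<close>
  let ?U = "topspace T \<inter> \<Inter>(supp ` B)"
  have "openin T ?U"
    using B by (intro openin_Int_Inter) (auto simp: point_family_def supp_openin)
  moreover have "x \<in> ?U" using B assms by (auto simp: point_family_def)
  ultimately obtain g where g: "g \<in> carrier G" "supp g \<subseteq> ?U" "g \<noteq> \<one>"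
    using supp_in by metis
  have "supp_le G g f" if "f \<in> B" for f
    using supp_le_iff[OF g(1), of f] g(2) B that unfolding point_family_def by blast
  then show "\<exists>g\<in>carrier G. g \<noteq> \<one> \<and> (\<forall>f\<in>B. supp_le G g f)" using g by blast
qed

text \<open>Compactness of the support of one member turns the finite intersection property into a
  common point of all supports.\<close>

lemma centered_subset_point_family:
  assumes A: "centered G A"
  shows "\<exists>x\<in>topspace T. A \<subseteq> point_family x"
proof -
  have Ac: "A \<subseteq> carrier G" "A \<noteq> {}" using A by (auto simp: centered_def)
  then obtain f0 where f0: "f0 \<in> A" by blast
  have fip: "supp f0 \<inter> \<Inter>\<F> \<noteq> {}" if \<F>: "finite \<F>" "\<F> \<subseteq> supp ` A" for \<F>
  proof -
    obtain B where B: "finite B" "B \<subseteq> A" "\<F> = supp ` B"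
      using finite_subset_image[OF \<F>] by blast
    then have "finite (insert f0 B)" "insert f0 B \<subseteq> A" using f0 by auto
    then obtain g where g: "g \<in> carrier G" "g \<noteq> \<one>" "\<forall>f\<in>insert f0 B. supp_le G g f"
      using A unfolding centered_def by meson
    have "supp g \<subseteq> supp f" if "f \<in> insert f0 B" for f
      using g that supp_le_iff[OF g(1)] f0 B(2) Ac(1) by blast
    then have s: "supp g \<subseteq> supp f0 \<inter> \<Inter>\<F>" using B(3) by blast
    obtain x where "x \<in> topspace T" "act g x \<noteq> x"
      using faithful[OF g(1) one_closed] g(2) act_one by metis
    then have "x \<in> supp g" using moved_subset_supp by (auto simp: moved_def)
    then show ?thesis using s by blast
  qed
  have "compactin T (supp f0)" using supp_compactin f0 Ac by blast
  then have "supp f0 \<inter> \<Inter>(supp ` A) \<noteq> {}"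
    unfolding compactin_fip using fip supp_closed by blast
  then obtain x where "x \<in> supp f0" "\<forall>f\<in>A. x \<in> supp f" by blast
  moreover have "x \<in> topspace T" using calculation(1) closedin_subset[OF supp_closed] by blast
  ultimately show ?thesis using Ac by (auto simp: point_family_def)
qed

lemma point_family_subset_imp_eq:
  assumes x: "x \<in> topspace T" and y: "y \<in> topspace T" and le: "point_family x \<subseteq> point_family y"
  shows "x = y"
proof (rule ccontr)
  assume "x \<noteq> y"
  then obtain U V where UV: "openin T U" "openin T V" "x \<in> U" "y \<in> V" "disjnt U V"
    using hausdorff x y unfolding Hausdorff_space_def by metis
  obtain g where "g \<in> carrier G" "x \<in> supp g" "supp g \<subseteq> U" using supp_in[OF UV(1,3)] by metis
  then have "g \<in> point_family x" "g \<notin> point_family y" using UV by (auto simp: point_family_def disjnt_iff)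
  then show False using le by blast
qed

text \<open>Every centered family lies in some point family, and the point families of distinct
  points are incomparable, so nothing lies strictly above a point family.\<close>

lemma max_centered_iff: "max_centered G A \<longleftrightarrow> (\<exists>x\<in>topspace T. A = point_family x)"
proof
  assume A: "max_centered G A"
  then obtain x where x: "x \<in> topspace T" "A \<subseteq> point_family x"
    using centered_subset_point_family unfolding max_centered_def by blast
  then show "\<exists>x\<in>topspace T. A = point_family x"
    using A point_family_centered[OF x(1)] unfolding max_centered_def by metis
next
  assume "\<exists>x\<in>topspace T. A = point_family x"
  then obtain x where x: "x \<in> topspace T" "A = point_family x" by blast
  have "A' = A" if "centered G A'" "A \<subseteq> A'" for A'
  proof -
    obtain y where y: "y \<in> topspace T" "A' \<subseteq> point_family y" using centered_subset_point_family[OF \<open>centered G A'\<close>] by blast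
    then have "x = y" using point_family_subset_imp_eq[OF x(1)] that(2) x(2) by blast
    then show ?thesis using y that(2) x(2) by blast
  qed
  then show "max_centered G A" using point_family_centered[OF x(1)] x(2) unfolding max_centered_def by blast
qed

text \<open>This recovers the action and not only the space: the support of \<open>f\<close> seen
  from the image of \<open>x\<close> is the support of a conjugate of \<open>f\<close> seen from
  \<open>x\<close>.\<close>

lemma supp_conj:
  assumes f: "f \<in> carrier G" and g: "g \<in> carrier G" and x: "x \<in> topspace T"
  shows "act g x \<in> supp f \<longleftrightarrow> x \<in> supp (inv g \<otimes> f \<otimes> g)"
proof -
  have "moved f = act g ` moved (inv g \<otimes> f \<otimes> g)"
  proof (intro equalityI subsetI)
    fix y assume y: "y \<in> moved f"
    then have yt: "y \<in> topspace T" using moved_subset by blast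
    have "act (inv g) y \<in> moved (inv g \<otimes> f \<otimes> g)"
      unfolding moved_def using y yt f g
      by (auto simp: act_mult act_closed act_inv_r moved_def dest: act_inj[OF inv_closed[OF g] act_closed[OF f yt] yt])
    then show "y \<in> act g ` moved (inv g \<otimes> f \<otimes> g)" using act_inv_r[OF g yt] by (metis imageI)
  next
    fix y assume "y \<in> act g ` moved (inv g \<otimes> f \<otimes> g)"
    then show "y \<in> moved f"
      using f g by (auto simp: moved_def act_mult act_closed act_inv_l)
  qed
  then have "supp f = act g ` supp (inv g \<otimes> f \<otimes> g)"
    unfolding supp_def using homeomorphic_map_closure_of[OF act_homeo[OF g] moved_subset] by simp
  moreover have "supp (inv g \<otimes> f \<otimes> g) \<subseteq> topspace T" using closedin_subset[OF supp_closed] .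
  ultimately show ?thesis using act_inj[OF g x] by blast
qed

end

section \<open>Transport of the algebraic notions along a group isomorphism\<close>

lemma alg_disjoint_iso:
  assumes G: "group G" and H: "group H" and i: "i \<in> iso G H" and f: "f \<in> carrier G" and g: "g \<in> carrier G"
  shows "alg_disjoint H (i f) (i g) \<longleftrightarrow> alg_disjoint G f g"
proof -
  interpret G: group G by fact
  interpret H: group H by fact
  interpret group_hom G H i using i by unfold_locales (simp add: iso_def)
  have inj: "inj_on i (carrier G)" and im: "carrier H = i ` carrier G"
    using i by (auto simp: iso_def bij_betw_def)
  have eq: "i a = i b \<longleftrightarrow> a = b" if "a \<in> carrier G" "b \<in> carrier G" for a b
    using inj that by (auto simp: inj_on_def)
  have one: "i a = \<one>\<^bsub>H\<^esub> \<longleftrightarrow> a = \<one>\<^bsub>G\<^esub>" if "a \<in> carrier G" for a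
    using eq[OF that G.one_closed] by simp
  \<comment> \<open>The notion is a first-order formula in the group operation: surjectivity of
    \<open>i\<close> rewrites the quantifiers over \<open>H\<close>, and injectivity the equations
    and inequations.\<close>
  show ?thesis unfolding alg_disjoint_def im ball_simps bex_simps
    using f g by (simp add: hom_mult[symmetric] eq one del: hom_mult cong: conj_cong)
qed

lemma supp_le_iso:
  assumes G: "group G" and H: "group H" and i: "i \<in> iso G H" and f: "f \<in> carrier G" and g: "g \<in> carrier G"
  shows "supp_le H (i g) (i f) \<longleftrightarrow> supp_le G g f"
proof -
  interpret G: group G by fact
  interpret H: group H by fact
  interpret group_hom G H i using i by unfold_locales (simp add: iso_def)
  have inj: "inj_on i (carrier G)" and im: "carrier H = i ` carrier G"
    using i by (auto simp: iso_def bij_betw_def)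
  have eq: "i a = i b \<longleftrightarrow> a = b" if "a \<in> carrier G" "b \<in> carrier G" for a b
    using inj that by (auto simp: inj_on_def)
  show ?thesis unfolding supp_le_def im ball_simps
    using f g by (simp add: hom_mult[symmetric] hom_nat_pow[symmetric] alg_disjoint_iso[OF G H i] eq
        del: hom_mult hom_nat_pow cong: conj_cong)
qed

lemma centered_iso:
  assumes G: "group G" and H: "group H" and i: "i \<in> iso G H" and A: "A \<subseteq> carrier G"
  shows "centered H (i ` A) \<longleftrightarrow> centered G A"
proof -
  interpret G: group G by fact
  interpret H: group H by fact
  interpret group_hom G H i using i by unfold_locales (simp add: iso_def)
  have inj: "inj_on i (carrier G)" and im: "carrier H = i ` carrier G"
    using i by (auto simp: iso_def bij_betw_def)
  have one: "i a = \<one>\<^bsub>H\<^esub> \<longleftrightarrow> a = \<one>\<^bsub>G\<^esub>" if "a \<in> carrier G" for a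
    using inj that by (metis G.one_closed hom_one inj_on_def)
  have ex: "(\<exists>g\<in>carrier H. g \<noteq> \<one>\<^bsub>H\<^esub> \<and> (\<forall>f\<in>i ` B. supp_le H g f)) \<longleftrightarrow>
        (\<exists>g\<in>carrier G. g \<noteq> \<one>\<^bsub>G\<^esub> \<and> (\<forall>f\<in>B. supp_le G g f))" if "B \<subseteq> A" for B
  proof -
    have "B \<subseteq> carrier G" using that A by blast
    then have "\<And>g f. g \<in> carrier G \<Longrightarrow> f \<in> B \<Longrightarrow> supp_le H (i g) (i f) \<longleftrightarrow> supp_le G g f"
      using supp_le_iso[OF G H i] by blast
    then show ?thesis unfolding im bex_simps ball_simps using one by auto
  qed
  have "(\<forall>B. finite B \<and> B \<subseteq> i ` A \<longrightarrow> (\<exists>g\<in>carrier H. g \<noteq> \<one>\<^bsub>H\<^esub> \<and> (\<forall>f\<in>B. supp_le H g f))) \<longleftrightarrow>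
     (\<forall>B. finite B \<and> B \<subseteq> A \<longrightarrow> (\<exists>g\<in>carrier G. g \<noteq> \<one>\<^bsub>G\<^esub> \<and> (\<forall>f\<in>B. supp_le G g f)))" (is "?L = ?R")
  proof
    assume L: ?L
    show ?R
    proof (intro allI impI)
      fix B assume "finite B \<and> B \<subseteq> A"
      then have "finite (i ` B) \<and> i ` B \<subseteq> i ` A" by blast
      then show "\<exists>g\<in>carrier G. g \<noteq> \<one>\<^bsub>G\<^esub> \<and> (\<forall>f\<in>B. supp_le G g f)"
        using L ex \<open>finite B \<and> B \<subseteq> A\<close> by blast
    qed
  next
    assume R: ?R
    show ?L
    proof (intro allI impI)
      fix B assume B: "finite B \<and> B \<subseteq> i ` A"
      then obtain C where "C \<subseteq> A" "finite C" "B = i ` C" using finite_subset_image by metis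
      then show "\<exists>g\<in>carrier H. g \<noteq> \<one>\<^bsub>H\<^esub> \<and> (\<forall>f\<in>B. supp_le H g f)" using R ex by blast
    qed
  qed
  moreover have "i ` A \<subseteq> carrier H" using A im by blast
  ultimately show ?thesis unfolding centered_def using A by simp
qed

lemma max_centered_iso:
  assumes G: "group G" and H: "group H" and i: "i \<in> iso G H" and A: "max_centered G A"
  shows "max_centered H (i ` A)"
  unfolding max_centered_def
proof (intro conjI allI impI)
  have inj: "inj_on i (carrier G)" and im: "carrier H = i ` carrier G"
    using i by (auto simp: iso_def bij_betw_def)
  have Ac: "A \<subseteq> carrier G" using A by (auto simp: max_centered_def centered_def)
  show "centered H (i ` A)" using A centered_iso[OF G H i Ac] by (auto simp: max_centered_def)
  fix A' assume A': "centered H A' \<and> i ` A \<subseteq> A'"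
  then have "A' \<subseteq> i ` carrier G" using im by (auto simp: centered_def)
  then obtain B where B: "B \<subseteq> carrier G" "A' = i ` B" by (metis subset_imageE)
  then have "centered G B" using A' centered_iso[OF G H i] by blast
  moreover have "A \<subseteq> B" using A' B Ac inj by (metis inj_on_image_subset_iff)
  ultimately show "A' = i ` A" using A B by (auto simp: max_centered_def)
qed

text \<open>The isomorphism maps maximal centered families to maximal centered families, hence
  points to points. The supports inside an open set cover it on both sides and correspond to each
  other, which makes the bijection continuous and open.\<close>

theorem spatial_realization:
  assumes GT: "rubin_action G T a" and HS: "rubin_action H S b" and i: "i \<in> iso G H"
  shows "\<exists>\<Phi>. homeomorphic_map T S \<Phi> \<and>
    (\<forall>g\<in>carrier G. \<forall>x\<in>topspace T. \<Phi> (a g x) = b (i g) (\<Phi> x))"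
proof -
  interpret G: rubin_action G T a by fact
  interpret H: rubin_action H S b by fact
  have G: "group G" and H: "group H" by unfold_locales
  interpret hom: group_hom G H i using i by unfold_locales (simp add: iso_def)
  have inj: "inj_on i (carrier G)" and im: "carrier H = i ` carrier G"
    using i by (auto simp: iso_def bij_betw_def)
  have point_family_c: "G.point_family x \<subseteq> carrier G" for x by (auto simp: G.point_family_def)
  have "\<exists>y\<in>topspace S. i ` G.point_family x = H.point_family y" if "x \<in> topspace T" for x
    using max_centered_iso[OF G H i, of "G.point_family x"] G.max_centered_iff H.max_centered_iff that by blast
  then obtain \<Phi> where \<Phi>: "\<And>x. x \<in> topspace T \<Longrightarrow> \<Phi> x \<in> topspace S"
      "\<And>x. x \<in> topspace T \<Longrightarrow> i ` G.point_family x = H.point_family (\<Phi> x)" by metis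
  have mem: "\<Phi> x \<in> H.supp (i f) \<longleftrightarrow> x \<in> G.supp f" if "x \<in> topspace T" "f \<in> carrier G" for x f
  proof -
    have "\<Phi> x \<in> H.supp (i f) \<longleftrightarrow> i f \<in> i ` G.point_family x"
      using \<Phi>(2)[OF that(1)] that(2) by (auto simp: H.point_family_def)
    also have "\<dots> \<longleftrightarrow> f \<in> G.point_family x" using inj point_family_c that(2) by (metis inj_on_image_mem_iff)
    finally show ?thesis using that by (simp add: G.point_family_def)
  qed
  have surj: "\<exists>x\<in>topspace T. \<Phi> x = y" if y: "y \<in> topspace S" for y
  proof -
    have "inv_into (carrier G) i \<in> iso H G" using G.iso_set_sym[OF i] .
    then have "max_centered G (inv_into (carrier G) i ` H.point_family y)"
      using max_centered_iso[OF H G] H.max_centered_iff y by blast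
    then obtain x where x: "x \<in> topspace T" "inv_into (carrier G) i ` H.point_family y = G.point_family x"
      using G.max_centered_iff by blast
    have "H.point_family y \<subseteq> i ` carrier G" using im by (auto simp: H.point_family_def)
    then have "i ` G.point_family x = H.point_family y" unfolding x(2)[symmetric] by (rule image_inv_into_cancel[OF refl])
    then have "H.point_family (\<Phi> x) = H.point_family y" using \<Phi>(2)[OF x(1)] by simp
    then show ?thesis using H.point_family_subset_imp_eq[OF \<Phi>(1)[OF x(1)] y] x(1) by blast
  qed
  have injp: "inj_on \<Phi> (topspace T)"
  proof (rule inj_onI)
    fix x y assume xy: "x \<in> topspace T" "y \<in> topspace T" "\<Phi> x = \<Phi> y"
    then have "i ` G.point_family x = i ` G.point_family y" using \<Phi>(2) by metis
    then have "G.point_family x = G.point_family y" using inj point_family_c by (metis inj_on_image_eq_iff)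
    then show "x = y" using G.point_family_subset_imp_eq xy by blast
  qed
  have cont: "continuous_map T S \<Phi>"
    unfolding continuous_map_def
  proof (intro conjI allI impI)
    show "\<Phi> \<in> topspace T \<rightarrow> topspace S" using \<Phi>(1) by blast
    fix V assume V: "openin S V"
    show "openin T {x \<in> topspace T. \<Phi> x \<in> V}"
    proof (subst openin_subopen, intro ballI)
      fix x assume x: "x \<in> {x \<in> topspace T. \<Phi> x \<in> V}"
      then obtain g where g: "g \<in> carrier H" "\<Phi> x \<in> H.supp g" "H.supp g \<subseteq> V"
        using H.supp_in[OF V, of "\<Phi> x"] by blast
      then obtain f where f: "f \<in> carrier G" "g = i f" using im by blast
      have "openin T (G.supp f)" "x \<in> G.supp f" "G.supp f \<subseteq> {x \<in> topspace T. \<Phi> x \<in> V}"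
        using G.supp_openin[OF f(1)] mem f g x closedin_subset[OF G.supp_closed] by blast+
      then show "\<exists>W. openin T W \<and> x \<in> W \<and> W \<subseteq> {x \<in> topspace T. \<Phi> x \<in> V}" by blast
    qed
  qed
  have op: "open_map T S \<Phi>"
    unfolding open_map_def
  proof (intro allI impI)
    fix U assume U: "openin T U"
    show "openin S (\<Phi> ` U)"
    proof (subst openin_subopen, intro ballI)
      fix y assume "y \<in> \<Phi> ` U"
      then obtain x where x: "x \<in> U" "y = \<Phi> x" by blast
      then obtain f where f: "f \<in> carrier G" "x \<in> G.supp f" "G.supp f \<subseteq> U"
        using G.supp_in[OF U] by blast
      have fc: "i f \<in> carrier H" using im f by blast
      have "H.supp (i f) \<subseteq> \<Phi> ` U"
      proof
        fix z assume z: "z \<in> H.supp (i f)"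
        then obtain w where w: "w \<in> topspace T" "z = \<Phi> w"
          using surj closedin_subset[OF H.supp_closed] by blast
        then show "z \<in> \<Phi> ` U" using mem[OF w(1) f(1)] z f(3) by blast
      qed
      moreover have "y \<in> H.supp (i f)" using mem f x openin_subset[OF U] by blast
      ultimately show "\<exists>W. openin S W \<and> y \<in> W \<and> W \<subseteq> \<Phi> ` U" using H.supp_openin[OF fc] by blast
    qed
  qed
  have "homeomorphic_map T S \<Phi>"
    using bijective_open_imp_homeomorphic_map[OF cont op _ injp] \<Phi>(1) surj by blast
  moreover have "\<Phi> (a g x) = b (i g) (\<Phi> x)" if g: "g \<in> carrier G" and x: "x \<in> topspace T" for g x
  proof -
    have gx: "a g x \<in> topspace T" using G.act_closed g x .
    have ig: "i g \<in> carrier H" using g by simp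
    have bx: "b (i g) (\<Phi> x) \<in> topspace S" using H.act_closed ig \<Phi>(1) x by blast
    \<comment> \<open>Equivariance is tested on supports, since a point is determined by the
      supports that contain it; conjugation moves \<open>g\<close> from the point to the
      element.\<close>
    have "\<Phi> (a g x) \<in> H.supp (i f) \<longleftrightarrow> b (i g) (\<Phi> x) \<in> H.supp (i f)" if f: "f \<in> carrier G" for f
    proof -
      have "\<Phi> (a g x) \<in> H.supp (i f) \<longleftrightarrow> \<Phi> x \<in> H.supp (i (inv\<^bsub>G\<^esub> g \<otimes>\<^bsub>G\<^esub> f \<otimes>\<^bsub>G\<^esub> g))"
        using mem[OF gx f] mem[OF x] f g x G.supp_conj[OF f g x] by (simp del: hom.hom_mult)
      also have "i (inv\<^bsub>G\<^esub> g \<otimes>\<^bsub>G\<^esub> f \<otimes>\<^bsub>G\<^esub> g) = inv\<^bsub>H\<^esub> (i g) \<otimes>\<^bsub>H\<^esub> i f \<otimes>\<^bsub>H\<^esub> i g"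
        using f g by simp
      finally show ?thesis using H.supp_conj[OF _ ig \<Phi>(1)[OF x]] f by simp
    qed
    then have "H.point_family (\<Phi> (a g x)) = H.point_family (b (i g) (\<Phi> x))" unfolding H.point_family_def im by auto
    then show ?thesis using H.point_family_subset_imp_eq[OF \<Phi>(1)[OF gx] bx] by blast
  qed
  ultimately show ?thesis by blast
qed

section \<open>Boundary paths\<close>

fun st :: "('v, 'e) graph \<Rightarrow> ('v, 'e) bpath \<Rightarrow> 'v" where
  "st E (FinP v es) = v"
| "st E (InfP x) = src E (x 0)"

text \<open>With an option value, finite and infinite paths are handled alike: \<open>None\<close>
  marks positions past the end, and equality of paths is equality of the start vertex and of all
  \<open>ed\<close> values.\<close>

fun ed :: "('v, 'e) bpath \<Rightarrow> nat \<Rightarrow> 'e option" where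
  "ed (FinP v es) i = (if i < length es then Some (es ! i) else None)"
| "ed (InfP x) i = Some (x i)"

text \<open>The vertex is read off the incoming edge and not the outgoing one, so that the end of a
  finite path has a vertex too. Past the end the value is meaningless.\<close>

definition vx :: "('v, 'e) graph \<Rightarrow> ('v, 'e) bpath \<Rightarrow> nat \<Rightarrow> 'v" where
  "vx E x n = (if n = 0 then st E x else rng E (the (ed x (n - 1))))"

text \<open>The start vertex is an argument because a finite path stores it explicitly, even when
  its edge list is empty; for an infinite path it is determined by the edges.\<close>

fun cat :: "'v \<Rightarrow> 'e list \<Rightarrow> ('v, 'e) bpath \<Rightarrow> ('v, 'e) bpath" where
  "cat v es (FinP w fs) = FinP v (es @ fs)"
| "cat v es (InfP x) = InfP (\<lambda>i. if i < length es then es ! i else x (i - length es))"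

definition pre :: "('v, 'e) bpath \<Rightarrow> nat \<Rightarrow> 'e list" where
  "pre x n = map (\<lambda>i. the (ed x i)) [0..<n]"

text \<open>The paths that agree with \<open>x\<close> on the first \<open>j\<close> edges; if \<open>x\<close> ends earlier, they must not
  continue with an edge in \<open>F\<close>.\<close>

definition nb :: "('v, 'e) graph \<Rightarrow> ('v, 'e) bpath \<Rightarrow> nat \<Rightarrow> 'e set \<Rightarrow> ('v, 'e) bpath set" where
  "nb E x j F = {z \<in> boundary E. st E z = st E x \<and>
     (\<forall>i<j. (ed x i \<noteq> None \<longrightarrow> ed z i = ed x i) \<and> (path_len x = enat i \<longrightarrow> ed z i \<notin> Some ` F))}"

lemma ed_None_iff: "ed x i = None \<longleftrightarrow> path_len x \<le> enat i"
  by (cases x) auto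

lemma ed_Some_iff: "ed x i \<noteq> None \<longleftrightarrow> enat i < path_len x"
  by (cases x) auto

lemma path_len_eq_iff: "path_len x = enat n \<longleftrightarrow> ed x n = None \<and> (\<forall>i<n. ed x i \<noteq> None)"
proof (cases x)
  case (FinP v es)
  have "length es = n" if "length es \<le> n" "\<forall>i<n. i < length es" 
    using that by (metis le_neq_implies_less less_irrefl)
  then show ?thesis using FinP by auto
qed auto

lemma path_len_ge_iff: "enat n \<le> path_len x \<longleftrightarrow> (\<forall>i<n. ed x i \<noteq> None)"
proof (cases x)
  case (FinP v es)
  have "n \<le> length es" if "\<forall>i<n. i < length es" 
    using that by (metis leI less_irrefl)
  then show ?thesis using FinP by auto
qed auto

lemma path_eqI:
  assumes "st E x = st E y" "\<And>i. ed x i = ed y i"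
  shows "x = y"
proof -
  have l: "path_len x = enat n \<longleftrightarrow> path_len y = enat n" for n
    using assms(2) by (simp add: path_len_eq_iff)
  show ?thesis
  proof (cases x)
    case (FinP v es)
    then obtain w fs where y: "y = FinP w fs" using l[of "length es"] by (cases y) auto
    have len: "length es = length fs" using l[of "length es"] FinP y by simp
    moreover have "es ! i = fs ! i" if "i < length es" for i
      using assms(2)[of i] FinP y that len by simp
    ultimately show ?thesis using assms(1) FinP y by (simp add: nth_equalityI)
  next
    case (InfP a)
    then obtain b where y: "y = InfP b" using l by (cases y) auto
    have "a i = b i" for i using assms(2)[of i] InfP y by simp
    then show ?thesis using InfP y by auto
  qed
qed

lemma vx_0 [simp]: "vx E x 0 = st E x"
  by (simp add: vx_def)

lemma vx_Suc: "ed x n = Some e \<Longrightarrow> vx E x (Suc n) = rng E e"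
  by (simp add: vx_def)

lemma vx_cong: "st E x = st E y \<Longrightarrow> (\<And>i. i < n \<Longrightarrow> ed x i = ed y i) \<Longrightarrow> vx E x n = vx E y n"
  by (cases n) (auto simp: vx_def)

lemma length_pre [simp]: "length (pre x n) = n"
  by (simp add: pre_def)

lemma nth_pre: "i < n \<Longrightarrow> enat n \<le> path_len x \<Longrightarrow> Some (pre x n ! i) = ed x i"
  by (auto simp: pre_def path_len_ge_iff)

text \<open>Rephrases cylinders through \<open>st\<close> and \<open>ed\<close>, after which the
  distinction between finite and infinite paths disappears from the topological arguments.\<close>

lemma cyl_iff:
  "y \<in> cyl E (FinP v es) \<longleftrightarrow> y \<in> boundary E \<and> st E y = v \<and> (\<forall>i<length es. ed y i = Some (es ! i))"
proof (cases y)
  case (FinP w fs)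
  have "(\<exists>zs. fs = es @ zs) \<longleftrightarrow> (\<forall>i<length es. i < length fs \<and> fs ! i = es ! i)"
  proof
    assume R: "\<forall>i<length es. i < length fs \<and> fs ! i = es ! i"
    then have "length es \<le> length fs" by (metis leI less_irrefl)
    then have "take (length es) fs = es" using R by (intro nth_equalityI) auto
    then show "\<exists>zs. fs = es @ zs" by (metis append_take_drop_id)
  qed (auto simp: nth_append)
  then show ?thesis using FinP by (auto simp: cyl_def)
next
  case (InfP x)
  have m: "es = map x [0..<length es] \<longleftrightarrow> (\<forall>i<length es. es ! i = x i)"
  proof
    assume e: "es = map x [0..<length es]"
    have "map x [0..<length es] ! i = x i" if "i < length es" for i using that by simp
    then show "\<forall>i<length es. es ! i = x i" using e by metis
  next
    assume "\<forall>i<length es. es ! i = x i"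
    then show "es = map x [0..<length es]" by (intro nth_equalityI) simp_all
  qed
  show ?thesis unfolding InfP cyl_def mem_Collect_eq extends.simps m ed.simps option.inject st.simps by metis
qed

lemma paths_append:
  assumes p: "p \<in> paths_from_to E u v" and q: "q \<in> paths_from_to E v w"
  shows "p @ q \<in> paths_from_to E u w"
proof -
  have P: "edge_path E p" and Q: "edge_path E q" using p q by (auto simp: paths_from_to_def)
  have "rng E ((p @ q) ! i) = src E ((p @ q) ! Suc i)" if i: "Suc i < length (p @ q)" for i
  proof -
    consider "Suc i < length p" | "Suc i = length p" | "length p \<le> i" by linarith
    then show ?thesis
    proof cases
      case 1
      then show ?thesis using P by (auto simp: edge_path_def nth_append)
    next
      case 2
      then have "p \<noteq> []" "q \<noteq> []" using i by auto
      then have "rng E (last p) = v" "src E (hd q) = v" using p q by (auto simp: paths_from_to_def)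
      moreover have "(p @ q) ! i = last p" using 2 \<open>p \<noteq> []\<close> 
        by (metis diff_Suc_1 last_conv_nth lessI nth_append)
      moreover have "(p @ q) ! Suc i = hd q" using 2 \<open>q \<noteq> []\<close> by (simp add: nth_append hd_conv_nth)
      ultimately show ?thesis by simp
    next
      case 3
      have "rng E (q ! (i - length p)) = src E (q ! Suc (i - length p))"
        using Q 3 i by (auto simp: edge_path_def)
      then show ?thesis using 3 by (simp add: nth_append Suc_diff_le)
    qed
  qed
  then have "edge_path E (p @ q)" using P Q by (auto simp: edge_path_def)
  then show ?thesis using p q unfolding paths_from_to_def by (auto simp: last_append hd_append)
qed

locale dgraph =
  fixes E :: "('v, 'e) graph"
  assumes wf: "wf_graph E" and no_sinks: "no_sinks E"
begin

lemma src_in: "e \<in> edges E \<Longrightarrow> src E e \<in> verts E"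
  and rng_in: "e \<in> edges E \<Longrightarrow> rng E e \<in> verts E"
  using wf by (auto simp: wf_graph_def)

text \<open>In the absence of sinks the singular vertices are the infinite emitters.\<close>

lemma fin_boundary_iff:
  "FinP v es \<in> boundary E \<longleftrightarrow> es \<in> paths_from_to E v (path_range E (FinP v es)) \<and>
     infinite (out_edges E (path_range E (FinP v es)))" (is "?L \<longleftrightarrow> ?R")
proof
  assume ?L
  then have 1: "v \<in> verts E" "edge_path E es" "es \<noteq> [] \<longrightarrow> src E (hd es) = v"
    "singular E (path_range E (FinP v es))" by (auto simp: boundary_def)
  then have "path_range E (FinP v es) \<in> verts E"
    using rng_in last_in_set by (fastforce simp: edge_path_def)
  then show ?R using 1 no_sinks
    by (auto simp: paths_from_to_def singular_def infinite_emitter_def no_sinks_def split: if_splits)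
next
  assume ?R
  then show ?L by (auto simp: boundary_def paths_from_to_def singular_def infinite_emitter_def split: if_splits)
qed

lemma inf_boundary_iff: "InfP x \<in> boundary E \<longleftrightarrow> inf_path E x"
  by (auto simp: boundary_def)

lemma ed_edge:
  assumes "x \<in> boundary E" "ed x i = Some e"
  shows "e \<in> edges E" "src E e = vx E x i"
proof -
  have "e \<in> edges E \<and> src E e = vx E x i"
  proof (cases x)
    case (FinP v es)
    then have "i < length es" "e = es ! i" using assms(2) by (auto split: if_splits)
    moreover have "edge_path E es" "es \<noteq> [] \<longrightarrow> src E (hd es) = v"
      using assms(1)[unfolded FinP fin_boundary_iff paths_from_to_def] by auto
    ultimately show ?thesis using FinP
      by (cases i) (auto simp: edge_path_def vx_def hd_conv_nth)
  next
    case (InfP a)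
    then show ?thesis using assms(1)[unfolded InfP inf_boundary_iff inf_path_def] assms(2)
      by (cases i) (auto simp: vx_def)
  qed
  then show "e \<in> edges E" "src E e = vx E x i" by auto
qed

lemma st_in: "x \<in> boundary E \<Longrightarrow> st E x \<in> verts E"
  by (cases x) (auto simp: fin_boundary_iff inf_boundary_iff inf_path_def paths_from_to_def src_in)

lemma vx_in: 
  assumes "x \<in> boundary E" "enat n \<le> path_len x"
  shows "vx E x n \<in> verts E"
proof (cases n)
  case (Suc m)
  then obtain e where "ed x m = Some e" using assms(2) by (auto simp: path_len_ge_iff)
  then show ?thesis using ed_edge(1)[OF assms(1)] rng_in Suc by (simp add: vx_Suc)
qed (use assms st_in in simp)

lemma path_range_vx: "path_range E (FinP v es) = vx E (FinP v es) (length es)"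
  by (cases es rule: rev_cases) (auto simp: vx_def nth_append)

lemma end_infinite:
  assumes "x \<in> boundary E" "path_len x = enat n"
  shows "infinite (out_edges E (vx E x n))"
proof (cases x)
  case (FinP v es)
  then show ?thesis using assms unfolding FinP fin_boundary_iff path_range_vx by simp
qed (use assms in auto)

lemma ed_shift:
  assumes "enat m \<le> path_len x"
  shows "ed (shift E m x) i = ed x (m + i)"
  using assms by (cases x) (auto simp: add.commute)

lemma st_shift:
  assumes "x \<in> boundary E" "enat m \<le> path_len x"
  shows "st E (shift E m x) = vx E x m"
proof (cases x)
  case (FinP v es)
  show ?thesis
  proof (cases "m = 0 \<or> length es \<le> m")
    case True
    then show ?thesis using assms(2) FinP path_range_vx[of v es] by (auto simp del: path_range.simps)
  next
    case False
    then show ?thesis using ed_edge(2)[OF assms(1), of m "es ! m"] FinP by auto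
  qed
next
  case (InfP a)
  then show ?thesis using ed_edge(2)[OF assms(1), of m "a m"] by auto
qed

lemma pre_path:
  assumes "x \<in> boundary E" "enat n \<le> path_len x"
  shows "pre x n \<in> paths_from_to E (st E x) (vx E x n)"
proof -
  have e: "\<exists>e. ed x i = Some e \<and> pre x n ! i = e \<and> e \<in> edges E \<and> src E e = vx E x i" if "i < n" for i
    using nth_pre[OF that assms(2)] ed_edge[OF assms(1)] by metis
  have "set (pre x n) \<subseteq> edges E" using e by (auto simp: in_set_conv_nth)
  moreover have "rng E (pre x n ! i) = src E (pre x n ! Suc i)" if "Suc i < n" for i
    using e[of i] e[of "Suc i"] that vx_Suc[of x i] by auto
  moreover have "src E (hd (pre x n)) = st E x" if "n > 0"
    using e[of 0] that by (metis hd_conv_nth length_0_conv length_pre less_numeral_extra(3) vx_0)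
  moreover have "rng E (last (pre x n)) = vx E x n" if "n > 0"
    using e[of "n - 1"] that vx_Suc[of x "n - 1"]
    by (metis One_nat_def Suc_pred diff_less last_conv_nth length_0_conv length_pre less_numeral_extra(3) zero_less_one)
  moreover have "pre x n = [] \<longleftrightarrow> n = 0" by (metis length_0_conv length_pre)
  ultimately show ?thesis using st_in[OF assms(1)] vx_in[OF assms] 
    by (auto simp: paths_from_to_def edge_path_def)
qed

lemma ed_cat: "ed (cat v es w) i = (if i < length es then Some (es ! i) else ed w (i - length es))"
  by (cases w) (auto simp: nth_append)

lemma path_len_cat: "path_len (cat v es w) = enat (length es) + path_len w"
  by (cases w) auto

lemma st_cat:
  assumes "es \<in> paths_from_to E v (st E w)"
  shows "st E (cat v es w) = v"
  using assms by (cases w; cases es) (auto simp: paths_from_to_def)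

lemma cat_boundary:
  assumes es: "es \<in> paths_from_to E v (st E w)" and w: "w \<in> boundary E"
  shows "cat v es w \<in> boundary E"
proof (cases w)
  case (FinP u fs)
  then have "fs \<in> paths_from_to E u (path_range E w)" "infinite (out_edges E (path_range E w))"
    using w fin_boundary_iff by blast+
  moreover have "path_range E (cat v es w) = path_range E w"
    using FinP es by (auto simp: paths_from_to_def last_append)
  ultimately show ?thesis using paths_append[of es E v u fs] es FinP
    unfolding FinP cat.simps fin_boundary_iff by simp
next
  case (InfP x)
  then have x: "inf_path E x" using w inf_boundary_iff by blast
  have e: "edge_path E es" "es \<noteq> [] \<longrightarrow> rng E (last es) = src E (x 0)"
    using es InfP by (auto simp: paths_from_to_def)
  let ?y = "\<lambda>i. if i < length es then es ! i else x (i - length es)"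
  have "inf_path E ?y"
    unfolding inf_path_def
  proof (intro conjI allI)
    fix i show "?y i \<in> edges E" using e(1) x by (auto simp: edge_path_def inf_path_def)
    show "rng E (?y i) = src E (?y (Suc i))"
    proof (cases "Suc i = length es")
      case True
      then have "es \<noteq> []" "last es = es ! i" by (auto simp: last_conv_nth) (metis diff_Suc_1 last_conv_nth length_0_conv nat.distinct(1))
      then show ?thesis using e(2) True by auto
    next
      case False
      then show ?thesis using e(1) x by (auto simp: edge_path_def inf_path_def Suc_diff_le)
    qed
  qed
  then show ?thesis using InfP inf_boundary_iff by simp
qed

lemma shift_cat:
  assumes es: "es \<in> paths_from_to E v (st E w)" and w: "w \<in> boundary E"
  shows "shift E (length es) (cat v es w) = w"
proof (rule path_eqI[where E=E])
  have l: "enat (length es) \<le> path_len (cat v es w)" by (simp add: path_len_cat)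
  show "st E (shift E (length es) (cat v es w)) = st E w"
    using st_shift[OF cat_boundary[OF es w] l] es st_cat[OF es]
    by (cases "es = []") (auto simp: vx_def ed_cat paths_from_to_def last_conv_nth)
  show "ed (shift E (length es) (cat v es w)) i = ed w i" for i
    by (simp add: ed_shift[OF l] ed_cat)
qed

lemma path_len_shift_ge: "enat m \<le> path_len x \<Longrightarrow> enat i \<le> path_len (shift E m x) \<longleftrightarrow> enat (m + i) \<le> path_len x"
  by (cases x) auto

lemma path_len_shift_eq: "enat m \<le> path_len x \<Longrightarrow> path_len (shift E m x) = enat i \<longleftrightarrow> path_len x = enat (m + i)"
  by (cases x) auto

lemma shift_boundary:
  assumes x: "x \<in> boundary E" and m: "enat m \<le> path_len x"
  shows "shift E m x \<in> boundary E"
proof (cases x)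
  case (FinP v es)
  show ?thesis
  proof (cases "m = 0")
    case False
    have f: "es \<in> paths_from_to E v (path_range E x)" "infinite (out_edges E (path_range E x))"
      using x unfolding FinP fin_boundary_iff by auto
    show ?thesis
    proof (cases "m < length es")
      case True
      have "path_range E (FinP (src E (es ! m)) (drop m es)) = path_range E x"
        using True FinP by auto
      moreover have "drop m es \<in> paths_from_to E (src E (es ! m)) (path_range E x)"
        using True f(1) FinP src_in
        by (auto simp: paths_from_to_def edge_path_def hd_drop_conv_nth nth_mem subset_iff dest: in_set_dropD)
      moreover have "shift E m x = FinP (src E (es ! m)) (drop m es)" using True False FinP by simp
      ultimately show ?thesis using f(2) fin_boundary_iff by metis
    next
      case False': False
      then have s: "shift E m x = FinP (path_range E x) []" using False FinP by simp
      show ?thesis unfolding s fin_boundary_iff using f by (auto simp: paths_from_to_def edge_path_def)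
    qed
  qed (use x FinP in simp)
next
  case (InfP a)
  then show ?thesis using x[unfolded InfP] by (auto simp: inf_boundary_iff inf_path_def)
qed

lemma vx_shift:
  assumes x: "x \<in> boundary E" and m: "enat m \<le> path_len x"
  shows "vx E (shift E m x) i = vx E x (m + i)"
  using st_shift[OF x m] ed_shift[OF m] by (cases i) (auto simp: vx_def)

lemma shift_shift:
  assumes x: "x \<in> boundary E" and m: "enat (m + n) \<le> path_len x"
  shows "shift E n (shift E m x) = shift E (m + n) x"
proof (rule path_eqI[where E=E])
  have m': "enat m \<le> path_len x" using m by (metis enat_ord_simps(1) le_add1 order_trans)
  have n: "enat n \<le> path_len (shift E m x)" using m m' path_len_shift_ge by blast
  have s: "shift E m x \<in> boundary E" using shift_boundary[OF x m'] .
  show "st E (shift E n (shift E m x)) = st E (shift E (m + n) x)"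
    using st_shift[OF s n] st_shift[OF x m] vx_shift[OF x m'] by simp
  show "ed (shift E n (shift E m x)) i = ed (shift E (m + n) x) i" for i
    using ed_shift n m' m by (simp add: add.assoc)
qed

text \<open>The vertices have to be compared separately from the edges: if both paths end at these
  positions, no edge is left from which the vertex could be read.\<close>

lemma shift_eq_iff:
  assumes "x \<in> boundary E" "enat m \<le> path_len x" "y \<in> boundary E" "enat n \<le> path_len y"
  shows "shift E m x = shift E n y \<longleftrightarrow> vx E x m = vx E y n \<and> (\<forall>i. ed x (m + i) = ed y (n + i))"
proof
  assume s: "shift E m x = shift E n y"
  have "ed x (m + i) = ed y (n + i)" for i
    using arg_cong[OF s, of "\<lambda>z. ed z i"] assms by (simp add: ed_shift)
  moreover have "vx E x m = vx E y n"
    using arg_cong[OF s, of "st E"] assms by (simp add: st_shift)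
  ultimately show "vx E x m = vx E y n \<and> (\<forall>i. ed x (m + i) = ed y (n + i))" by blast
next
  assume "vx E x m = vx E y n \<and> (\<forall>i. ed x (m + i) = ed y (n + i))"
  then show "shift E m x = shift E n y"
    by (intro path_eqI[where E=E]) (use assms in \<open>auto simp: st_shift ed_shift\<close>)
qed

lemma shift_inj:
  assumes "x \<in> boundary E" "enat m \<le> path_len x" "y \<in> boundary E" "enat m \<le> path_len y"
    and "shift E m x = shift E m y" "st E x = st E y" "\<And>i. i < m \<Longrightarrow> ed x i = ed y i"
  shows "x = y"
proof (rule path_eqI[where E=E])
  show "ed x i = ed y i" for i
  proof (cases "i < m")
    case False
    then show ?thesis using assms(5) shift_eq_iff[OF assms(1-4)] by (metis le_add_diff_inverse linorder_not_less)
  qed (use assms in auto)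
qed (use assms in auto)

end

section \<open>Topology of the boundary path space\<close>

context dgraph
begin

abbreviation "Bd \<equiv> boundary E"
abbreviation "Tp \<equiv> boundary_top E"

lemma nb_subset: "nb E x j F \<subseteq> Bd"
  by (auto simp: nb_def)

lemma nb_self: "x \<in> Bd \<Longrightarrow> x \<in> nb E x j F"
  by (auto simp: nb_def path_len_eq_iff)

lemma nb_mono: 
  assumes "j \<le> j'" "F \<subseteq> F'"
  shows "nb E x j' F' \<subseteq> nb E x j F"
proof
  fix z assume z: "z \<in> nb E x j' F'"
  have "(ed x i \<noteq> None \<longrightarrow> ed z i = ed x i) \<and> (path_len x = enat i \<longrightarrow> ed z i \<notin> Some ` F)" if "i < j" for i
  proof -
    have "i < j'" using that assms(1) by simp
    then have "(ed x i \<noteq> None \<longrightarrow> ed z i = ed x i) \<and> (path_len x = enat i \<longrightarrow> ed z i \<notin> Some ` F')"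
      using z unfolding nb_def by blast
    then show ?thesis using assms(2) by blast
  qed
  then show "z \<in> nb E x j F" using z by (auto simp: nb_def)
qed

lemma nb_len: "z \<in> nb E x (m + j) F \<Longrightarrow> enat m \<le> path_len x \<Longrightarrow> enat m \<le> path_len z"
  by (auto simp: nb_def path_len_ge_iff)

lemma nb_ed: "z \<in> nb E x (m + j) F \<Longrightarrow> enat m \<le> path_len x \<Longrightarrow> i < m \<Longrightarrow> ed z i = ed x i"
  by (auto simp: nb_def path_len_ge_iff)

text \<open>Cylinders are formed for arbitrary edge lists; a single boundary path inside certifies
  that the list is a path.\<close>

lemma cyl_fin_path:
  assumes "y \<in> cyl E (FinP v es)"
  shows "fin_path E (FinP v es)" "path_range E (FinP v es) = vx E y (length es)"
proof -
  have y: "y \<in> Bd" "st E y = v" "\<And>i. i < length es \<Longrightarrow> ed y i = Some (es ! i)"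
    using assms by (auto simp: cyl_iff)
  have l: "enat (length es) \<le> path_len y" using y(3) by (simp add: path_len_ge_iff)
  have "pre y (length es) ! i = es ! i" if "i < length es" for i
    using y(3)[OF that] nth_pre[OF that l] by simp
  then have "pre y (length es) = es" by (intro nth_equalityI) auto
  then have p: "es \<in> paths_from_to E v (vx E y (length es))" using pre_path[OF y(1) l] y(2) by simp
  show "fin_path E (FinP v es)" using p by (auto simp: paths_from_to_def)
  show "path_range E (FinP v es) = vx E y (length es)" using p by (auto simp: paths_from_to_def)
qed

text \<open>Edges of \<open>F\<close> that do not leave the end of \<open>es\<close> span empty
  cylinders, so intersecting \<open>F\<close> with the outgoing edges leaves the set unchanged and
  exhibits it as a basis element.\<close>

lemma basis_open:
  assumes "finite F" 
  shows "openin Tp (cyl E (FinP v es) - (\<Union>e\<in>F. cyl E (FinP v (es @ [e]))))" (is "openin Tp ?B")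
proof (cases "cyl E (FinP v es) = {}")
  case False
  then obtain y where "y \<in> cyl E (FinP v es)" by blast
  then have fp: "fin_path E (FinP v es)" using cyl_fin_path by blast
  let ?r = "path_range E (FinP v es)"
  have "e \<in> out_edges E ?r" if "z \<in> cyl E (FinP v (es @ [e]))" for e z
  proof -
    have z: "z \<in> Bd" "z \<in> cyl E (FinP v es)" "ed z (length es) = Some e"
      using that by (auto simp: cyl_iff nth_append)
    then show ?thesis using ed_edge[OF z(1,3)] cyl_fin_path(2)[OF z(2)] by (simp add: out_edges_def)
  qed
  then have "?B = cyl E (FinP v es) - (\<Union>e\<in>F \<inter> out_edges E ?r. cyl E (path_snoc (FinP v es) e))"
    by auto
  then have "?B \<in> boundary_basis E"
    unfolding boundary_basis_def using fp assms by blast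
  then show ?thesis unfolding boundary_top_def by (rule topology_generated_by_Basis)
qed simp

lemma cyl_open: "openin Tp (cyl E (FinP v es))"
  using basis_open[of "{}"] by simp

lemma topspace_T [simp]: "topspace Tp = Bd"
proof
  show "topspace Tp \<subseteq> Bd"
    by (auto simp: boundary_top_def boundary_basis_def cyl_def)
  show "Bd \<subseteq> topspace Tp"
  proof
    fix x assume "x \<in> Bd"
    then have "x \<in> cyl E (FinP (st E x) [])" by (simp add: cyl_iff)
    then show "x \<in> topspace Tp" using openin_subset[OF cyl_open] by blast
  qed
qed

lemma nb_eq_cyl:
  assumes "x \<in> Bd" "enat j \<le> path_len x"
  shows "nb E x j F = cyl E (FinP (st E x) (pre x j))"
proof -
  have "path_len x \<noteq> enat i" if "i < j" for i using that assms(2) by auto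
  moreover have "ed x i \<noteq> None" if "i < j" for i using that assms(2) by (auto simp: path_len_ge_iff)
  ultimately show ?thesis using nth_pre[OF _ assms(2)] by (auto simp: nb_def cyl_iff)
qed

lemma nb_eq_diff:
  assumes "x \<in> Bd" "path_len x = enat l" "l < j"
  shows "nb E x j F = cyl E (FinP (st E x) (pre x l)) - (\<Union>e\<in>F. cyl E (FinP (st E x) (pre x l @ [e])))"
proof -
  have N: "ed x i = None" if "l \<le> i" for i using assms(2) that by (simp add: ed_None_iff)
  have S: "ed x i = Some (pre x l ! i)" "ed x i \<noteq> None" if "i < l" for i
  proof -
    have "Some (pre x l ! i) = ed x i" using nth_pre[OF that, of x] assms(2) by simp
    then show "ed x i = Some (pre x l ! i)" "ed x i \<noteq> None" by (simp, metis option.distinct(1))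
  qed
  have "z \<in> nb E x j F \<longleftrightarrow> z \<in> Bd \<and> st E z = st E x \<and> (\<forall>i<l. ed z i = Some (pre x l ! i)) \<and> ed z l \<notin> Some ` F" for z
  proof -
    have "(\<forall>i<j. (ed x i \<noteq> None \<longrightarrow> ed z i = ed x i) \<and> (path_len x = enat i \<longrightarrow> ed z i \<notin> Some ` F)) \<longleftrightarrow>
       (\<forall>i<l. ed z i = Some (pre x l ! i)) \<and> ed z l \<notin> Some ` F" (is "?A \<longleftrightarrow> ?B")
    proof
      assume ?A then show ?B using S assms(2,3) by (metis order.strict_trans)
    next
      assume B: ?B
      show ?A
      proof (intro allI impI conjI)
        fix i assume "i < j"
        show "ed z i = ed x i" if "ed x i \<noteq> None" using that N S(1) B by (metis linorder_not_less)
        show "ed z i \<notin> Some ` F" if "path_len x = enat i" using that B assms(2) by simp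
      qed
    qed
    then show ?thesis by (auto simp: nb_def)
  qed
  moreover have "z \<in> cyl E (FinP (st E x) (pre x l)) - (\<Union>e\<in>F. cyl E (FinP (st E x) (pre x l @ [e]))) \<longleftrightarrow>
     z \<in> Bd \<and> st E z = st E x \<and> (\<forall>i<l. ed z i = Some (pre x l ! i)) \<and> ed z l \<notin> Some ` F" for z
  proof -
    have "(\<forall>i<Suc l. ed z i = Some ((pre x l @ [e]) ! i)) \<longleftrightarrow> 
       (\<forall>i<l. ed z i = Some (pre x l ! i)) \<and> ed z l = Some e" for e
      by (auto simp: less_Suc_eq nth_append)
    then show ?thesis by (auto simp: cyl_iff)
  qed
  ultimately show ?thesis by blast
qed

lemma nb_open: 
  assumes "x \<in> Bd" "finite F"
  shows "openin Tp (nb E x j F)"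
proof (cases "enat j \<le> path_len x")
  case True
  then show ?thesis using nb_eq_cyl[OF assms(1)] cyl_open by simp
next
  case False
  then obtain l where "path_len x = enat l" "l < j" by (cases "path_len x") auto
  then show ?thesis using nb_eq_diff[OF assms(1)] basis_open[OF assms(2)] by simp
qed

text \<open>Together with \<open>nb_open\<close> this makes the sets \<open>nb E x j F\<close> a
  neighbourhood base at \<open>x\<close>. The proof is an induction over the generation of the
  topology.\<close>

lemma open_nb:
  assumes "openin Tp U" "x \<in> U"
  obtains j F where "finite F" "nb E x j F \<subseteq> U"
proof -
  have "generate_topology_on (boundary_basis E) U"
    using assms(1) unfolding boundary_top_def by (rule openin_topology_generated_by)
  then have "x \<in> U \<longrightarrow> (\<exists>j F. finite F \<and> nb E x j F \<subseteq> U)"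
  proof (induction rule: generate_topology_on.induct)
    case (Int a b)
    show ?case
    proof
      assume "x \<in> a \<inter> b"
      then obtain j F j' F' where "finite F" "nb E x j F \<subseteq> a" "finite F'" "nb E x j' F' \<subseteq> b"
        using Int by blast
      then have "finite (F \<union> F')" "nb E x (max j j') (F \<union> F') \<subseteq> a \<inter> b"
        using nb_mono[of j "max j j'" F "F \<union> F'" x] nb_mono[of j' "max j j'" F' "F \<union> F'" x] by auto
      then show "\<exists>j F. finite F \<and> nb E x j F \<subseteq> a \<inter> b" by blast
    qed
  next
    case (UN K)
    show ?case
    proof
      assume "x \<in> \<Union>K"
      then obtain k where k: "k \<in> K" "x \<in> k" by blast
      then obtain j F where "finite F" "nb E x j F \<subseteq> k" using UN by blast
      then show "\<exists>j F. finite F \<and> nb E x j F \<subseteq> \<Union>K" using k by blast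
    qed
  next
    case (Basis s)
    show ?case
    proof
      assume x: "x \<in> s"
      obtain \<mu> F where \<mu>: "s = cyl E \<mu> - (\<Union>e\<in>F. cyl E (path_snoc \<mu> e))" "fin_path E \<mu>" "finite F"
        using Basis by (auto simp: boundary_basis_def)
      obtain v es where es: "\<mu> = FinP v es" using \<mu>(2) by (cases \<mu>) auto
      have xX: "x \<in> Bd" "st E x = v" "\<forall>i<length es. ed x i = Some (es ! i)"
        using x \<mu>(1) es by (auto simp: cyl_iff)
      have xF: "ed x (length es) \<notin> Some ` F"
        using x xX \<mu>(1) es by (auto simp: cyl_iff nth_append less_Suc_eq)
      \<comment> \<open>One position beyond \<open>es\<close> is included: if \<open>x\<close> ends
        there, the edges of \<open>F\<close> are excluded at this index, and otherwise this index
        fixes the next edge, which is not in \<open>F\<close>.\<close>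
      have "nb E x (Suc (length es)) F \<subseteq> s"
      proof
        fix z assume z: "z \<in> nb E x (Suc (length es)) F"
        have zX: "z \<in> Bd" "st E z = v" "\<forall>i<length es. ed z i = Some (es ! i)"
          using z xX by (auto simp: nb_def)
        have "ed z (length es) \<notin> Some ` F"
        proof (cases "ed x (length es) = None")
          case True
          then have "path_len x = enat (length es)" using xX(3) by (auto simp: path_len_eq_iff)
          then show ?thesis using z by (auto simp: nb_def)
        next
          case False
          then show ?thesis using z xF by (auto simp: nb_def)
        qed
        then show "z \<in> s" using zX \<mu>(1) es by (force simp: cyl_iff nth_append)
      qed
      then show "\<exists>j F. finite F \<and> nb E x j F \<subseteq> s" using \<mu>(3) by blast
    qed
  qed simp
  then show ?thesis using assms(2) that by blast
qed

text \<open>The offsets prepare for \<open>shift_bij_nb\<close>: with the same \<open>j\<close> and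
  \<open>F\<close>, the neighbourhoods of two paths with a common tail are shifted onto one and the
  same set.\<close>

lemma open_nb2:
  assumes "openin Tp U" "x \<in> U" "openin Tp V" "y \<in> V"
  obtains j F where "finite F" "nb E x (m + j) F \<subseteq> U" "nb E y (n + j) F \<subseteq> V"
proof -
  obtain j F where 1: "finite F" "nb E x j F \<subseteq> U" using open_nb[OF assms(1,2)] .
  obtain j' F' where 2: "finite F'" "nb E y j' F' \<subseteq> V" using open_nb[OF assms(3,4)] .
  show ?thesis
  proof (rule that)
    show "finite (F \<union> F')" using 1 2 by simp
    show "nb E x (m + (j + j')) (F \<union> F') \<subseteq> U" 
      using nb_mono[of j "m + (j + j')" F "F \<union> F'" x] 1(2) by auto
    show "nb E y (n + (j + j')) (F \<union> F') \<subseteq> V"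
      using nb_mono[of j' "n + (j + j')" F' "F \<union> F'" y] 2(2) by auto
  qed
qed

lemma open_nb_ge:
  assumes "openin Tp U" "x \<in> U"
  obtains j F where "finite F" "nb E x (m + j) F \<subseteq> U"
  using open_nb2[OF assms assms] by metis

lemma openin_nbI:
  assumes "U \<subseteq> Bd" "\<And>x. x \<in> U \<Longrightarrow> \<exists>j F. finite F \<and> nb E x j F \<subseteq> U"
  shows "openin Tp U"
proof (subst openin_subopen, intro ballI)
  fix x assume x: "x \<in> U"
  then obtain j F where "finite F" "nb E x j F \<subseteq> U" using assms(2) by blast
  then show "\<exists>V. openin Tp V \<and> x \<in> V \<and> V \<subseteq> U" using nb_open[of x F j] nb_self[of x j F] x assms(1) by (intro exI[of _ "nb E x j F"]) auto
qed

section \<open>Clopen and compact cylinders, and the Hausdorff property\<close>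

lemma cyl_closed: "closedin Tp (cyl E (FinP v es))"
proof -
  have "openin Tp (Bd - cyl E (FinP v es))"
  proof (rule openin_nbI)
    fix x assume x: "x \<in> Bd - cyl E (FinP v es)"
    \<comment> \<open>If \<open>x\<close> ends before it disagrees with \<open>es\<close>, paths
      near \<open>x\<close> could still continue along \<open>es\<close>; excluding the edges of
      \<open>es\<close> at the end of \<open>x\<close> prevents this.\<close>
    have "nb E x (length es) (set es) \<subseteq> Bd - cyl E (FinP v es)"
    proof (cases "st E x = v")
      case False
      then show ?thesis by (auto simp: nb_def cyl_iff)
    next
      case True
      define P where "P i \<longleftrightarrow> i < length es \<and> ed x i \<noteq> Some (es ! i)" for i
      have "\<exists>i. P i" using x True by (auto simp: cyl_iff P_def)
      then obtain i where i: "P i" "\<forall>k<i. \<not> P k" by (metis LeastI_ex not_less_Least)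
      show ?thesis
      proof
        fix z assume z: "z \<in> nb E x (length es) (set es)"
        have "ed z i \<noteq> Some (es ! i)"
        proof (cases "ed x i = None")
          case True
          then have "path_len x = enat i" using i by (auto simp: path_len_eq_iff P_def)
          then show ?thesis using z i by (auto simp: nb_def P_def)
        next
          case False
          then show ?thesis using z i by (auto simp: nb_def P_def)
        qed
        then show "z \<in> Bd - cyl E (FinP v es)" using z i by (auto simp: cyl_iff P_def nb_def)
      qed
    qed
    then show "\<exists>j F. finite F \<and> nb E x j F \<subseteq> Bd - cyl E (FinP v es)" by blast
  qed blast
  then show ?thesis by (simp add: closedin_def cyl_def)
qed

lemma nb_closed:
  assumes "x \<in> Bd"
  shows "closedin Tp (nb E x j F)"
proof (cases "enat j \<le> path_len x")
  case True
  then show ?thesis using nb_eq_cyl[OF assms(1)] cyl_closed by simp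
next
  case False
  then obtain l where "path_len x = enat l" "l < j" by (cases "path_len x") auto
  then show ?thesis unfolding nb_eq_diff[OF assms(1) \<open>path_len x = enat l\<close> \<open>l < j\<close>]
    by (intro closedin_diff cyl_closed openin_Union) (auto simp: cyl_open)
qed

text \<open>Two paths differ in their start vertex or in some edge, so a cylinder contains exactly
  one of them, and cylinders are clopen.\<close>

lemma hausdorff_T: "Hausdorff_space Tp"
  unfolding Hausdorff_space_def
proof (intro allI impI)
  fix x y assume xy: "x \<in> topspace Tp \<and> y \<in> topspace Tp \<and> x \<noteq> y"
  have sep: "\<exists>v es. (x \<in> cyl E (FinP v es) \<and> y \<notin> cyl E (FinP v es)) \<or> (y \<in> cyl E (FinP v es) \<and> x \<notin> cyl E (FinP v es))"
  proof (cases "st E x = st E y")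
    case False
    then have "x \<in> cyl E (FinP (st E x) []) \<and> y \<notin> cyl E (FinP (st E x) [])"
      using xy by (auto simp: cyl_iff)
    then show ?thesis by blast
  next
    case True
    then obtain i where i: "ed x i \<noteq> ed y i" using path_eqI[of E x y] xy by blast
    have one: "z \<in> cyl E (FinP (st E z) (pre z (Suc i))) \<and> w \<notin> cyl E (FinP (st E z) (pre z (Suc i)))"
      if zw: "z \<in> Bd" "ed z i \<noteq> None" "ed z i \<noteq> ed w i" for z w
    proof -
      have "\<not> path_len z \<le> enat i" using zw(2) by (simp add: ed_None_iff)
      then have l: "enat (Suc i) \<le> path_len z" by (cases "path_len z") auto
      have "\<forall>k<Suc i. Some (pre z (Suc i) ! k) = ed z k" using nth_pre[OF _ l] by blast
      then show ?thesis using zw by (auto simp: cyl_iff)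
    qed
    have "ed x i \<noteq> None \<or> ed y i \<noteq> None" using i by auto
    then show ?thesis
    proof
      assume "ed x i \<noteq> None"
      then show ?thesis using one[of x y] i xy by auto
    next
      assume "ed y i \<noteq> None"
      then show ?thesis using one[of y x] i xy by auto
    qed
  qed
  then obtain v es where v: "(x \<in> cyl E (FinP v es) \<and> y \<notin> cyl E (FinP v es)) \<or> (y \<in> cyl E (FinP v es) \<and> x \<notin> cyl E (FinP v es))"
    by blast
  have o: "openin Tp (cyl E (FinP v es))" "openin Tp (Bd - cyl E (FinP v es))" 
    using cyl_open cyl_closed by (auto simp: closedin_def)
  have d: "disjnt (cyl E (FinP v es)) (Bd - cyl E (FinP v es))" "disjnt (Bd - cyl E (FinP v es)) (cyl E (FinP v es))"
    by (auto simp: disjnt_def)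
  have "x \<in> Bd" "y \<in> Bd" using xy by auto
  then show "\<exists>U V. openin Tp U \<and> openin Tp V \<and> x \<in> U \<and> y \<in> V \<and> disjnt U V"
    using v o d by blast
qed

text \<open>As in Koenig's lemma, an open cover without finite subcover yields an infinite path all of whose
  initial segments span cylinders without finite subcover.\<close>

lemma cyl_compact: "compactin Tp (cyl E (FinP v []))"
proof (rule ccontr)
  assume nc: "\<not> compactin Tp (cyl E (FinP v []))"
  have sub: "cyl E (FinP v []) \<subseteq> topspace Tp" by (auto simp: cyl_iff)
  obtain \<U> where \<U>: "\<forall>U\<in>\<U>. openin Tp U" "cyl E (FinP v []) \<subseteq> \<Union>\<U>"
    "\<nexists>\<F>. finite \<F> \<and> \<F> \<subseteq> \<U> \<and> cyl E (FinP v []) \<subseteq> \<Union>\<F>"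
    using nc sub unfolding compactin_def by blast
  define bad where "bad es \<longleftrightarrow> (\<nexists>\<F>. finite \<F> \<and> \<F> \<subseteq> \<U> \<and> cyl E (FinP v es) \<subseteq> \<Union>\<F>)" for es
  have step: "\<exists>e. bad (es @ [e])" if b: "bad es" for es
  proof (rule ccontr)
    assume nb: "\<nexists>e. bad (es @ [e])"
    have "cyl E (FinP v es) \<noteq> {}" using b unfolding bad_def by blast
    then obtain y0 where "y0 \<in> cyl E (FinP v es)" by blast
    then have fp: "fin_path E (FinP v es)" using cyl_fin_path by blast
    let ?r = "path_range E (FinP v es)"
    have rv: "?r \<in> verts E" using cyl_fin_path(2)[OF \<open>y0 \<in> cyl E (FinP v es)\<close>] vx_in \<open>y0 \<in> cyl E (FinP v es)\<close>
      by (auto simp: cyl_iff path_len_ge_iff)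
    have ext: "z \<in> cyl E (FinP v (es @ [e]))" if "z \<in> cyl E (FinP v es)" "ed z (length es) = Some e" for z e
      using that by (auto simp: cyl_iff nth_append less_Suc_eq)
    \<comment> \<open>Either the end of \<open>es\<close> emits finitely many edges, and no boundary
      path ends there; or \<open>es\<close> is itself a boundary path, and the member of the cover
      that contains it covers all but finitely many one-edge extensions.\<close>
    have "\<exists>A \<F>. finite A \<and> finite \<F> \<and> \<F> \<subseteq> \<U> \<and> cyl E (FinP v es) \<subseteq> \<Union>\<F> \<union> (\<Union>e\<in>A. cyl E (FinP v (es @ [e])))"
    proof (cases "finite (out_edges E ?r)")
      case True
      have "z \<in> (\<Union>e\<in>out_edges E ?r. cyl E (FinP v (es @ [e])))" if z: "z \<in> cyl E (FinP v es)" for z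
      proof -
        have zX: "z \<in> Bd" using z by (auto simp: cyl_iff)
        have r: "?r = vx E z (length es)" using cyl_fin_path(2)[OF z] .
        have "path_len z \<noteq> enat (length es)" using end_infinite[OF zX] True r by metis
        then obtain e where e: "ed z (length es) = Some e"
          using z by (auto simp: cyl_iff path_len_eq_iff)
        then have "e \<in> out_edges E ?r" using ed_edge[OF zX e] r by (simp add: out_edges_def)
        then show ?thesis using ext[OF z e] by blast
      qed
      then show ?thesis using True by (intro exI[of _ "out_edges E ?r"] exI[of _ "{}"]) auto
    next
      case False
      let ?p = "FinP v es"
      have pX: "?p \<in> Bd" using fp False rv fin_boundary_iff by (auto simp: paths_from_to_def)
      then have "?p \<in> cyl E (FinP v [])" by (simp add: cyl_iff)
      then obtain U where U: "U \<in> \<U>" "?p \<in> U" using \<U>(2) by blast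
      then obtain j F where jF: "finite F" "nb E ?p j F \<subseteq> U" using open_nb \<U>(1) by metis
      have "cyl E (FinP v es) \<subseteq> \<Union>{U} \<union> (\<Union>e\<in>F. cyl E (FinP v (es @ [e])))"
      proof
        fix z assume z: "z \<in> cyl E (FinP v es)"
        show "z \<in> \<Union>{U} \<union> (\<Union>e\<in>F. cyl E (FinP v (es @ [e])))"
        proof (cases "ed z (length es) \<in> Some ` F")
          case True
          then show ?thesis using ext[OF z] by blast
        next
          case False
          then have "z \<in> nb E ?p j F" using z by (auto simp: nb_def cyl_iff)
          then show ?thesis using jF by blast
        qed
      qed
      then show ?thesis using U(1) jF(1) by (intro exI[of _ F] exI[of _ "{U}"]) simp
    qed
    then obtain A \<F> where AF: "finite A" "finite \<F>" "\<F> \<subseteq> \<U>"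
        "cyl E (FinP v es) \<subseteq> \<Union>\<F> \<union> (\<Union>e\<in>A. cyl E (FinP v (es @ [e])))" by blast
    have "\<forall>e. \<exists>\<G>. finite \<G> \<and> \<G> \<subseteq> \<U> \<and> cyl E (FinP v (es @ [e])) \<subseteq> \<Union>\<G>"
      using nb unfolding bad_def by blast
    then obtain \<G> where \<G>: "\<And>e. finite (\<G> e) \<and> \<G> e \<subseteq> \<U> \<and> cyl E (FinP v (es @ [e])) \<subseteq> \<Union>(\<G> e)" by metis
    have "finite (\<F> \<union> \<Union>(\<G> ` A))" using AF \<G> by blast
    moreover have "\<F> \<union> \<Union>(\<G> ` A) \<subseteq> \<U>" using AF \<G> by blast
    moreover have "cyl E (FinP v es) \<subseteq> \<Union>(\<F> \<union> \<Union>(\<G> ` A))"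
    proof
      fix z assume "z \<in> cyl E (FinP v es)"
      then consider "z \<in> \<Union>\<F>" | e where "e \<in> A" "z \<in> cyl E (FinP v (es @ [e]))" using AF(4) by blast
      then show "z \<in> \<Union>(\<F> \<union> \<Union>(\<G> ` A))"
      proof cases
        case 2
        then have "z \<in> \<Union>(\<G> e)" using \<G>[of e] by blast
        then show ?thesis using 2(1) by blast
      qed blast
    qed
    ultimately have "\<exists>\<F>. finite \<F> \<and> \<F> \<subseteq> \<U> \<and> cyl E (FinP v es) \<subseteq> \<Union>\<F>"
      by (intro exI[of _ "\<F> \<union> \<Union>(\<G> ` A)"] conjI)
    then show False by (rule notE[OF b[unfolded bad_def]])
  qed
  obtain f where f: "f 0 = []" "\<And>n. bad (f n)" "\<And>n. \<exists>e. f (Suc n) = f n @ [e]"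
  proof -
    define N where "N es = es @ [SOME e. bad (es @ [e])]" for es
    define f where "f n = (N ^^ n) []" for n
    have b: "bad (f n)" for n
    proof (induction n)
      case 0
      show ?case using \<U>(3) by (simp add: f_def bad_def)
    next
      case (Suc n)
      have "bad (N (f n))" unfolding N_def using step[OF Suc] by (rule someI_ex)
      then show ?case by (simp add: f_def)
    qed
    show ?thesis by (rule that[of f]) (use b in \<open>auto simp: f_def N_def\<close>)
  qed
  have len: "length (f n) = n" for n
  proof (induction n)
    case (Suc n) then show ?case using f(3)[of n] by auto
  qed (use f in simp)
  have nthf: "f (n + k) ! i = f n ! i" if "i < n" for n k i
  proof (induction k)
    case (Suc k)
    obtain e where "f (Suc (n + k)) = f (n + k) @ [e]" using f(3) by blast
    then show ?case using Suc len that by (simp add: nth_append)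
  qed simp
  define x where "x i = f (Suc i) ! i" for i
  have fx: "f n ! i = x i" if "i < n" for n i
  proof -
    have "f (Suc i + (n - Suc i)) ! i = f (Suc i) ! i" by (rule nthf) simp
    then show ?thesis using that by (simp add: x_def)
  qed
  have fp: "fin_path E (FinP v (f n))" for n
  proof -
    have "cyl E (FinP v (f n)) \<noteq> {}" using f(2)[of n] unfolding bad_def by blast
    then show ?thesis using cyl_fin_path by blast
  qed
  have "inf_path E x"
    unfolding inf_path_def
  proof (intro conjI allI)
    fix i
    have "edge_path E (f (Suc (Suc i)))" using fp[of "Suc (Suc i)"] by simp
    then have "f (Suc (Suc i)) ! i \<in> edges E" "rng E (f (Suc (Suc i)) ! i) = src E (f (Suc (Suc i)) ! Suc i)"
      unfolding edge_path_def using len by (auto simp: subset_iff)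
    then show "x i \<in> edges E" "rng E (x i) = src E (x (Suc i))" using fx by auto
  qed
  then have xX: "InfP x \<in> Bd" by (simp add: boundary_def)
  have "src E (x 0) = v"
  proof -
    have "f (Suc 0) \<noteq> []" using len[of "Suc 0"] by auto
    then show ?thesis using fp[of "Suc 0"] by (simp add: x_def hd_conv_nth)
  qed
  then have "InfP x \<in> cyl E (FinP v [])" using xX by (simp add: cyl_iff)
  then obtain U where U: "U \<in> \<U>" "InfP x \<in> U" using \<U>(2) by blast
  then obtain j F where jF: "finite F" "nb E (InfP x) j F \<subseteq> U" using open_nb \<U>(1) by metis
  \<comment> \<open>An infinite path has no end at which edges are excluded, so its neighbourhoods
    contain the cylinders of its initial segments.\<close>
  have "cyl E (FinP v (f j)) \<subseteq> nb E (InfP x) j F"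
    using \<open>src E (x 0) = v\<close> fx len by (auto simp: cyl_iff nb_def)
  then have "cyl E (FinP v (f j)) \<subseteq> \<Union>{U}" using jF by auto
  then show False using f(2)[of j] U(1) unfolding bad_def by blast
qed

lemma nb_compact:
  assumes "x \<in> Bd"
  shows "compactin Tp (nb E x j F)"
  by (rule closed_compactin[OF cyl_compact[of "st E x"] _ nb_closed[OF assms]])
     (auto simp: nb_def cyl_iff)

text \<open>Paths in \<open>nb E x (m + j) F\<close> share the first \<open>m\<close> edges with
  \<open>x\<close>, and putting these edges back in front inverts the shift. The shift is thus a
  local homeomorphism on paths of sufficient length.\<close>

lemma shift_bij_nb:
  assumes x: "x \<in> Bd" and m: "enat m \<le> path_len x"
  shows "bij_betw (shift E m) (nb E x (m + j) F) (nb E (shift E m x) j F)"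
  unfolding bij_betw_def
proof (intro conjI equalityI subsetI)
  show "inj_on (shift E m) (nb E x (m + j) F)"
  proof (rule inj_onI)
    fix y z assume yz: "y \<in> nb E x (m + j) F" "z \<in> nb E x (m + j) F" "shift E m y = shift E m z"
    show "y = z"
    proof (rule shift_inj[of y m z])
      show "enat m \<le> path_len y" "enat m \<le> path_len z" using nb_len m yz by blast+
      show "y \<in> Bd" "z \<in> Bd" "st E y = st E z" using yz by (auto simp: nb_def)
      show "ed y i = ed z i" if "i < m" for i using nb_ed[OF _ m that] yz by metis
    qed (rule yz)
  qed
next
  fix w assume "w \<in> shift E m ` nb E x (m + j) F"
  then obtain z where z: "z \<in> nb E x (m + j) F" "w = shift E m z" by blast
  have zX: "z \<in> Bd" "st E z = st E x" using z by (auto simp: nb_def)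
  have zm: "enat m \<le> path_len z" using nb_len[OF z(1) m] .
  have "vx E z m = vx E x m" using nb_ed[OF z(1) m] zX by (intro vx_cong) auto
  then show "w \<in> nb E (shift E m x) j F"
    using z(1) shift_boundary[OF zX(1) zm] st_shift[OF zX(1) zm] st_shift[OF x m]
    unfolding z(2) nb_def by (auto simp: ed_shift[OF zm] ed_shift[OF m] path_len_shift_eq[OF m])
next
  fix w assume w: "w \<in> nb E (shift E m x) j F"
  have wX: "w \<in> Bd" and ws: "st E w = vx E x m" using w st_shift[OF x m] by (auto simp: nb_def)
  have p: "pre x m \<in> paths_from_to E (st E x) (st E w)" using pre_path[OF x m] ws by simp
  let ?z = "cat (st E x) (pre x m) w"
  have "shift E m ?z = w" using shift_cat[OF p wX] by simp
  moreover have "?z \<in> nb E x (m + j) F"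
    unfolding nb_def
  proof (intro CollectI conjI allI impI)
    show "?z \<in> Bd" using cat_boundary[OF p wX] .
    show "st E ?z = st E x" using st_cat[OF p] .
    fix i assume i: "i < m + j"
    show "ed ?z i = ed x i" if e: "ed x i \<noteq> None"
    proof (cases "i < m")
      case True
      then show ?thesis using nth_pre[OF _ m] by (simp add: ed_cat)
    next
      case False
      then have "ed w (i - m) = ed (shift E m x) (i - m)" using w i e ed_shift[OF m, of "i - m"] by (auto simp: nb_def)
      then show ?thesis using False ed_shift[OF m, of "i - m"] by (simp add: ed_cat)
    qed
    show "ed ?z i \<notin> Some ` F" if e: "path_len x = enat i"
    proof -
      have "m \<le> i" using e m by simp
      then have "path_len (shift E m x) = enat (i - m)" using path_len_shift_eq[OF m] e by simp
      then have "ed w (i - m) \<notin> Some ` F" using w i \<open>m \<le> i\<close> by (auto simp: nb_def)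
      then show ?thesis using \<open>m \<le> i\<close> by (simp add: ed_cat)
    qed
  qed
  ultimately show "w \<in> shift E m ` nb E x (m + j) F" by (metis imageI)
qed

end

section \<open>Germs of homeomorphisms of the boundary path space\<close>

lemma take_path:
  assumes "es \<in> paths_from_to E v w" "0 < n" "n \<le> length es" "rng E ` edges E \<subseteq> verts E"
  shows "take n es \<in> paths_from_to E v (rng E (es ! (n - 1)))"
proof -
  have ne: "es \<noteq> []" "take n es \<noteq> []" using assms by auto
  have e: "edge_path E es" "src E (hd es) = v" "v \<in> verts E" using assms(1) ne by (auto simp: paths_from_to_def)
  have "edge_path E (take n es)" using e(1) assms(3) by (auto simp: edge_path_def dest: in_set_takeD)
  moreover have "last (take n es) = es ! (n - 1)" using ne assms(2,3) by (simp add: last_conv_nth)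
  moreover have "es ! (n - 1) \<in> edges E" using e(1) assms(2,3) by (auto simp: edge_path_def)
  ultimately show ?thesis using ne e(2,3) assms(2,4) by (auto simp: paths_from_to_def)
qed

text \<open>A closed path of minimal length does not return early, since it could be cut off at the
  return.\<close>

lemma return_path_exists:
  assumes "es \<in> paths_from_to E v v" "es \<noteq> []" "rng E ` edges E \<subseteq> verts E"
  shows "\<exists>\<mu>. return_path E v \<mu>"
proof -
  define P where "P \<mu> \<longleftrightarrow> \<mu> \<in> paths_from_to E v v \<and> \<mu> \<noteq> []" for \<mu>
  obtain \<mu> where \<mu>: "P \<mu>" "\<And>\<nu>. P \<nu> \<Longrightarrow> length \<mu> \<le> length \<nu>"
    using ex_has_least_nat[of P es length] assms unfolding P_def by blast
  have "rng E (last \<mu>) = v" using \<mu>(1) by (auto simp: P_def paths_from_to_def)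
  moreover have "rng E (\<mu> ! i) \<noteq> v" if i: "Suc i < length \<mu>" for i
  proof
    assume "rng E (\<mu> ! i) = v"
    then have "P (take (Suc i) \<mu>)"
      using take_path[of \<mu> E v v "Suc i"] \<mu>(1) i assms(3) by (auto simp: P_def)
    then show False using \<mu>(2) i by fastforce
  qed
  ultimately show ?thesis using \<mu>(1) unfolding return_path_def P_def by blast
qed

context dgraph
begin

section \<open>The groupoid operations and rerouted paths\<close>

lemma groupoid_iff:
  "(x, k, y) \<in> graph_groupoid E \<longleftrightarrow> (\<exists>m n. x \<in> Bd \<and> y \<in> Bd \<and> enat m \<le> path_len x \<and> 
     enat n \<le> path_len y \<and> shift E m x = shift E n y \<and> k = int m - int n)"
  unfolding graph_groupoid_def by auto

lemma groupoidI:
  "x \<in> Bd \<Longrightarrow> y \<in> Bd \<Longrightarrow> enat m \<le> path_len x \<Longrightarrow> enat n \<le> path_len y \<Longrightarrow> shift E m x = shift E n y \<Longrightarrow>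
   k = int m - int n \<Longrightarrow> (x, k, y) \<in> graph_groupoid E"
  unfolding groupoid_iff by blast

lemma groupoidE:
  assumes "(x, k, y) \<in> graph_groupoid E"
  obtains m n where "x \<in> Bd" "y \<in> Bd" "enat m \<le> path_len x" "enat n \<le> path_len y"
    "shift E m x = shift E n y" "k = int m - int n"
  using assms[unfolded groupoid_iff] by (elim exE conjE) (rule that)

text \<open>A pair of cuts with equal tails can be moved further by the same number of edges. This
  compares different ways of writing one integer as a difference of cut positions.\<close>

lemma shift_step:
  assumes xy: "x \<in> Bd" "y \<in> Bd" "enat m \<le> path_len x" "enat n \<le> path_len y" "shift E m x = shift E n y"
  shows "enat (m + d) \<le> path_len x \<longleftrightarrow> enat (n + d) \<le> path_len y"
    and "enat (m + d) \<le> path_len x \<Longrightarrow> shift E (m + d) x = shift E (n + d) y"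
proof -
  show 1: "enat (m + d) \<le> path_len x \<longleftrightarrow> enat (n + d) \<le> path_len y"
    using path_len_shift_ge[OF xy(3), of d] path_len_shift_ge[OF xy(4), of d] xy(5) by simp
  show "shift E (m + d) x = shift E (n + d) y" if "enat (m + d) \<le> path_len x"
    using shift_shift[OF xy(1) that] shift_shift[OF xy(2), of n d] that 1 xy(5) by simp
qed

lemma groupoid_unit: "x \<in> Bd \<Longrightarrow> (x, 0, x) \<in> graph_groupoid E"
  by (rule groupoidI[of x x 0 0]) (auto simp: zero_enat_def[symmetric])

lemma groupoid_inv: "(x, k, y) \<in> graph_groupoid E \<Longrightarrow> (y, - k, x) \<in> graph_groupoid E"
  by (erule groupoidE, rule groupoidI) auto

text \<open>The two arrows may cut the middle path \<open>y\<close> at different positions; the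
  earlier cut is moved to the later one.\<close>

lemma groupoid_mult:
  assumes "(x, k, y) \<in> graph_groupoid E" "(y, l, z) \<in> graph_groupoid E"
  shows "(x, k + l, z) \<in> graph_groupoid E"
proof -
  obtain m n where 1: "x \<in> Bd" "y \<in> Bd" "enat m \<le> path_len x" "enat n \<le> path_len y"
    "shift E m x = shift E n y" "k = int m - int n" using groupoidE[OF assms(1)] .
  obtain m' n' where 2: "z \<in> Bd" "enat m' \<le> path_len y" "enat n' \<le> path_len z"
    "shift E m' y = shift E n' z" "l = int m' - int n'" using groupoidE[OF assms(2)] by metis
  show ?thesis
  proof (cases "n \<le> m'")
    case True
    then obtain d where d: "m' = n + d" using le_Suc_ex by blast
    have "enat (m + d) \<le> path_len x" using shift_step(1)[OF 1(1-5), of d] 2(2) d by simp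
    moreover have "shift E (m + d) x = shift E n' z"
      using shift_step(2)[OF 1(1-5) calculation] 2(4) d by simp
    ultimately show ?thesis by (rule groupoidI[OF 1(1) 2(1) _ 2(3)]) (use 1 2 d in simp)
  next
    case False
    then obtain d where d: "n = m' + d" using le_Suc_ex[of m' n] by auto
    have "enat (n' + d) \<le> path_len z" using shift_step(1)[OF 1(2) 2(1-4), of d] 1(4) d by simp
    moreover have "shift E m x = shift E (n' + d) z"
      using shift_step(2)[OF 1(2) 2(1-4), of d] 1(4,5) d by simp
    ultimately show ?thesis by (rule groupoidI[OF 1(1) 2(1) 1(3)]) (use 1 2 d in simp)
  qed
qed

text \<open>The path consists of the first \<open>i\<close> edges of \<open>x\<close>, then
  \<open>p\<close>, then the tail of \<open>x\<close> from \<open>i'\<close>. All escaping points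
  below are of this form.\<close>

lemma reroute:
  assumes x: "x \<in> Bd" and i: "enat i \<le> path_len x" and i': "enat i' \<le> path_len x"
    and p: "p \<in> paths_from_to E (vx E x i) (vx E x i')"
  obtains y k where "(y, k, x) \<in> graph_groupoid E" "st E y = st E x"
    "\<And>a. a < i \<Longrightarrow> ed y a = ed x a" "\<And>b. b < length p \<Longrightarrow> ed y (i + b) = Some (p ! b)"
    "\<And>c. ed y (i + length p + c) = ed x (i' + c)"
proof -
  let ?w = "shift E i' x"
  have w: "?w \<in> Bd" "st E ?w = vx E x i'" using shift_boundary[OF x i'] st_shift[OF x i'] by auto
  let ?q = "pre x i @ p"
  have q: "?q \<in> paths_from_to E (st E x) (st E ?w)" 
    using paths_append[OF pre_path[OF x i] p] w by simp
  let ?y = "cat (st E x) ?q ?w"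
  have "(?y, int (i + length p) - int i', x) \<in> graph_groupoid E"
    by (rule groupoidI[OF cat_boundary[OF q w(1)] x _ i' _ refl])
       (use shift_cat[OF q w(1)] in \<open>auto simp: path_len_cat\<close>)
  moreover have "st E ?y = st E x" using st_cat[OF q] .
  moreover have "ed ?y a = ed x a" if "a < i" for a
    using that nth_pre[OF that i] by (simp add: ed_cat nth_append)
  moreover have "ed ?y (i + b) = Some (p ! b)" if "b < length p" for b
    using that by (simp add: ed_cat nth_append)
  moreover have "ed ?y (i + length p + c) = ed x (i' + c)" for c
    by (simp add: ed_cat ed_shift[OF i'])
  ultimately show ?thesis using that by blast
qed

text \<open>If rerouting \<open>x\<close> along either of two distinct paths \<open>p\<close>, \<open>q\<close> gives \<open>x\<close> back, then one of
  \<open>p\<close>, \<open>q\<close> is a proper prefix of the other and \<open>x\<close> is eventually periodic.\<close>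

lemma two_reroutes:
  assumes x: "x \<in> Bd" and i: "enat i \<le> path_len x" and i': "enat i' \<le> path_len x"
    and pq: "p \<in> paths_from_to E (vx E x i) (vx E x i')" "q \<in> paths_from_to E (vx E x i) (vx E x i')" "p \<noteq> q"
    and no: "\<And>p q. p \<in> paths_from_to E (vx E x i) (vx E x i') \<Longrightarrow> q \<in> paths_from_to E (vx E x i) (vx E x i') \<Longrightarrow>
       {p, q} = {p', q'} \<Longrightarrow>
       length p < length q \<Longrightarrow> (\<And>b. b < length p \<Longrightarrow> p ! b = q ! b) \<Longrightarrow>
       (\<And>c. ed x (i + length p + c) = ed x (i + length q + c)) \<Longrightarrow> False"
    and pq': "{p, q} = {p', q'}"
  obtains y k where "(y, k, x) \<in> graph_groupoid E" "st E y = st E x"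
    "\<And>a. a < i \<Longrightarrow> ed y a = ed x a" "y \<noteq> x"
proof -
  obtain y k where y: "(y, k, x) \<in> graph_groupoid E" "st E y = st E x"
    "\<And>a. a < i \<Longrightarrow> ed y a = ed x a" "\<And>b. b < length p \<Longrightarrow> ed y (i + b) = Some (p ! b)"
    "\<And>c. ed y (i + length p + c) = ed x (i' + c)" using reroute[OF x i i' pq(1)] by blast
  obtain z l where z: "(z, l, x) \<in> graph_groupoid E" "st E z = st E x"
    "\<And>a. a < i \<Longrightarrow> ed z a = ed x a" "\<And>b. b < length q \<Longrightarrow> ed z (i + b) = Some (q ! b)"
    "\<And>c. ed z (i + length q + c) = ed x (i' + c)" using reroute[OF x i i' pq(2)] by blast
  have "y \<noteq> x \<or> z \<noteq> x"
  proof (rule ccontr)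
    assume "\<not> (y \<noteq> x \<or> z \<noteq> x)"
    then have yz: "y = x" "z = x" by auto
    have b: "p ! b = q ! b" if "b < length p" "b < length q" for b
      using y(4)[OF that(1)] z(4)[OF that(2)] yz by simp
    have c: "ed x (i + length p + c) = ed x (i + length q + c)" for c
      using y(5)[of c] z(5)[of c] yz by simp
    \<comment> \<open>Either path may be the shorter one; the hypothesis \<open>no\<close> mentions
      the unordered pair so that it serves both cases.\<close>
    consider "length p < length q" | "length q < length p" | "length p = length q" by linarith
    then show False
    proof cases
      case 1
      show ?thesis by (rule no[OF pq(1,2) pq' 1]) (use b c 1 in auto)
    next
      case 2
      have "{q, p} = {p', q'}" using pq' by blast
      show ?thesis by (rule no[OF pq(2,1) \<open>{q, p} = {p', q'}\<close> 2]) (use b c 2 in auto)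
    next
      case 3
      then show ?thesis using b pq(3) by (metis nth_equalityI)
    qed
  qed
  then show ?thesis using that y z by blast
qed

text \<open>Near \<open>y\<close> the map \<open>\<pi>\<close> replaces an initial segment of length \<open>n\<close> by one of length \<open>m\<close>;
  the lag \<open>k = m - n\<close> is the middle component of the corresponding arrow.\<close>

definition germ :: "(('v, 'e) bpath \<Rightarrow> ('v, 'e) bpath) \<Rightarrow> ('v, 'e) bpath \<Rightarrow> int \<Rightarrow> bool" where
  "germ \<pi> y k \<longleftrightarrow> (\<exists>m n U. openin Tp U \<and> y \<in> U \<and> k = int m - int n \<and>
     (\<forall>z\<in>U. enat m \<le> path_len (\<pi> z) \<and> enat n \<le> path_len z \<and> shift E m (\<pi> z) = shift E n z))"

lemma germE:
  assumes "germ \<pi> y k"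
  obtains m n U where "openin Tp U" "y \<in> U" "k = int m - int n"
     "\<And>z. z \<in> U \<Longrightarrow> enat m \<le> path_len (\<pi> z)" "\<And>z. z \<in> U \<Longrightarrow> enat n \<le> path_len z" 
     "\<And>z. z \<in> U \<Longrightarrow> shift E m (\<pi> z) = shift E n z"
proof -
  obtain m n U where U: "openin Tp U" "y \<in> U" "k = int m - int n"
     "\<forall>z\<in>U. enat m \<le> path_len (\<pi> z) \<and> enat n \<le> path_len z \<and> shift E m (\<pi> z) = shift E n z"
    using assms unfolding germ_def by blast
  show ?thesis by (rule that[OF U(1-3)]) (use U(4) in auto)
qed

lemma germI:
  "openin Tp U \<Longrightarrow> y \<in> U \<Longrightarrow> k = int m - int n \<Longrightarrow>
     (\<And>z. z \<in> U \<Longrightarrow> enat m \<le> path_len (\<pi> z) \<and> enat n \<le> path_len z \<and> shift E m (\<pi> z) = shift E n z) \<Longrightarrow> germ \<pi> y k"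
  unfolding germ_def by blast

lemma open_sub: "openin Tp U \<Longrightarrow> z \<in> U \<Longrightarrow> z \<in> Bd"
  using openin_subset by fastforce

lemma germ_groupoid:
  assumes "germ \<pi> y k" "\<pi> y \<in> Bd"
  shows "(\<pi> y, k, y) \<in> graph_groupoid E"
  using assms(1) by (rule germE) (metis groupoidI assms(2) open_sub)

lemma germ_cong:
  assumes "openin Tp U" "y \<in> U" "\<And>z. z \<in> U \<Longrightarrow> \<pi> z = \<rho> z" and g: "germ \<rho> y k"
  shows "germ \<pi> y k"
proof -
  obtain m n V where V: "openin Tp V" "y \<in> V" "k = int m - int n"
     "\<And>z. z \<in> V \<Longrightarrow> enat m \<le> path_len (\<rho> z)" "\<And>z. z \<in> V \<Longrightarrow> enat n \<le> path_len z" 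
     "\<And>z. z \<in> V \<Longrightarrow> shift E m (\<rho> z) = shift E n z" by (rule germE[OF g]) (rule that)
  show ?thesis
    by (rule germI[of "U \<inter> V" y k m n]) (use V assms in auto)
qed

lemma germ_id:
  assumes "openin Tp U" "y \<in> U" "\<And>z. z \<in> U \<Longrightarrow> \<pi> z = z"
  shows "germ \<pi> y 0"
  by (rule germI[OF assms(1,2), of 0 0 0]) (use assms in \<open>auto simp: zero_enat_def[symmetric]\<close>)

lemma cont_pre: "continuous_map Tp Tp \<pi> \<Longrightarrow> openin Tp V \<Longrightarrow> openin Tp {z \<in> Bd. \<pi> z \<in> V}"
  using openin_continuous_map_preimage by fastforce

lemma cont_in: "continuous_map Tp Tp \<pi> \<Longrightarrow> z \<in> Bd \<Longrightarrow> \<pi> z \<in> Bd"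
  by (auto simp: continuous_map_def)

text \<open>The matching of cuts from \<open>groupoid_mult\<close>, carried out uniformly on a
  neighbourhood.\<close>

lemma germ_comp:
  assumes c: "continuous_map Tp Tp \<pi>" "continuous_map Tp Tp \<rho>" 
    and g: "germ \<pi> (\<rho> y) k" "germ \<rho> y l"
  shows "germ (\<lambda>z. \<pi> (\<rho> z)) y (k + l)"
proof -
  obtain m n U where U: "openin Tp U" "\<rho> y \<in> U" "k = int m - int n"
     "\<And>z. z \<in> U \<Longrightarrow> enat m \<le> path_len (\<pi> z)" "\<And>z. z \<in> U \<Longrightarrow> enat n \<le> path_len z" 
     "\<And>z. z \<in> U \<Longrightarrow> shift E m (\<pi> z) = shift E n z" by (rule germE[OF g(1)]) (rule that)
  obtain m' n' V where V: "openin Tp V" "y \<in> V" "l = int m' - int n'"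
     "\<And>z. z \<in> V \<Longrightarrow> enat m' \<le> path_len (\<rho> z)" "\<And>z. z \<in> V \<Longrightarrow> enat n' \<le> path_len z" 
     "\<And>z. z \<in> V \<Longrightarrow> shift E m' (\<rho> z) = shift E n' z" by (rule germE[OF g(2)]) (rule that)
  let ?W = "V \<inter> {z \<in> Bd. \<rho> z \<in> U}"
  have W: "openin Tp ?W" "y \<in> ?W" using V(1,2) U(2) cont_pre[OF c(2) U(1)] open_sub by blast+
  have in_Bd: "z \<in> Bd" "\<rho> z \<in> Bd" "\<pi> (\<rho> z) \<in> Bd" if "z \<in> ?W" for z
    using that cont_in[OF c(1)] cont_in[OF c(2)] by auto
  show ?thesis
  proof (cases "n \<le> m'")
    case True
    then obtain d where d: "m' = n + d" using le_Suc_ex by blast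
    show ?thesis
    proof (rule germI[OF W, of _ "m + d" n'])
      show "k + l = int (m + d) - int n'" using U V d by simp
      fix z assume z: "z \<in> ?W"
      have s: "\<pi> (\<rho> z) \<in> Bd" "\<rho> z \<in> Bd" "enat m \<le> path_len (\<pi> (\<rho> z))" "enat n \<le> path_len (\<rho> z)"
        "shift E m (\<pi> (\<rho> z)) = shift E n (\<rho> z)" using in_Bd[OF z] U z by auto
      have "enat (m + d) \<le> path_len (\<pi> (\<rho> z))" using shift_step(1)[OF s, of d] V z d by auto
      then show "enat (m + d) \<le> path_len (\<pi> (\<rho> z)) \<and> enat n' \<le> path_len z \<and> shift E (m + d) (\<pi> (\<rho> z)) = shift E n' z"
        using shift_step(2)[OF s, of d] V z d by auto
    qed
  next
    case False
    then obtain d where d: "n = m' + d" using le_Suc_ex[of m' n] by auto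
    show ?thesis
    proof (rule germI[OF W, of _ m "n' + d"])
      show "k + l = int m - int (n' + d)" using U V d by simp
      fix z assume z: "z \<in> ?W"
      have s: "\<rho> z \<in> Bd" "z \<in> Bd" "enat m' \<le> path_len (\<rho> z)" "enat n' \<le> path_len z"
        "shift E m' (\<rho> z) = shift E n' z" using in_Bd[OF z] V z by auto
      have m: "enat (m' + d) \<le> path_len (\<rho> z)" using U z d by auto
      then have "enat (n' + d) \<le> path_len z" using shift_step(1)[OF s, of d] by auto
      then show "enat m \<le> path_len (\<pi> (\<rho> z)) \<and> enat (n' + d) \<le> path_len z \<and> shift E m (\<pi> (\<rho> z)) = shift E (n' + d) z"
        using shift_step(2)[OF s m] U z d by auto
    qed
  qed
qed

lemma germ_inv:
  assumes h: "homeomorphic_map Tp Tp \<pi>" and r: "\<And>z. z \<in> Bd \<Longrightarrow> \<rho> (\<pi> z) = z" and g: "germ \<pi> y k"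
  shows "germ \<rho> (\<pi> y) (- k)"
proof -
  obtain m n U where U: "openin Tp U" "y \<in> U" "k = int m - int n"
     "\<And>z. z \<in> U \<Longrightarrow> enat m \<le> path_len (\<pi> z)" "\<And>z. z \<in> U \<Longrightarrow> enat n \<le> path_len z" 
     "\<And>z. z \<in> U \<Longrightarrow> shift E m (\<pi> z) = shift E n z" by (rule germE[OF g]) (rule that)
  have "openin Tp (\<pi> ` U)" using h U(1) by (metis homeomorphic_imp_open_map open_map_def)
  then show ?thesis
    by (rule germI[of _ _ _ n m]) (use U r open_sub in auto)
qed

text \<open>Equal lags allow a common cut, after which both maps have the same tail; by continuity
  the edges before the cut agree with those of the common value at \<open>y\<close>. This is what
  identifies arrows of the groupoid with germs of homeomorphisms.\<close>

lemma eventually_equal: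
  assumes c: "continuous_map Tp Tp \<pi>" "continuous_map Tp Tp \<rho>" 
    and g: "germ \<pi> y k" "germ \<rho> y k" and e: "\<pi> y = \<rho> y"
  obtains U where "openin Tp U" "y \<in> U" "\<And>z. z \<in> U \<Longrightarrow> \<pi> z = \<rho> z"
proof -
  have main: thesis 
    if c: "continuous_map Tp Tp \<pi>" "continuous_map Tp Tp \<rho>" and e: "\<pi> y = \<rho> y"
    and U: "openin Tp U" "y \<in> U" "\<And>z. z \<in> U \<Longrightarrow> enat m \<le> path_len (\<pi> z)" "\<And>z. z \<in> U \<Longrightarrow> enat n \<le> path_len z" 
     "\<And>z. z \<in> U \<Longrightarrow> shift E m (\<pi> z) = shift E n z"
    and V: "openin Tp V" "y \<in> V" "\<And>z. z \<in> V \<Longrightarrow> enat (m + d) \<le> path_len (\<rho> z)" 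
      "\<And>z. z \<in> V \<Longrightarrow> enat (n + d) \<le> path_len z" 
     "\<And>z. z \<in> V \<Longrightarrow> shift E (m + d) (\<rho> z) = shift E (n + d) z" 
    and that: "\<And>U. openin Tp U \<Longrightarrow> y \<in> U \<Longrightarrow> (\<And>z. z \<in> U \<Longrightarrow> \<pi> z = \<rho> z) \<Longrightarrow> thesis"
  for \<pi> \<rho> m n d U V thesis
  proof -
    have yB: "y \<in> Bd" using U open_sub by blast
    \<comment> \<open>The summand \<open>0\<close> brings the index into the form
      \<open>m + j\<close> expected by \<open>nb_ed\<close>.\<close>
    let ?N = "nb E (\<pi> y) (m + d + 0) {}"
    have N: "openin Tp ?N" "\<pi> y \<in> ?N" using nb_open[OF cont_in[OF c(1) yB]] nb_self[OF cont_in[OF c(1) yB]] by auto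
    let ?W = "U \<inter> V \<inter> {z \<in> Bd. \<pi> z \<in> ?N} \<inter> {z \<in> Bd. \<rho> z \<in> ?N}"
    have "openin Tp ?W" using U(1) V(1) cont_pre[OF c(1) N(1)] cont_pre[OF c(2) N(1)] by blast
    moreover have "y \<in> ?W" using U(2) V(2) N(2) e yB by simp
    moreover have "\<pi> z = \<rho> z" if z: "z \<in> ?W" for z
    proof -
      have B: "z \<in> Bd" "\<pi> z \<in> Bd" "\<rho> z \<in> Bd" using z cont_in c by auto
      have s: "\<pi> z \<in> Bd" "z \<in> Bd" "enat m \<le> path_len (\<pi> z)" "enat n \<le> path_len z"
        "shift E m (\<pi> z) = shift E n z" using z U B by auto
      have l: "enat (m + d) \<le> path_len (\<pi> z)" using shift_step(1)[OF s, of d] V(4) z by blast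
      have "shift E (m + d) (\<pi> z) = shift E (m + d) (\<rho> z)"
        using shift_step(2)[OF s l] V(5) z by simp
      have l0: "enat (m + d) \<le> path_len (\<pi> y)" using V(2,3) e by simp
      have zN: "\<pi> z \<in> ?N" "\<rho> z \<in> ?N" using z by auto
      show ?thesis
      proof (rule shift_inj[OF B(2) l B(3)])
        show "enat (m + d) \<le> path_len (\<rho> z)" using V(3) z by blast
        show "shift E (m + d) (\<pi> z) = shift E (m + d) (\<rho> z)" by fact
        show "st E (\<pi> z) = st E (\<rho> z)" using zN by (simp add: nb_def)
        show "ed (\<pi> z) i = ed (\<rho> z) i" if "i < m + d" for i
          using nb_ed[OF zN(1) l0 that] nb_ed[OF zN(2) l0 that] by simp
      qed
    qed
    ultimately show thesis by (rule that)
  qed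
  obtain m n U where U: "openin Tp U" "y \<in> U" "k = int m - int n"
     "\<And>z. z \<in> U \<Longrightarrow> enat m \<le> path_len (\<pi> z)" "\<And>z. z \<in> U \<Longrightarrow> enat n \<le> path_len z" 
     "\<And>z. z \<in> U \<Longrightarrow> shift E m (\<pi> z) = shift E n z" by (rule germE[OF g(1)]) (rule that)
  obtain m' n' V where V: "openin Tp V" "y \<in> V" "k = int m' - int n'"
     "\<And>z. z \<in> V \<Longrightarrow> enat m' \<le> path_len (\<rho> z)" "\<And>z. z \<in> V \<Longrightarrow> enat n' \<le> path_len z" 
     "\<And>z. z \<in> V \<Longrightarrow> shift E m' (\<rho> z) = shift E n' z" by (rule germE[OF g(2)]) (rule that)
  show thesis
  proof (cases "m \<le> m'")
    case True
    then obtain d where d: "m' = m + d" using le_Suc_ex by blast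
    then have "n' = n + d" using U(3) V(3) by simp
    then show thesis using main[OF c e U(1,2,4-6) V(1,2)] V(4-6) d that by blast
  next
    case False
    then obtain d where d: "m = m' + d" using le_Suc_ex[of m' m] by auto
    then have n: "n = n' + d" using U(3) V(3) by simp
    show thesis
      by (rule main[OF c(2,1) e[symmetric] V(1,2,4-6) U(1,2) U(4-6)[unfolded d n]])
         (use that in \<open>auto simp: d n\<close>)
  qed
qed

text \<open>From position \<open>b\<close> on, every edge repeats the one \<open>b - a\<close>
  positions earlier, so the first \<open>b\<close> edges determine the path.\<close>

lemma periodic_unique:
  assumes "y \<in> Bd" "enat a \<le> path_len y" "enat b \<le> path_len y" "shift E a y = shift E b y"
    and "z \<in> Bd" "enat a \<le> path_len z" "enat b \<le> path_len z" "shift E a z = shift E b z"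
    and "a < b" "st E z = st E y" "\<And>i. i < b \<Longrightarrow> ed z i = ed y i"
  shows "z = y"
proof (rule path_eqI[where E = E])
  have y: "ed y (a + i) = ed y (b + i)" for i
    using shift_eq_iff[OF assms(1,2,1,3)] assms(4) by simp
  have z: "ed z (a + i) = ed z (b + i)" for i
    using shift_eq_iff[OF assms(5,6,5,7)] assms(8) by simp
  show "ed z i = ed y i" for i
  proof (induction i rule: less_induct)
    case (less i)
    show ?case
    proof (cases "i < b")
      case False
      then have "ed y i = ed y (a + (i - b))" "ed z i = ed z (a + (i - b))"
        using y[of "i - b"] z[of "i - b"] by simp_all
      then show ?thesis using less[of "a + (i - b)"] False assms(9) by simp
    qed (rule assms(11))
  qed
qed (rule assms)

end

section \<open>Escaping points, effectiveness and clopen supports\<close>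

locale kwi_graph = dgraph E for E :: "('v, 'e) graph" +
  assumes K: "condition_K E" and W: "condition_W E" and infty: "condition_infty E"
begin

text \<open>Condition (\<infinity>) gives infinitely many edges at the end of \<open>x\<close> that
  begin a closed path. One of them avoids \<open>F\<close>, and extending \<open>x\<close> once
  round that closed path gives the new point.\<close>

lemma escape_fin:
  assumes x: "x \<in> Bd" and i: "path_len x = enat i" and F: "finite F"
  obtains y k where "(y, k, x) \<in> graph_groupoid E" "y \<in> nb E x j F" "y \<noteq> x"
proof -
  let ?v = "vx E x i"
  have l: "enat i \<le> path_len x" using i by simp
  have v: "?v \<in> verts E" using vx_in[OF x l] .
  have "infinite_emitter E ?v" using end_infinite[OF x i] by (simp add: infinite_emitter_def)
  then have "infinite {e \<in> out_edges E ?v. reaches E (rng E e) ?v}"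
    using infty v by (simp add: condition_infty_def)
  then obtain e where e: "e \<in> out_edges E ?v" "reaches E (rng E e) ?v" "e \<notin> F"
    using F by (metis (no_types, lifting) finite_subset mem_Collect_eq subsetI)
  have ee: "e \<in> edges E" "src E e = ?v" using e(1) by (auto simp: out_edges_def)
  have "[e] \<in> paths_from_to E ?v (rng E e)" using ee v rng_in by (auto simp: paths_from_to_def edge_path_def)
  moreover obtain q where "q \<in> paths_from_to E (rng E e) ?v" using e(2) by (auto simp: reaches_def)
  ultimately have "[e] @ q \<in> paths_from_to E ?v ?v" by (rule paths_append)
  then obtain y k where y: "(y, k, x) \<in> graph_groupoid E" "st E y = st E x"
    "\<And>a. a < i \<Longrightarrow> ed y a = ed x a" "\<And>b. b < length ([e] @ q) \<Longrightarrow> ed y (i + b) = Some (([e] @ q) ! b)"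
    using reroute[OF x l l] by metis
  have yi: "ed y i = Some e" using y(4)[of 0] by simp
  have xi: "ed x i = None" using i by (simp add: path_len_eq_iff)
  have "ed x a \<noteq> None \<Longrightarrow> a < i" for a using i ed_Some_iff[of x a] by simp
  then have "y \<in> nb E x j F"
    using y(1) yi e(3) i y(2,3) by (auto simp: nb_def elim!: groupoidE)
  moreover have "y \<noteq> x" using yi xi by auto
  ultimately show ?thesis using that y(1) by blast
qed

text \<open>If the tail is wandering, Condition (W) offers two routes to a later vertex, and a tail
  reproduced by both would be eventually periodic and could not wander. Otherwise a vertex recurs,
  and Condition (K) offers two return paths, neither of which is a proper initial segment of the
  other.\<close>

lemma escape_inf:
  assumes x: "InfP a \<in> Bd"
  obtains y k where "(y, k, InfP a) \<in> graph_groupoid E" "y \<in> nb E (InfP a) j F" "y \<noteq> InfP a"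
proof -
  note result = that
  let ?x = "InfP a :: ('v, 'e) bpath"
  have a: "inf_path E a" using x by (simp add: inf_boundary_iff)
  have vxa: "vx E ?x n = src E (a n)" for n using ed_edge(2)[OF x, of n "a n"] by simp
  have rs: "E' ` edges E \<subseteq> verts E" if "E' = rng E" for E' using rng_in that by auto
  \<comment> \<open>The first \<open>j\<close> edges have to be kept, so the graph conditions are
    applied to the rest.\<close>
  let ?t = "\<lambda>k. a (j + k)"
  have t: "inf_path E ?t" using a by (auto simp: inf_path_def)
  have suff: ?thesis if "(y, k, ?x) \<in> graph_groupoid E" "st E y = st E ?x"
    "\<And>b. b < i \<Longrightarrow> ed y b = ed ?x b" "y \<noteq> ?x" "j \<le> i" for y k i
  proof -
    have "y \<in> nb E ?x j F" using that by (auto simp: nb_def elim!: groupoidE)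
    then show ?thesis using result that(1,4) by blast
  qed
  show ?thesis
  proof (cases "wandering E ?t")
    case True
    then obtain n \<mu> \<nu> where W': "\<mu> \<in> paths_from_to E (src E (a (j + 0))) (rng E (a (j + n)))"
       "\<nu> \<in> paths_from_to E (src E (a (j + 0))) (rng E (a (j + n)))" "\<mu> \<noteq> \<nu>"
      using W unfolding condition_W_def by blast
    have r: "rng E (a (j + n)) = vx E ?x (Suc (j + n))" by (simp add: vx_def)
    have len: "enat b \<le> path_len ?x" for b by simp
    obtain y k where y: "(y, k, ?x) \<in> graph_groupoid E" "st E y = st E ?x"
       "\<And>b. b < j \<Longrightarrow> ed y b = ed ?x b" "y \<noteq> ?x"
    proof (rule two_reroutes[OF x len len, of \<mu> j "Suc (j + n)" \<nu> \<mu> \<nu>])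
      show "\<mu> \<in> paths_from_to E (vx E ?x j) (vx E ?x (Suc (j + n)))"
        "\<nu> \<in> paths_from_to E (vx E ?x j) (vx E ?x (Suc (j + n)))"
        using W'(1,2) unfolding r vxa by simp_all
      fix p q :: "'e list"
      assume l: "length p < length q" and c: "\<And>c. ed ?x (j + length p + c) = ed ?x (j + length q + c)"
      define d where "d = length q - length p"
      have d: "d > 0" using l by (simp add: d_def)
      have per: "a (j + length p + c + d) = a (j + length p + c)" for c
        using c[of c] l by (simp add: d_def algebra_simps)
      have per': "a (j + (length p + r * d)) = a (j + length p)" for r
      proof (induction r)
        case (Suc r)
        then show ?case using per[of "r * d"] by (simp add: algebra_simps)
      qed simp
      \<comment> \<open>A positive period repeats one source vertex infinitely often, which a
        wandering path forbids.\<close>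
      have "inj (\<lambda>r. length p + r * d)" using d by (auto simp: inj_on_def)
      then have "infinite (range (\<lambda>r. length p + r * d))" by (rule range_inj_infinite)
      moreover have "range (\<lambda>r. length p + r * d) \<subseteq> {i. src E (?t i) = src E (a (j + length p))}"
        using per' by auto
      ultimately have "infinite {i. src E (?t i) = src E (a (j + length p))}" using infinite_super by blast
      then show False using True by (auto simp: wandering_def)
    qed (use W' in auto)
    then show ?thesis using suff[of y k j] by blast
  next
    case False
    then obtain v where v: "infinite {i. src E (?t i) = v}" using t by (auto simp: wandering_def)
    then obtain i1 where i1: "src E (?t i1) = v" using not_finite_existsD by blast
    \<comment> \<open>A second visit to \<open>v\<close> closes a path there, which rules out the
      first alternative of Condition (K).\<close>
    obtain i2 where i2: "src E (?t i2) = v" "i1 < i2" using v unfolding infinite_nat_iff_unbounded by blast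
    let ?i = "j + i1"
    have len: "enat b \<le> path_len ?x" for b by simp
    have vi: "vx E ?x ?i = v" using i1 vxa by simp
    have vV: "v \<in> verts E" using vx_in[OF x len, of ?i] vi by simp
    let ?w = "shift E ?i ?x"
    have w: "?w \<in> Bd" using shift_boundary[OF x] by simp
    have "pre ?w (i2 - i1) \<in> paths_from_to E (st E ?w) (vx E ?w (i2 - i1))"
      using pre_path[OF w] by simp
    moreover have "st E ?w = v" using st_shift[OF x, of ?i] vi by simp
    moreover have "vx E ?w (i2 - i1) = v" using vx_shift[OF x, of ?i "i2 - i1"] i2 vxa by simp
    ultimately have c: "pre ?w (i2 - i1) \<in> paths_from_to E v v" by simp
    have "pre ?w (i2 - i1) \<noteq> []" using i2(2) by (metis diff_is_0_eq length_0_conv length_pre linorder_not_less)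
    then obtain \<mu> \<nu> where mn: "return_path E v \<mu>" "return_path E v \<nu>" "\<mu> \<noteq> \<nu>"
      using return_path_exists[OF c _ rs[OF refl]] K vV unfolding condition_K_def by blast
    obtain y k where y: "(y, k, ?x) \<in> graph_groupoid E" "st E y = st E ?x"
       "\<And>b. b < ?i \<Longrightarrow> ed y b = ed ?x b" "y \<noteq> ?x"
    proof (rule two_reroutes[OF x len len, of \<mu> ?i ?i \<nu> \<mu> \<nu>])
      show "\<mu> \<in> paths_from_to E (vx E ?x ?i) (vx E ?x ?i)" "\<nu> \<in> paths_from_to E (vx E ?x ?i) (vx E ?x ?i)"
        using mn vi by (auto simp: return_path_def)
      fix p q :: "'e list"
      assume pq: "{p, q} = {\<mu>, \<nu>}" and l: "length p < length q" and c: "\<And>b. b < length p \<Longrightarrow> p ! b = q ! b"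
      have "return_path E v p" "return_path E v q" using pq mn by (auto simp: doubleton_eq_iff)
      then have r: "p \<noteq> []" "rng E (last p) = v" "rng E (last q) = v" 
        "\<And>i. Suc i < length q \<Longrightarrow> rng E (q ! i) \<noteq> rng E (last q)"
        by (auto simp: return_path_def paths_from_to_def)
      \<comment> \<open>The longer path would pass through \<open>v\<close> where the shorter one
        ends, which a return path may not do before its own end.\<close>
      have "rng E (q ! (length p - 1)) = v" using r(1,2) c[of "length p - 1"] by (simp add: last_conv_nth)
      then show False using r(1,3) r(4)[of "length p - 1"] l by (cases p) auto
    qed (use mn in auto)
    then show ?thesis using suff[of y k ?i] by simp
  qed
qed

text \<open>The three graph conditions enter everything that follows through this statement alone:
  near each boundary path lies another one of the same orbit.\<close>

lemma escape:
  assumes A: "openin Tp A" "x \<in> A"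
  obtains y k where "(y, k, x) \<in> graph_groupoid E" "y \<in> A" "y \<noteq> x"
proof -
  have x: "x \<in> Bd" using A open_sub by blast
  obtain j F where jF: "finite F" "nb E x j F \<subseteq> A" using open_nb[OF A] .
  show ?thesis
  proof (cases x)
    case (FinP v es)
    then show ?thesis using escape_fin[OF x _ jF(1), of "length es" j] jF(2) that by auto
  next
    case (InfP a)
    then show ?thesis using escape_inf[of a j F] x jF(2) that by blast
  qed
qed

text \<open>By \<open>periodic_unique\<close> a point of \<open>U\<close> is isolated in
  \<open>U\<close>, and \<open>escape\<close> excludes this. It is the effectiveness of the
  groupoid.\<close>

lemma no_open_periodic:
  assumes U: "openin Tp U" "y \<in> U" and ab: "a \<noteq> b"
    and s: "\<And>z. z \<in> U \<Longrightarrow> enat a \<le> path_len z \<and> enat b \<le> path_len z \<and> shift E a z = shift E b z"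
  shows False
proof -
  have main: False if ab: "a < b" 
    and s: "\<And>z. z \<in> U \<Longrightarrow> enat a \<le> path_len z \<and> enat b \<le> path_len z \<and> shift E a z = shift E b z" for a b
  proof -
    have y: "y \<in> Bd" using U open_sub by blast
    have "openin Tp (U \<inter> nb E y (b + 0) {})" "y \<in> U \<inter> nb E y (b + 0) {}"
      using U nb_open[OF y, of "{}"] nb_self[OF y] by auto
    then obtain z k where z: "z \<in> U" "z \<in> nb E y (b + 0) {}" "z \<noteq> y" by (rule escape) auto
    have "z = y"
      by (rule periodic_unique[of _ a b]) (use s[OF z(1)] s[OF U(2)] y z ab nb_ed[OF z(2)] in \<open>auto simp: nb_def\<close>)
    then show False using z by blast
  qed
  show False using main[of a b] main[of b a] ab s by (metis linorder_neqE_nat)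
qed

text \<open>With two different lags at one point, two different iterates of the shift would agree on
  a neighbourhood.\<close>

lemma germ_unique:
  assumes in_Bd: "\<And>z. z \<in> Bd \<Longrightarrow> \<pi> z \<in> Bd" and g: "germ \<pi> y k" "germ \<pi> y l"
  shows "k = l"
proof (rule ccontr)
  assume kl: "k \<noteq> l"
  have main: False
    if U: "openin Tp U" "y \<in> U" "\<And>z. z \<in> U \<Longrightarrow> enat m \<le> path_len (\<pi> z)" "\<And>z. z \<in> U \<Longrightarrow> enat n \<le> path_len z" 
     "\<And>z. z \<in> U \<Longrightarrow> shift E m (\<pi> z) = shift E n z"
    and V: "openin Tp V" "y \<in> V" "\<And>z. z \<in> V \<Longrightarrow> enat (m + d) \<le> path_len (\<pi> z)" 
      "\<And>z. z \<in> V \<Longrightarrow> enat n' \<le> path_len z" 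
     "\<And>z. z \<in> V \<Longrightarrow> shift E (m + d) (\<pi> z) = shift E n' z" 
    and ne: "n' \<noteq> n + d" for m n d n' U V
  proof (rule no_open_periodic)
    show "openin Tp (U \<inter> V)" "y \<in> U \<inter> V" using U V by auto
    show "n' \<noteq> n + d" by fact
    fix z assume z: "z \<in> U \<inter> V"
    have B: "z \<in> Bd" "\<pi> z \<in> Bd" using z U(1) open_sub in_Bd by auto
    have s: "\<pi> z \<in> Bd" "z \<in> Bd" "enat m \<le> path_len (\<pi> z)" "enat n \<le> path_len z"
        "shift E m (\<pi> z) = shift E n z" using z U B by auto
    have l: "enat (m + d) \<le> path_len (\<pi> z)" using V z by blast
    show "enat n' \<le> path_len z \<and> enat (n + d) \<le> path_len z \<and> shift E n' z = shift E (n + d) z"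
      using shift_step(1)[OF s, of d] shift_step(2)[OF s l] V z l by auto
  qed
  obtain m n U where U: "openin Tp U" "y \<in> U" "k = int m - int n"
     "\<And>z. z \<in> U \<Longrightarrow> enat m \<le> path_len (\<pi> z)" "\<And>z. z \<in> U \<Longrightarrow> enat n \<le> path_len z" 
     "\<And>z. z \<in> U \<Longrightarrow> shift E m (\<pi> z) = shift E n z" by (rule germE[OF g(1)]) (rule that)
  obtain m' n' V where V: "openin Tp V" "y \<in> V" "l = int m' - int n'"
     "\<And>z. z \<in> V \<Longrightarrow> enat m' \<le> path_len (\<pi> z)" "\<And>z. z \<in> V \<Longrightarrow> enat n' \<le> path_len z" 
     "\<And>z. z \<in> V \<Longrightarrow> shift E m' (\<pi> z) = shift E n' z" by (rule germE[OF g(2)]) (rule that)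
  show False
  proof (cases "m \<le> m'")
    case True
    then obtain d where d: "m' = m + d" using le_Suc_ex by blast
    have "n' \<noteq> n + d" using kl U(3) V(3) d by auto
    then show False using main[OF U(1,2,4-6) V(1,2)] V(4-6) d by blast
  next
    case False
    then obtain d where d: "m = m' + d" using le_Suc_ex[of m' m] by auto
    have "n \<noteq> n' + d" using kl U(3) V(3) d by auto
    then show False using main[OF V(1,2,4-6) U(1,2)] U(4-6) d by blast
  qed
qed

text \<open>A fixed point with nonzero lag is eventually periodic and determined by a finite initial segment.
  So it is isolated among the fixed points, and hence in the closure of the moved points.\<close>

lemma supp_clopen:
  assumes c: "continuous_map Tp Tp \<pi>" and g: "\<And>y. y \<in> Bd \<Longrightarrow> \<exists>k. germ \<pi> y k"
  shows "openin Tp (Tp closure_of {x \<in> Bd. \<pi> x \<noteq> x})" (is "openin Tp (_ closure_of ?M)")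
proof (subst openin_subopen, intro ballI)
  fix x assume x: "x \<in> Tp closure_of ?M"
  have MS: "?M \<subseteq> Tp closure_of ?M" by (rule closure_of_subset) auto
  have xB: "x \<in> Bd" using x by (simp add: in_closure_of)
  show "\<exists>W. openin Tp W \<and> x \<in> W \<and> W \<subseteq> Tp closure_of ?M"
  proof (cases "\<pi> x = x")
    case False
    have "closedin Tp {x \<in> topspace Tp. \<pi> x = id x}"
      by (rule closedin_continuous_maps_eq[OF hausdorff_T c continuous_map_id])
    then have "openin Tp (topspace Tp - {x \<in> topspace Tp. \<pi> x = id x})" by blast
    moreover have "topspace Tp - {x \<in> topspace Tp. \<pi> x = id x} = ?M" by auto
    ultimately have "openin Tp ?M" by simp
    then show ?thesis using MS False xB by blast
  next
    case True
    obtain k where "germ \<pi> x k" using g[OF xB] by blast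
    then obtain m n U where U: "openin Tp U" "x \<in> U" "k = int m - int n"
     "\<And>z. z \<in> U \<Longrightarrow> enat m \<le> path_len (\<pi> z)" "\<And>z. z \<in> U \<Longrightarrow> enat n \<le> path_len z" 
     "\<And>z. z \<in> U \<Longrightarrow> shift E m (\<pi> z) = shift E n z" by (rule germE) (rule that)
    have N: "openin Tp (nb E x (b + 0) {})" "x \<in> nb E x (b + 0) {}" for b 
      using nb_open[OF xB, of "{}"] nb_self[OF xB] by auto
    show ?thesis
    proof (cases "m = n")
      \<comment> \<open>With lag zero at a fixed point, \<open>\<pi>\<close> preserves the tail and,
        by continuity, the edges before the cut, so it is the identity near \<open>x\<close> and
        \<open>x\<close> is not in the closure.\<close>
      case mn: True
      let ?W = "U \<inter> nb E x (m + 0) {} \<inter> {z \<in> Bd. \<pi> z \<in> nb E x (m + 0) {}}"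
      have W: "openin Tp ?W" "x \<in> ?W" using U(1,2) N[of m] cont_pre[OF c] xB True by auto
      have l: "enat m \<le> path_len x" using U(2,5) mn by blast
      have "\<pi> z = z" if z: "z \<in> ?W" for z
      proof (rule shift_inj)
        show "\<pi> z \<in> Bd" "z \<in> Bd" using z cont_in[OF c] by auto
        show "enat m \<le> path_len (\<pi> z)" "enat m \<le> path_len z" "shift E m (\<pi> z) = shift E m z"
          using z U mn by auto
        show "st E (\<pi> z) = st E z" using z by (auto simp: nb_def)
        show "ed (\<pi> z) i = ed z i" if "i < m" for i
          using z nb_ed[OF _ l that, of _ 0 "{}"] by auto
      qed
      then have "?W \<inter> ?M = {}" by blast
      then have False using openin_Int_closure_of_eq_empty[OF W(1), of ?M] x W(2) by blast
      then show ?thesis ..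
    next
      case mn: False
      let ?b = "max m n"
      let ?W = "U \<inter> nb E x (?b + 0) {}"
      have W: "openin Tp ?W" "x \<in> ?W" using U(1,2) N[of ?b] by auto
      have lx: "enat ?b \<le> path_len x" using U(4,5)[OF U(2)] True by (simp add: max_def)
      have uniq: "z = w" if z: "z \<in> ?W" "\<pi> z = z" and w: "w \<in> ?W" "\<pi> w = w" for z w
      proof -
        have zw: "z \<in> Bd" "w \<in> Bd" "st E z = st E w" using z(1) w(1) by (auto simp: nb_def)
        have e: "ed z i = ed w i" if "i < ?b" for i
          using nb_ed[OF _ lx that, of z 0 "{}"] nb_ed[OF _ lx that, of w 0 "{}"] z(1) w(1) by simp
        have zs: "enat m \<le> path_len z" "enat n \<le> path_len z" "shift E m z = shift E n z"
          using U(4-6)[of z] z by auto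
        have ws: "enat m \<le> path_len w" "enat n \<le> path_len w" "shift E m w = shift E n w"
          using U(4-6)[of w] w by auto
        show ?thesis
        proof (cases "m < n")
          case True
          then show ?thesis by (intro periodic_unique[of w m n z]) (use zw zs ws e in auto)
        next
          case False
          then show ?thesis using mn by (intro periodic_unique[of w n m z]) (use zw zs ws e in auto)
        qed
      qed
      have "z \<in> Tp closure_of ?M" if z: "z \<in> ?W" for z
      proof (cases "\<pi> z = z")
        case fz: True
        have zB: "z \<in> Bd" using z by (auto simp: nb_def)
        show ?thesis
          unfolding in_closure_of
        proof (intro conjI allI impI)
          show "z \<in> topspace Tp" using zB by simp
          fix V assume V: "z \<in> V \<and> openin Tp V"
          then have "openin Tp (V \<inter> ?W)" "z \<in> V \<inter> ?W" using W z by auto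
          \<comment> \<open>By \<open>uniq\<close> the set \<open>?W\<close> contains no fixed point
            besides \<open>z\<close>, so the escaping point is moved.\<close>
          then obtain w k where w: "w \<in> V \<inter> ?W" "w \<noteq> z" by (rule escape)
          then have "\<pi> w \<noteq> w" using uniq[of w z] z fz by blast
          moreover have "w \<in> Bd" using w by (auto simp: nb_def)
          ultimately show "\<exists>y. y \<in> ?M \<and> y \<in> V" using w by blast
        qed
      next
        case False
        have "z \<in> Bd" using z by (auto simp: nb_def)
        then show ?thesis using MS False by blast
      qed
      then show ?thesis using W by blast
    qed
  qed
qed

end

section \<open>The topological full group\<close>

context kwi_graph
begin

text \<open>Tails of points near \<open>z\<close> are tails of points near \<open>w\<close>, because
  suitable neighbourhoods of both are shifted onto the same set. This yields the continuity of the
  transpositions.\<close>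

lemma local_section:
  assumes wz: "w \<in> Bd" "z \<in> Bd" "enat m \<le> path_len w" "enat n \<le> path_len z" "shift E m w = shift E n z"
    and C: "openin Tp C" "w \<in> C" and D: "openin Tp D" "z \<in> D"
  obtains V where "openin Tp V" "z \<in> V" "V \<subseteq> D"
    "\<And>z'. z' \<in> V \<Longrightarrow> \<exists>w'\<in>C. shift E m w' = shift E n z'"
proof -
  obtain j F where jF: "finite F" "nb E w (m + j) F \<subseteq> C" "nb E z (n + j) F \<subseteq> D"
    using open_nb2[OF C D] .
  show ?thesis
  proof (rule that[of "nb E z (n + j) F"])
    show "openin Tp (nb E z (n + j) F)" "z \<in> nb E z (n + j) F" using nb_open nb_self wz(2) jF(1) by auto
    fix z' assume "z' \<in> nb E z (n + j) F"
    then have "shift E n z' \<in> nb E (shift E n z) j F"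
      using shift_bij_nb[OF wz(2,4)] by (meson bij_betwE)
    then have "shift E n z' \<in> shift E m ` nb E w (m + j) F"
      using shift_bij_nb[OF wz(1,3)] wz(5) by (metis bij_betw_def)
    then show "\<exists>w'\<in>C. shift E m w' = shift E n z'" using jF(2) by (metis imageE subsetD)
  qed (rule jF)
qed

section \<open>Basic open sets of the groupoid\<close>

lemma topspace_groupoid [simp]: "topspace (groupoid_top E) = graph_groupoid E"
  and groupoid_basis_open: "B \<in> groupoid_basis E \<Longrightarrow> openin (groupoid_top E) B"
  and groupoid_basisI: "x \<in> Bd \<Longrightarrow> y \<in> Bd \<Longrightarrow> enat m \<le> path_len x \<Longrightarrow> enat n \<le> path_len y \<Longrightarrow>
     shift E m x = shift E n y \<Longrightarrow> finite F \<Longrightarrow>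
     {(x', int m - int n, z) | x' z. x' \<in> nb E x (m + j) F \<and> z \<in> nb E y (n + j) F \<and> shift E m x' = shift E n z}
       \<in> groupoid_basis E"
proof -
  have sub: "B \<subseteq> graph_groupoid E" if B: "B \<in> groupoid_basis E" for B
  proof
    fix g assume g: "g \<in> B"
    obtain U V m n where UV: "openin Tp U" "openin Tp V" "\<forall>x\<in>U. enat m \<le> path_len x" "\<forall>y\<in>V. enat n \<le> path_len y"
      "B = {(x, int m - int n, y) | x y. x \<in> U \<and> y \<in> V \<and> shift E m x = shift E n y}"
      using B unfolding groupoid_basis_def by blast
    then obtain x y where "g = (x, int m - int n, y)" "x \<in> U" "y \<in> V" "shift E m x = shift E n y" using g by blast
    then show "g \<in> graph_groupoid E" using groupoidI[of x y m n] UV open_sub by blast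
  qed
  show op: "openin (groupoid_top E) B" if B: "B \<in> groupoid_basis E" for B
    unfolding groupoid_top_def openin_subtopology
    using sub[OF B] topology_generated_by_Basis[OF B] by blast
  show basic: "{(x', int m - int n, z) | x' z. x' \<in> nb E x (m + j) F \<and> z \<in> nb E y (n + j) F \<and> shift E m x' = shift E n z}
       \<in> groupoid_basis E" (is "?B \<in> _")
    if "x \<in> Bd" "y \<in> Bd" "enat m \<le> path_len x" "enat n \<le> path_len y"
      "shift E m x = shift E n y" "finite F" for x y m n F j
  proof -
    have "bij_betw (shift E m) (nb E x (m + j) F) (nb E (shift E m x) j F)"
      "bij_betw (shift E n) (nb E y (n + j) F) (nb E (shift E m x) j F)"
      using shift_bij_nb that by metis+
    then have "inj_on (shift E m) (nb E x (m + j) F)" "inj_on (shift E n) (nb E y (n + j) F)"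
      "shift E m ` nb E x (m + j) F = shift E n ` nb E y (n + j) F"
      by (auto simp: bij_betw_def)
    moreover have "openin Tp (nb E x (m + j) F)" "openin Tp (nb E y (n + j) F)"
      using that nb_open by auto
    moreover have "\<forall>x'\<in>nb E x (m + j) F. enat m \<le> path_len x'" "\<forall>y'\<in>nb E y (n + j) F. enat n \<le> path_len y'"
      using nb_len that by blast+
    ultimately show ?thesis unfolding groupoid_basis_def by blast
  qed
  show "topspace (groupoid_top E) = graph_groupoid E"
  proof
    show "topspace (groupoid_top E) \<subseteq> graph_groupoid E" by (simp add: groupoid_top_def)
    show "graph_groupoid E \<subseteq> topspace (groupoid_top E)"
    proof
      fix g assume g: "g \<in> graph_groupoid E"
      obtain x k y where gxy: "g = (x, k, y)" by (cases g)
      then obtain m n where mn: "x \<in> Bd" "y \<in> Bd" "enat m \<le> path_len x" "enat n \<le> path_len y"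
        "shift E m x = shift E n y" "k = int m - int n" using g groupoidE by metis
      let ?B = "{(x', int m - int n, z) | x' z. x' \<in> nb E x (m + 0) {} \<and> z \<in> nb E y (n + 0) {} \<and> shift E m x' = shift E n z}"
      have "?B \<in> groupoid_basis E" by (rule basic[OF mn(1-5)]) simp
      then have "?B \<subseteq> topspace (groupoid_top E)" using op openin_subset by blast
      moreover have "g \<in> ?B" using mn gxy nb_self by simp
      ultimately show "g \<in> topspace (groupoid_top E)" by blast
    qed
  qed
qed

text \<open>The generating sets may use a cut other than \<open>m\<close>, \<open>n\<close>, but
  cuts with the same lag differ by a common number of edges. Moving a cut further is harmless;
  moving it back is possible because nearby paths copy the first \<open>m\<close> edges of
  \<open>x\<close> and the first \<open>n\<close> edges of \<open>y\<close>.\<close>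

lemma groupoid_open_nbhd:
  assumes W: "openin (groupoid_top E) W" and g: "(x, k, y) \<in> W"
    and mn: "k = int m - int n" "enat m \<le> path_len x" "enat n \<le> path_len y" "shift E m x = shift E n y"
  obtains j F where "finite F"
    "\<And>x' z. x' \<in> nb E x (m + j) F \<Longrightarrow> z \<in> nb E y (n + j) F \<Longrightarrow> shift E m x' = shift E n z \<Longrightarrow> (x', k, z) \<in> W"
proof -
  obtain W' where W': "openin (topology_generated_by (groupoid_basis E)) W'" "W = W' \<inter> graph_groupoid E"
    using W unfolding groupoid_top_def openin_subtopology by blast
  have xy: "x \<in> Bd" "y \<in> Bd" using g W'(2) groupoid_iff by blast+
  have "generate_topology_on (groupoid_basis E) W'" using W'(1) by (rule openin_topology_generated_by)
  then have "(x, k, y) \<in> W' \<longrightarrow> (\<exists>j F. finite F \<and> (\<forall>x'\<in>nb E x (m + j) F. \<forall>z\<in>nb E y (n + j) F.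
      shift E m x' = shift E n z \<longrightarrow> (x', k, z) \<in> W'))"
  proof (induction rule: generate_topology_on.induct)
    case (Int a b)
    show ?case
    proof
      assume "(x, k, y) \<in> a \<inter> b"
      then obtain j F j' F' where 
        1: "finite F" "\<forall>x'\<in>nb E x (m + j) F. \<forall>z\<in>nb E y (n + j) F. shift E m x' = shift E n z \<longrightarrow> (x', k, z) \<in> a"
        and 2: "finite F'" "\<forall>x'\<in>nb E x (m + j') F'. \<forall>z\<in>nb E y (n + j') F'. shift E m x' = shift E n z \<longrightarrow> (x', k, z) \<in> b"
        using Int.IH by auto
      have s: "nb E w (l + (j + j')) (F \<union> F') \<subseteq> nb E w (l + j) F" "nb E w (l + (j + j')) (F \<union> F') \<subseteq> nb E w (l + j') F'"
        for w l by (rule nb_mono, simp, simp)+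
      have "finite (F \<union> F')" using 1 2 by simp
      moreover have "\<forall>x'\<in>nb E x (m + (j + j')) (F \<union> F'). \<forall>z\<in>nb E y (n + (j + j')) (F \<union> F'). 
          shift E m x' = shift E n z \<longrightarrow> (x', k, z) \<in> a \<inter> b"
        using 1(2) 2(2) s by blast
      ultimately show "\<exists>j F. finite F \<and> (\<forall>x'\<in>nb E x (m + j) F. \<forall>z\<in>nb E y (n + j) F.
         shift E m x' = shift E n z \<longrightarrow> (x', k, z) \<in> a \<inter> b)" by blast
    qed
  next
    case (UN K)
    show ?case
    proof
      assume "(x, k, y) \<in> \<Union>K"
      then obtain a where a: "a \<in> K" "(x, k, y) \<in> a" by blast
      then obtain j F where "finite F" "\<forall>x'\<in>nb E x (m + j) F. \<forall>z\<in>nb E y (n + j) F. shift E m x' = shift E n z \<longrightarrow> (x', k, z) \<in> a"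
        using UN by meson
      then show "\<exists>j F. finite F \<and> (\<forall>x'\<in>nb E x (m + j) F. \<forall>z\<in>nb E y (n + j) F.
         shift E m x' = shift E n z \<longrightarrow> (x', k, z) \<in> \<Union>K)" using a(1) by blast
    qed
  next
    case (Basis s)
    show ?case
    proof
      assume s: "(x, k, y) \<in> s"
      obtain U V m' n' where UV: "openin Tp U" "openin Tp V" "\<forall>x\<in>U. enat m' \<le> path_len x" "\<forall>y\<in>V. enat n' \<le> path_len y"
        "s = {(x, int m' - int n', y) | x y. x \<in> U \<and> y \<in> V \<and> shift E m' x = shift E n' y}"
        using Basis unfolding groupoid_basis_def by blast
      have s': "x \<in> U" "y \<in> V" "k = int m' - int n'" "shift E m' x = shift E n' y" using s UV(5) by auto
      obtain j F where jF: "finite F" "nb E x (m + j) F \<subseteq> U" "nb E y (n + j) F \<subseteq> V"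
        using open_nb2[OF UV(1) s'(1) UV(2) s'(2)] .
      have "shift E m' x' = shift E n' z" 
        if x': "x' \<in> nb E x (m + j) F" and z: "z \<in> nb E y (n + j) F" and e: "shift E m x' = shift E n z" for x' z
      proof -
        have B: "x' \<in> Bd" "z \<in> Bd" using x' z nb_subset by blast+
        have l: "enat m \<le> path_len x'" "enat n \<le> path_len z" using nb_len[OF x' mn(2)] nb_len[OF z mn(3)] by auto
        have l': "enat m' \<le> path_len x'" "enat n' \<le> path_len z" using UV(3,4) jF x' z by blast+
        show ?thesis
        proof (cases "m \<le> m'")
          case True
          then obtain d where d: "m' = m + d" using le_Suc_ex by blast
          have "n' = n + d" using d s'(3) mn(1) by simp
          then show ?thesis using shift_step(2)[OF B l e, of d] l'(1) d by simp
        next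
          case False
          then obtain d where d: "m = m' + d" using le_Suc_ex[of m' m] by auto
          have n: "n = n' + d" using d s'(3) mn(1) by simp
          have lx: "enat m' \<le> path_len x" "enat n' \<le> path_len y" using UV(3,4) s' by blast+
          have ex: "ed x' i = ed x i" if "i < m" for i using nb_ed[OF x' mn(2) that] .
          have ey: "ed z i = ed y i" if "i < n" for i using nb_ed[OF z mn(3) that] .
          have 0: "vx E x m' = vx E y n'" "\<And>i. ed x (m' + i) = ed y (n' + i)"
            using shift_eq_iff[OF xy(1) lx(1) xy(2) lx(2)] s'(4) by auto
          show ?thesis
            unfolding shift_eq_iff[OF B(1) l'(1) B(2) l'(2)]
          proof (intro conjI allI)
            have "vx E x' m' = vx E x m'" "vx E z n' = vx E y n'"
              using x' z ex ey d n by (auto intro!: vx_cong simp: nb_def)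
            then show "vx E x' m' = vx E z n'" using 0 by simp
            fix i
            \<comment> \<open>The first \<open>d\<close> edges after the earlier cut are copied from
              \<open>x\<close> and \<open>y\<close>, where they agree; from then on the tails after
              the later cut coincide.\<close>
            show "ed x' (m' + i) = ed z (n' + i)"
            proof (cases "i < d")
              case True
              then show ?thesis using ex ey d n 0 by simp
            next
              case False
              then obtain c where "i = d + c" using le_Suc_ex[of d i] by auto
              then show ?thesis using e d n unfolding shift_eq_iff[OF B(1) l(1) B(2) l(2)]
                by (simp add: add.assoc[symmetric])
            qed
          qed
        qed
      qed
      then have "\<forall>x'\<in>nb E x (m + j) F. \<forall>z\<in>nb E y (n + j) F. shift E m x' = shift E n z \<longrightarrow> (x', k, z) \<in> s"
        using jF UV(5) s'(3) by blast
      then show "\<exists>j F. finite F \<and> (\<forall>x'\<in>nb E x (m + j) F. \<forall>z\<in>nb E y (n + j) F.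
         shift E m x' = shift E n z \<longrightarrow> (x', k, z) \<in> s)" using jF(1) by blast
    qed
  qed simp
  then obtain j F where jF: "finite F" "\<forall>x'\<in>nb E x (m + j) F. \<forall>z\<in>nb E y (n + j) F.
      shift E m x' = shift E n z \<longrightarrow> (x', k, z) \<in> W'" using g W'(2) by blast
  show ?thesis
  proof (rule that[OF jF(1)])
    fix x' z assume a: "x' \<in> nb E x (m + j) F" "z \<in> nb E y (n + j) F" "shift E m x' = shift E n z"
    have "(x', k, z) \<in> graph_groupoid E"
      by (rule groupoidI[OF _ _ nb_len[OF a(1) mn(2)] nb_len[OF a(2) mn(3)] a(3) mn(1)])
         (use a nb_subset in blast)+
    then show "(x', k, z) \<in> W" using a jF(2) W'(2) by blast
  qed
qed

section \<open>The full group as the homeomorphisms with a germ at every point\<close>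

definition FG :: "(('v, 'e) bpath \<Rightarrow> ('v, 'e) bpath) set" where
  "FG = {\<pi> \<in> extensional Bd. homeomorphic_map Tp Tp \<pi> \<and> (\<forall>y\<in>Bd. \<exists>k. germ \<pi> y k) \<and>
     compactin Tp (Tp closure_of {x \<in> Bd. \<pi> x \<noteq> x})}"

text \<open>Well defined on \<open>FG\<close> by \<open>germ_unique\<close>.\<close>

definition lag :: "(('v, 'e) bpath \<Rightarrow> ('v, 'e) bpath) \<Rightarrow> ('v, 'e) bpath \<Rightarrow> int" where
  "lag \<pi> y = (THE k. germ \<pi> y k)"

definition arrow :: "(('v, 'e) bpath \<Rightarrow> ('v, 'e) bpath) \<Rightarrow> ('v, 'e) bpath \<Rightarrow> ('v, 'e) garrow" where
  "arrow \<pi> y = (\<pi> y, lag \<pi> y, y)"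

lemma fg_cont: "\<pi> \<in> FG \<Longrightarrow> continuous_map Tp Tp \<pi>"
  by (auto simp: FG_def homeomorphic_imp_continuous_map)

lemma fg_in: "\<pi> \<in> FG \<Longrightarrow> z \<in> Bd \<Longrightarrow> \<pi> z \<in> Bd"
  using fg_cont cont_in by blast

lemma fg_inj: "\<pi> \<in> FG \<Longrightarrow> inj_on \<pi> Bd" and fg_surj: "\<pi> \<in> FG \<Longrightarrow> \<pi> ` Bd = Bd"
  by (auto simp: FG_def homeomorphic_eq_everything_map)

lemma lag_eq: "\<pi> \<in> FG \<Longrightarrow> germ \<pi> y k \<Longrightarrow> lag \<pi> y = k"
  unfolding lag_def using germ_unique[of \<pi>] fg_in by blast

lemma germ_lag: "\<pi> \<in> FG \<Longrightarrow> y \<in> Bd \<Longrightarrow> germ \<pi> y (lag \<pi> y)"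
  using lag_eq unfolding FG_def by blast

lemma arrow_in: "\<pi> \<in> FG \<Longrightarrow> y \<in> Bd \<Longrightarrow> arrow \<pi> y \<in> graph_groupoid E"
  unfolding arrow_def using germ_groupoid[OF germ_lag] fg_in by blast

text \<open>In a small basic set around an arrow of \<open>\<pi>\<close>, the range of an arrow with
  source \<open>z\<close> shares its first \<open>m\<close> edges and the tail after them with
  \<open>\<pi> z\<close>, so the basic set consists of arrows of \<open>\<pi>\<close>.\<close>

lemma arrow_open:
  assumes p: "\<pi> \<in> FG" and V: "openin Tp V"
  shows "openin (groupoid_top E) (arrow \<pi> ` V)"
proof (subst openin_subopen, intro ballI)
  fix g assume "g \<in> arrow \<pi> ` V"
  then obtain y where y: "y \<in> V" "g = arrow \<pi> y" by blast
  have yB: "y \<in> Bd" "\<pi> y \<in> Bd" using V y open_sub fg_in[OF p] by blast+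
  obtain m n U where U: "openin Tp U" "y \<in> U" "lag \<pi> y = int m - int n"
     "\<And>z. z \<in> U \<Longrightarrow> enat m \<le> path_len (\<pi> z)" "\<And>z. z \<in> U \<Longrightarrow> enat n \<le> path_len z" 
     "\<And>z. z \<in> U \<Longrightarrow> shift E m (\<pi> z) = shift E n z" by (rule germE[OF germ_lag[OF p yB(1)]]) (rule that)
  let ?N = "nb E (\<pi> y) (m + 0) {}"
  have N: "openin Tp ?N" "\<pi> y \<in> ?N" using nb_open[OF yB(2)] nb_self[OF yB(2)] by auto
  let ?V = "V \<inter> U \<inter> {z \<in> Bd. \<pi> z \<in> ?N}"
  have V': "openin Tp ?V" "y \<in> ?V" using V U(1,2) cont_pre[OF fg_cont[OF p] N(1)] y(1) N(2) yB by auto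
  obtain j F where jF: "finite F" "nb E y (n + j) F \<subseteq> ?V" using open_nb_ge[OF V'] .
  let ?B = "{(x', int m - int n, z) | x' z. x' \<in> nb E (\<pi> y) (m + j) F \<and> z \<in> nb E y (n + j) F \<and> shift E m x' = shift E n z}"
  have "openin (groupoid_top E) ?B"
    using groupoid_basis_open[OF groupoid_basisI[OF yB(2,1) U(4)[OF U(2)] U(5)[OF U(2)] U(6)[OF U(2)] jF(1)]] .
  moreover have "g \<in> ?B" using y(2) U(2,3,6) nb_self yB by (auto simp: arrow_def)
  moreover have "?B \<subseteq> arrow \<pi> ` V"
  proof
    fix h assume "h \<in> ?B"
    then obtain x' z where h: "h = (x', int m - int n, z)" "x' \<in> nb E (\<pi> y) (m + j) F" "z \<in> nb E y (n + j) F"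
      "shift E m x' = shift E n z" by blast
    have z: "z \<in> V" "z \<in> U" "\<pi> z \<in> ?N" using h(3) jF(2) by auto
    have zB: "z \<in> Bd" using z V open_sub by blast
    have l: "enat m \<le> path_len (\<pi> y)" using U by blast
    have "\<pi> z = x'"
    proof (rule shift_inj[of _ m])
      show "\<pi> z \<in> Bd" "x' \<in> Bd" using z(3) h(2) nb_subset by blast+
      show "enat m \<le> path_len (\<pi> z)" "enat m \<le> path_len x'" using U(4)[OF z(2)] nb_len[OF h(2) l] by auto
      show "shift E m (\<pi> z) = shift E m x'" using U(6)[OF z(2)] h(4) by simp
      show "st E (\<pi> z) = st E x'" using z(3) h(2) by (simp add: nb_def)
      show "ed (\<pi> z) i = ed x' i" if "i < m" for i using nb_ed[OF z(3) l that] nb_ed[OF h(2) l that] by simp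
    qed
    moreover have "germ \<pi> z (int m - int n)" by (rule germI[OF U(1) z(2) refl]) (use U in auto)
    ultimately have "h = arrow \<pi> z" using h(1) lag_eq[OF p] by (simp add: arrow_def)
    then show "h \<in> arrow \<pi> ` V" using z(1) by blast
  qed
  ultimately show "\<exists>W. openin (groupoid_top E) W \<and> g \<in> W \<and> W \<subseteq> arrow \<pi> ` V" by blast
qed

lemma arrow_cont:
  assumes p: "\<pi> \<in> FG" and W: "openin (groupoid_top E) W" and y: "y \<in> Bd" "arrow \<pi> y \<in> W"
  obtains V where "openin Tp V" "y \<in> V" "arrow \<pi> ` V \<subseteq> W"
proof -
  have yB: "\<pi> y \<in> Bd" using y fg_in[OF p] by blast
  obtain m n U where U: "openin Tp U" "y \<in> U" "lag \<pi> y = int m - int n"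
     "\<And>z. z \<in> U \<Longrightarrow> enat m \<le> path_len (\<pi> z)" "\<And>z. z \<in> U \<Longrightarrow> enat n \<le> path_len z" 
     "\<And>z. z \<in> U \<Longrightarrow> shift E m (\<pi> z) = shift E n z" by (rule germE[OF germ_lag[OF p y(1)]]) (rule that)
  obtain j F where jF: "finite F" "\<And>x' z. x' \<in> nb E (\<pi> y) (m + j) F \<Longrightarrow> z \<in> nb E y (n + j) F \<Longrightarrow> 
      shift E m x' = shift E n z \<Longrightarrow> (x', lag \<pi> y, z) \<in> W"
    by (rule groupoid_open_nbhd[OF W y(2)[unfolded arrow_def] U(3) U(4)[OF U(2)] U(5)[OF U(2)] U(6)[OF U(2)]]) (rule that)
  let ?N = "nb E (\<pi> y) (m + j) F"
  have N: "openin Tp ?N" "\<pi> y \<in> ?N" using nb_open[OF yB jF(1)] nb_self[OF yB] by auto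
  let ?V = "U \<inter> nb E y (n + j) F \<inter> {z \<in> Bd. \<pi> z \<in> ?N}"
  have "openin Tp ?V" using U(1) nb_open[OF y(1) jF(1)] cont_pre[OF fg_cont[OF p] N(1)] by blast
  moreover have "y \<in> ?V" using U(2) nb_self[OF y(1)] y N(2) by blast
  moreover have "arrow \<pi> z \<in> W" if z: "z \<in> ?V" for z
  proof -
    have "germ \<pi> z (int m - int n)" by (rule germI[OF U(1) _ refl]) (use U z in auto)
    then have "lag \<pi> z = lag \<pi> y" using lag_eq[OF p] U(3) by simp
    moreover have "(\<pi> z, lag \<pi> y, z) \<in> W" by (rule jF(2)) (use z U(6) in auto)
    ultimately show ?thesis by (simp add: arrow_def)
  qed
  ultimately show ?thesis using that by blast
qed

text \<open>As \<open>U\<close> is open, it contains a basic set around the given arrow, and as the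
  source map is injective on \<open>U\<close>, the value \<open>\<pi> z\<close> must be the range
  found there. Near \<open>y\<close> the map is therefore \<open>shift E n\<close> followed by a
  local inverse of \<open>shift E m\<close>.\<close>

lemma bisection_local:
  assumes U: "full_open_bisection E U" and p: "\<And>x. x \<in> Bd \<Longrightarrow> \<exists>k. (\<pi> x, k, x) \<in> U"
    and y: "(\<pi> y, k, y) \<in> U" "openin Tp A" "\<pi> y \<in> A" "openin Tp W" "y \<in> W"
    and mn: "enat m \<le> path_len (\<pi> y)" "enat n \<le> path_len y" "shift E m (\<pi> y) = shift E n y" "k = int m - int n"
  obtains P Q where "openin Tp P" "\<pi> y \<in> P" "P \<subseteq> A" "openin Tp Q" "y \<in> Q" "Q \<subseteq> W" "\<pi> ` Q = P"
    "\<And>z. z \<in> Q \<Longrightarrow> enat m \<le> path_len (\<pi> z) \<and> enat n \<le> path_len z \<and> shift E m (\<pi> z) = shift E n z"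
proof -
  have Uo: "openin (groupoid_top E) U" "inj_on g_src U" using U by (auto simp: full_open_bisection_def)
  have "(\<pi> y, k, y) \<in> graph_groupoid E" using Uo(1) y(1) openin_subset by fastforce
  then have yB: "\<pi> y \<in> Bd" "y \<in> Bd" by (auto simp: groupoid_iff)
  obtain j F where jF: "finite F" "\<And>x' z. x' \<in> nb E (\<pi> y) (m + j) F \<Longrightarrow> z \<in> nb E y (n + j) F \<Longrightarrow> 
      shift E m x' = shift E n z \<Longrightarrow> (x', k, z) \<in> U"
    by (rule groupoid_open_nbhd[OF Uo(1) y(1) mn(4,1,2,3)]) (rule that)
  obtain j' F' where jF': "finite F'" "nb E (\<pi> y) (m + j') F' \<subseteq> A" "nb E y (n + j') F' \<subseteq> W"
    using open_nb2[OF y(2-5)] .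
  let ?P = "nb E (\<pi> y) (m + (j + j')) (F \<union> F')" and ?Q = "nb E y (n + (j + j')) (F \<union> F')"
  have s: "nb E w (l + (j + j')) (F \<union> F') \<subseteq> nb E w (l + j) F" "nb E w (l + (j + j')) (F \<union> F') \<subseteq> nb E w (l + j') F'"
    for w l by (rule nb_mono, simp, simp)+
  have fF: "finite (F \<union> F')" using jF(1) jF'(1) by simp
  have img: "shift E m ` ?P = shift E n ` ?Q"
    using shift_bij_nb[OF yB(1) mn(1), of "j + j'" "F \<union> F'"] shift_bij_nb[OF yB(2) mn(2), of "j + j'" "F \<union> F'"] mn(3)
    by (simp add: bij_betw_def)
  have val: "\<pi> z = x'" if "x' \<in> ?P" "z \<in> ?Q" "shift E m x' = shift E n z" for x' z
  proof -
    have "(x', k, z) \<in> U" using jF(2) that s by blast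
    moreover have "z \<in> Bd" using that(2) nb_subset by blast
    then obtain k' where "(\<pi> z, k', z) \<in> U" using p by blast
    moreover have "g_src (\<pi> z, k', z) = g_src (x', k, z)" by (simp add: g_src_def)
    ultimately have "(\<pi> z, k', z) = (x', k, z)" using inj_onD[OF Uo(2)] by metis
    then show ?thesis by simp
  qed
  have Q: "\<pi> z \<in> ?P \<and> shift E m (\<pi> z) = shift E n z" if z: "z \<in> ?Q" for z
  proof -
    obtain x' where "x' \<in> ?P" "shift E m x' = shift E n z" using img z by (metis imageE imageI)
    then show ?thesis using val z by blast
  qed
  show ?thesis
  proof (rule that[of ?P ?Q])
    show "openin Tp ?P" "openin Tp ?Q" using nb_open yB fF by auto
    show "\<pi> y \<in> ?P" "y \<in> ?Q" using nb_self yB by auto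
    show "?P \<subseteq> A" "?Q \<subseteq> W" using s jF' by blast+
    show "\<pi> ` ?Q = ?P"
    proof
      show "?P \<subseteq> \<pi> ` ?Q"
      proof
        fix x' assume x': "x' \<in> ?P"
        then obtain z where "z \<in> ?Q" "shift E n z = shift E m x'" using img by (metis imageE imageI)
        then show "x' \<in> \<pi> ` ?Q" using val[OF x'] by (metis imageI)
      qed
    qed (use Q in blast)
    fix z assume z: "z \<in> ?Q"
    show "enat m \<le> path_len (\<pi> z) \<and> enat n \<le> path_len z \<and> shift E m (\<pi> z) = shift E n z"
      using Q[OF z] nb_len[OF _ mn(1)] nb_len[OF z mn(2)] by blast
  qed
qed

text \<open>This replaces bisections by homeomorphisms: continuity, openness and germs are read off
  \<open>bisection_local\<close>, and conversely the arrows of a homeomorphism with germs form a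
  full open bisection.\<close>

lemma full_group_carrier_eq: "full_group_carrier E = FG"
proof (intro equalityI subsetI)
  fix \<pi> assume "\<pi> \<in> full_group_carrier E"
  then obtain U where e: "\<pi> \<in> extensional Bd" and U: "full_open_bisection E U"
    and p: "\<And>x. x \<in> Bd \<Longrightarrow> \<exists>k. (\<pi> x, k, x) \<in> U"
    and c: "compactin Tp (Tp closure_of {x \<in> Bd. \<pi> x \<noteq> x})"
    unfolding full_group_carrier_def by blast
  have Uo: "inj_on g_src U" "inj_on g_rng U" "g_rng ` U = Bd" "U \<subseteq> graph_groupoid E" 
    using U openin_subset unfolding full_open_bisection_def by fastforce+
  have loc: "\<exists>m n P Q. openin Tp P \<and> \<pi> y \<in> P \<and> P \<subseteq> A \<and> openin Tp Q \<and> y \<in> Q \<and> Q \<subseteq> W \<and> \<pi> ` Q = P \<and>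
    (\<forall>z\<in>Q. enat m \<le> path_len (\<pi> z) \<and> enat n \<le> path_len z \<and> shift E m (\<pi> z) = shift E n z)"
    if A: "openin Tp A" "\<pi> y \<in> A" and W: "openin Tp W" "y \<in> W" for y A W
  proof -
    have "y \<in> Bd" using W open_sub by blast
    then obtain k where k: "(\<pi> y, k, y) \<in> U" using p by blast
    then obtain m n where mn: "enat m \<le> path_len (\<pi> y)" "enat n \<le> path_len y" "shift E m (\<pi> y) = shift E n y" "k = int m - int n"
      using Uo(4) groupoid_iff by blast
    show ?thesis by (rule bisection_local[OF U p k A W mn]) blast+
  qed
  have inB: "\<pi> y \<in> Bd" if "y \<in> Bd" for y
    using p[OF that] Uo(4) groupoid_iff by blast
  have cont: "continuous_map Tp Tp \<pi>"
    unfolding continuous_map_def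
  proof (intro conjI allI impI)
    show "\<pi> \<in> topspace Tp \<rightarrow> topspace Tp" using inB by auto
    fix A assume A: "openin Tp A"
    show "openin Tp {x \<in> topspace Tp. \<pi> x \<in> A}"
    proof (subst openin_subopen, intro ballI)
      fix x assume x: "x \<in> {x \<in> topspace Tp. \<pi> x \<in> A}"
      then have "\<pi> x \<in> A" "x \<in> topspace Tp" by auto
      then obtain P Q where "openin Tp Q" "x \<in> Q" "Q \<subseteq> topspace Tp" "\<pi> ` Q = P" "P \<subseteq> A"
        using loc[OF A _ openin_topspace, of x] by blast
      then show "\<exists>V. openin Tp V \<and> x \<in> V \<and> V \<subseteq> {x \<in> topspace Tp. \<pi> x \<in> A}" by blast
    qed
  qed
  have op: "open_map Tp Tp \<pi>"
    unfolding open_map_def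
  proof (intro allI impI)
    fix W assume W: "openin Tp W"
    show "openin Tp (\<pi> ` W)"
    proof (subst openin_subopen, intro ballI)
      fix x assume "x \<in> \<pi> ` W"
      then obtain y where y: "y \<in> W" "x = \<pi> y" by blast
      have "\<pi> y \<in> topspace Tp" using inB y(1) W open_sub by auto
      then obtain P Q where "openin Tp P" "x \<in> P" "\<pi> ` Q = P" "Q \<subseteq> W"
        using loc[OF openin_topspace _ W y(1)] y(2) by blast
      then show "\<exists>V. openin Tp V \<and> x \<in> V \<and> V \<subseteq> \<pi> ` W" by blast
    qed
  qed
  have inj: "inj_on \<pi> Bd"
  proof (rule inj_onI)
    fix x y assume xy: "x \<in> Bd" "y \<in> Bd" "\<pi> x = \<pi> y"
    obtain k l where "(\<pi> x, k, x) \<in> U" "(\<pi> y, l, y) \<in> U" using p xy by blast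
    moreover have "g_rng (\<pi> x, k, x) = g_rng (\<pi> y, l, y)" using xy(3) by (simp add: g_rng_def)
    ultimately have "(\<pi> x, k, x) = (\<pi> y, l, y)" using inj_onD[OF Uo(2)] by metis
    then show "x = y" by simp
  qed
  have surj: "\<pi> ` Bd = Bd"
  proof
    show "Bd \<subseteq> \<pi> ` Bd"
    proof
      fix x assume "x \<in> Bd"
      then obtain k y where g: "(x, k, y) \<in> U" using Uo(3) unfolding g_rng_def by (metis imageE prod.collapse)
      then have y: "y \<in> Bd" using Uo(4) groupoid_iff by blast
      then obtain l where "(\<pi> y, l, y) \<in> U" using p by blast
      moreover have "g_src (\<pi> y, l, y) = g_src (x, k, y)" by (simp add: g_src_def)
      ultimately have "(\<pi> y, l, y) = (x, k, y)" using inj_onD[OF Uo(1)] g by metis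
      then show "x \<in> \<pi> ` Bd" using y by blast
    qed
  qed (use inB in blast)
  have "homeomorphic_map Tp Tp \<pi>"
    by (rule bijective_open_imp_homeomorphic_map[OF cont op]) (use inj surj in auto)
  moreover have "\<exists>k. germ \<pi> y k" if y: "y \<in> Bd" for y
  proof -
    have "\<pi> y \<in> topspace Tp" "y \<in> topspace Tp" using inB y by auto
    then obtain m n Q where "openin Tp Q" "y \<in> Q" 
      "\<forall>z\<in>Q. enat m \<le> path_len (\<pi> z) \<and> enat n \<le> path_len z \<and> shift E m (\<pi> z) = shift E n z"
      using loc[OF openin_topspace _ openin_topspace, of y] by blast
    then show ?thesis using germI[of Q y _ m n \<pi>] by blast
  qed
  ultimately show "\<pi> \<in> FG" using e c unfolding FG_def by blast
next
  fix \<pi> assume p: "\<pi> \<in> FG"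
  have "full_open_bisection E (arrow \<pi> ` Bd)"
    unfolding full_open_bisection_def
  proof (intro conjI)
    show "openin (groupoid_top E) (arrow \<pi> ` Bd)" 
      using arrow_open[OF p openin_topspace] by simp
    show "inj_on g_src (arrow \<pi> ` Bd)" by (auto simp: inj_on_def g_src_def arrow_def)
    show "inj_on g_rng (arrow \<pi> ` Bd)" using fg_inj[OF p] by (auto simp: inj_on_def g_rng_def arrow_def)
    show "g_src ` (arrow \<pi> ` Bd) = Bd" by (auto simp: image_image g_src_def arrow_def)
    show "g_rng ` (arrow \<pi> ` Bd) = Bd" using fg_surj[OF p] by (simp add: image_image g_rng_def arrow_def)
  qed
  moreover have "\<forall>x\<in>Bd. \<exists>k. (\<pi> x, k, x) \<in> arrow \<pi> ` Bd" by (auto simp: arrow_def)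
  ultimately show "\<pi> \<in> full_group_carrier E" using p unfolding full_group_carrier_def FG_def by blast
qed

lemma fg_compose:
  assumes p: "\<pi> \<in> FG" and r: "\<rho> \<in> FG"
  shows "compose Bd \<pi> \<rho> \<in> FG"
  unfolding FG_def
proof (intro CollectI conjI ballI)
  show "compose Bd \<pi> \<rho> \<in> extensional Bd" by simp
  have "homeomorphic_map Tp Tp (\<pi> \<circ> \<rho>)"
    using p r by (intro homeomorphic_map_compose) (auto simp: FG_def)
  then show "homeomorphic_map Tp Tp (compose Bd \<pi> \<rho>)"
    by (rule homeomorphic_map_eq) (simp add: compose_def)
  show "\<exists>k. germ (compose Bd \<pi> \<rho>) y k" if y: "y \<in> Bd" for y
  proof -
    have "germ (\<lambda>z. \<pi> (\<rho> z)) y (lag \<pi> (\<rho> y) + lag \<rho> y)"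
      using germ_comp[OF fg_cont[OF p] fg_cont[OF r] germ_lag[OF p fg_in[OF r y]] germ_lag[OF r y]] .
    then have "germ (compose Bd \<pi> \<rho>) y (lag \<pi> (\<rho> y) + lag \<rho> y)"
      by (rule germ_cong[OF openin_topspace, rotated -1]) (use y in \<open>auto simp: compose_def\<close>)
    then show ?thesis by blast
  qed
  let ?M = "\<lambda>\<pi>. {x \<in> Bd. \<pi> x \<noteq> x}"
  have "?M (compose Bd \<pi> \<rho>) \<subseteq> ?M \<pi> \<union> ?M \<rho>" by (auto simp: compose_def)
  then have "Tp closure_of ?M (compose Bd \<pi> \<rho>) \<subseteq> Tp closure_of (?M \<pi> \<union> ?M \<rho>)"
    by (rule closure_of_mono)
  then have "Tp closure_of ?M (compose Bd \<pi> \<rho>) \<subseteq> Tp closure_of ?M \<pi> \<union> Tp closure_of ?M \<rho>"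
    by (simp only: closure_of_Un)
  moreover have "compactin Tp (Tp closure_of ?M \<pi> \<union> Tp closure_of ?M \<rho>)"
    using p r by (intro compactin_Un) (auto simp: FG_def)
  ultimately show "compactin Tp (Tp closure_of ?M (compose Bd \<pi> \<rho>))"
    using closed_compactin closedin_closure_of by blast
qed

lemma lag_compose:
  assumes p: "\<pi> \<in> FG" and r: "\<rho> \<in> FG" and y: "y \<in> Bd"
  shows "lag (compose Bd \<pi> \<rho>) y = lag \<pi> (\<rho> y) + lag \<rho> y"
proof -
  have "germ (\<lambda>z. \<pi> (\<rho> z)) y (lag \<pi> (\<rho> y) + lag \<rho> y)"
    using germ_comp[OF fg_cont[OF p] fg_cont[OF r] germ_lag[OF p fg_in[OF r y]] germ_lag[OF r y]] .
  then have "germ (compose Bd \<pi> \<rho>) y (lag \<pi> (\<rho> y) + lag \<rho> y)"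
    by (rule germ_cong[OF openin_topspace, rotated -1]) (use y in \<open>auto simp: compose_def\<close>)
  then show ?thesis using lag_eq[OF fg_compose[OF p r]] by blast
qed

lemma fg_id: "restrict id Bd \<in> FG"
  unfolding FG_def
proof (intro CollectI conjI ballI)
  show "homeomorphic_map Tp Tp (restrict id Bd)"
    by (rule homeomorphic_map_eq[OF homeomorphic_map_id[THEN iffD2, OF refl]]) simp
  show "\<exists>k. germ (restrict id Bd) y k" if "y \<in> Bd" for y
    using germ_id[OF openin_topspace, of y "restrict id Bd"] that by auto
  have "{x \<in> Bd. restrict id Bd x \<noteq> x} = {}" by auto
  then show "compactin Tp (Tp closure_of {x \<in> Bd. restrict id Bd x \<noteq> x})" by simp
qed simp

lemma fg_inverse:
  assumes p: "\<pi> \<in> FG"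
  obtains \<rho> where "\<rho> \<in> FG" "\<And>z. z \<in> Bd \<Longrightarrow> \<rho> (\<pi> z) = z" "\<And>z. z \<in> Bd \<Longrightarrow> \<pi> (\<rho> z) = z"
proof -
  have h: "homeomorphic_map Tp Tp \<pi>" using p by (simp add: FG_def)
  then obtain g where g: "homeomorphic_maps Tp Tp \<pi> g" using homeomorphic_map_maps by blast
  let ?r = "restrict g Bd"
  have gp: "g (\<pi> z) = z" "\<pi> (g z) = z" "g z \<in> Bd" if "z \<in> Bd" for z
    using g that by (auto simp: homeomorphic_maps_def continuous_map_def)
  have rp: "?r (\<pi> z) = z" "\<pi> (?r z) = z" if "z \<in> Bd" for z
    using gp[OF that] that fg_in[OF p that] by auto
  have "?r \<in> FG"
    unfolding FG_def
  proof (intro CollectI conjI ballI)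
    have "homeomorphic_map Tp Tp g" using g homeomorphic_maps_map by blast
    then show "homeomorphic_map Tp Tp ?r" by (rule homeomorphic_map_eq) simp
    show "\<exists>k. germ ?r y k" if y: "y \<in> Bd" for y
    proof -
      have "germ ?r (\<pi> (?r y)) (- lag \<pi> (?r y))"
        by (rule germ_inv[OF h rp(1) germ_lag[OF p]]) (use gp(3) y in auto)
      then show ?thesis using rp(2)[OF y] by auto
    qed
    have "{x \<in> Bd. ?r x \<noteq> x} = {x \<in> Bd. \<pi> x \<noteq> x}" using rp by (metis (no_types, lifting))
    then show "compactin Tp (Tp closure_of {x \<in> Bd. ?r x \<noteq> x})" using p by (simp add: FG_def)
  qed simp
  then show ?thesis using that rp by blast
qed

lemma fg_eqI: "\<pi> \<in> FG \<Longrightarrow> \<rho> \<in> FG \<Longrightarrow> (\<And>z. z \<in> Bd \<Longrightarrow> \<pi> z = \<rho> z) \<Longrightarrow> \<pi> = \<rho>"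
  by (rule extensionalityI[of _ Bd]) (auto simp: FG_def)

abbreviation "FullG \<equiv> full_group E"

lemma full_group_simps [simp]: 
  "carrier FullG = FG" "mult FullG = compose Bd" "\<one>\<^bsub>FullG\<^esub> = restrict id Bd"
  by (auto simp: full_group_def full_group_carrier_eq fun_eq_iff)

lemma group_full: "group FullG"
proof (rule groupI)
  show "x \<otimes>\<^bsub>FullG\<^esub> y \<in> carrier FullG" if "x \<in> carrier FullG" "y \<in> carrier FullG" for x y
    using that fg_compose by simp
  show "\<one>\<^bsub>FullG\<^esub> \<in> carrier FullG" using fg_id by simp
  show "x \<otimes>\<^bsub>FullG\<^esub> y \<otimes>\<^bsub>FullG\<^esub> z = x \<otimes>\<^bsub>FullG\<^esub> (y \<otimes>\<^bsub>FullG\<^esub> z)"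
    if "x \<in> carrier FullG" "y \<in> carrier FullG" "z \<in> carrier FullG" for x y z
    using that fg_in by (auto simp: compose_def)
  show "\<one>\<^bsub>FullG\<^esub> \<otimes>\<^bsub>FullG\<^esub> x = x" if "x \<in> carrier FullG" for x
  proof (rule fg_eqI)
    show "\<one>\<^bsub>FullG\<^esub> \<otimes>\<^bsub>FullG\<^esub> x \<in> FG" "x \<in> FG" using that fg_compose fg_id by auto
    then show "(\<one>\<^bsub>FullG\<^esub> \<otimes>\<^bsub>FullG\<^esub> x) z = x z" if "z \<in> Bd" for z using that fg_in by (simp add: compose_def)
  qed
  show "\<exists>y\<in>carrier FullG. y \<otimes>\<^bsub>FullG\<^esub> x = \<one>\<^bsub>FullG\<^esub>" if x: "x \<in> carrier FullG" for x
  proof -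
    obtain y where y: "y \<in> FG" "\<And>z. z \<in> Bd \<Longrightarrow> y (x z) = z" using fg_inverse x by (metis full_group_simps(1))
    have "y \<otimes>\<^bsub>FullG\<^esub> x = \<one>\<^bsub>FullG\<^esub>"
      by (rule fg_eqI) (use x y fg_compose fg_id in \<open>auto simp: compose_def\<close>)
    then show ?thesis using y(1) by auto
  qed
qed

section \<open>Transpositions, 3-cycles and local movers\<close>

lemma inv_involution:
  assumes t: "\<tau> \<in> FG" and i: "\<And>z. z \<in> Bd \<Longrightarrow> \<tau> (\<tau> z) = z"
  shows "inv\<^bsub>FullG\<^esub> \<tau> = \<tau>"
proof -
  have "\<tau> \<otimes>\<^bsub>FullG\<^esub> \<tau> = \<one>\<^bsub>FullG\<^esub>"
    by (rule fg_eqI) (use t i fg_compose fg_id in \<open>auto simp: compose_def\<close>)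
  then show ?thesis using group.inv_equality[OF group_full] t by simp
qed

text \<open>Two disjoint compact open sets around \<open>x\<close> and \<open>y\<close> have the
  same image under \<open>shift E m\<close> and \<open>shift E n\<close>. Exchanging points with
  equal image is an involution whose germ at \<open>y\<close> is the given arrow.\<close>

lemma transposition:
  assumes g: "(x, k, y) \<in> graph_groupoid E" and ne: "x \<noteq> y" and A: "openin Tp A" "x \<in> A" and B: "openin Tp B" "y \<in> B"
  obtains \<tau> P Q where "\<tau> \<in> FG" "x \<in> P" "P \<subseteq> A" "y \<in> Q" "Q \<subseteq> B" "closedin Tp P" "closedin Tp Q"
    "\<And>z. z \<in> Bd \<Longrightarrow> \<tau> (\<tau> z) = z" "\<And>z. z \<in> Bd \<Longrightarrow> z \<notin> P \<Longrightarrow> z \<notin> Q \<Longrightarrow> \<tau> z = z" "\<tau> y = x" "germ \<tau> y k"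
proof -
  obtain m n where mn: "x \<in> Bd" "y \<in> Bd" "enat m \<le> path_len x" "enat n \<le> path_len y"
    "shift E m x = shift E n y" "k = int m - int n" by (rule groupoidE[OF g]) (rule that)
  obtain A0 B0 where AB0: "openin Tp A0" "openin Tp B0" "x \<in> A0" "y \<in> B0" "disjnt A0 B0"
    using hausdorff_T mn(1,2) ne unfolding Hausdorff_space_def topspace_T by metis
  obtain j F where jF: "finite F" "nb E x (m + j) F \<subseteq> A \<inter> A0" "nb E y (n + j) F \<subseteq> B \<inter> B0"
  proof -
    have "openin Tp (A \<inter> A0)" "x \<in> A \<inter> A0" "openin Tp (B \<inter> B0)" "y \<in> B \<inter> B0" using A B AB0 by auto
    from open_nb2[OF this] show ?thesis using that .
  qed
  define P Q where PQ: "P = nb E x (m + j) F" "Q = nb E y (n + j) F"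
  have PB: "P \<subseteq> Bd" "Q \<subseteq> Bd" using nb_subset PQ by auto
  have disj: "P \<inter> Q = {}" using jF AB0 PQ by (auto simp: disjnt_iff)
  have op: "openin Tp P" "openin Tp Q" "closedin Tp P" "closedin Tp Q" "compactin Tp P" "compactin Tp Q"
    using PQ nb_open nb_closed nb_compact mn jF(1) by auto
  have inj: "inj_on (shift E m) P" "inj_on (shift E n) Q" and im: "shift E m ` P = shift E n ` Q"
    using shift_bij_nb[OF mn(1,3), of j F] shift_bij_nb[OF mn(2,4), of j F] mn(5) PQ by (auto simp: bij_betw_def)
  have len: "enat m \<le> path_len w" if "w \<in> P" for w using that nb_len[OF _ mn(3)] PQ by blast
  have len': "enat n \<le> path_len w" if "w \<in> Q" for w using that nb_len[OF _ mn(4)] PQ by blast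
  \<comment> \<open>The value \<open>undefined\<close> outside the boundary makes
    \<open>\<tau>\<close> extensional.\<close>
  define \<tau> where "\<tau> z = (if z \<in> Q then inv_into P (shift E m) (shift E n z)
     else if z \<in> P then inv_into Q (shift E n) (shift E m z) else if z \<in> Bd then z else undefined)" for z
  have \<tau>Q: "\<tau> z = w" if "z \<in> Q" "w \<in> P" "shift E m w = shift E n z" for z w
    using that inj by (simp add: \<tau>_def inv_into_f_eq)
  have \<tau>P: "\<tau> w = z" if "z \<in> Q" "w \<in> P" "shift E m w = shift E n z" for z w
    using that inj disj by (auto simp: \<tau>_def inv_into_f_eq)
  have fix0: "\<tau> z = z" if "z \<in> Bd" "z \<notin> P" "z \<notin> Q" for z using that by (simp add: \<tau>_def)
  have exP: "\<exists>w\<in>P. shift E m w = shift E n z" if "z \<in> Q" for z using im that by (metis imageE imageI)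
  have exQ: "\<exists>z\<in>Q. shift E m w = shift E n z" if "w \<in> P" for w using im that by (metis imageE imageI)
  have invol: "\<tau> (\<tau> z) = z" if "z \<in> Bd" for z
  proof (cases "z \<in> P \<or> z \<in> Q")
    case True
    then show ?thesis using \<tau>P \<tau>Q exP exQ by metis
  next
    case False
    then show ?thesis using fix0 that by simp
  qed
  have inB: "\<tau> z \<in> Bd" if "z \<in> Bd" for z
  proof -
    consider "z \<in> P" | "z \<in> Q" | "z \<notin> P" "z \<notin> Q" by blast
    then show ?thesis
    proof cases
      case 1 
      then obtain u where "u \<in> Q" "shift E m z = shift E n u" using exQ by blast
      then show ?thesis using \<tau>P 1 PB by blast
    next
      case 2
      then obtain u where "u \<in> P" "shift E m u = shift E n z" using exP by blast
      then show ?thesis using \<tau>Q 2 PB by blast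
    qed (use fix0 that in simp)
  qed
  have xy: "x \<in> P" "y \<in> Q" using PQ nb_self mn by auto
  have cont: "continuous_map Tp Tp \<tau>"
    unfolding continuous_map_def
  proof (intro conjI allI impI)
    show "\<tau> \<in> topspace Tp \<rightarrow> topspace Tp" using inB by auto
    fix C assume C: "openin Tp C"
    show "openin Tp {z \<in> topspace Tp. \<tau> z \<in> C}"
    proof (subst openin_subopen, intro ballI)
      fix z assume "z \<in> {z \<in> topspace Tp. \<tau> z \<in> C}"
      then have z: "z \<in> Bd" "\<tau> z \<in> C" by auto
      consider "z \<in> Q" | "z \<in> P" | "z \<notin> P" "z \<notin> Q" by blast
      then have "\<exists>V. openin Tp V \<and> z \<in> V \<and> (\<forall>z'\<in>V. \<tau> z' \<in> C)"
      proof cases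
        case 1
        then obtain w where w: "w \<in> P" "shift E m w = shift E n z" using exP by blast
        have wC: "w \<in> C \<inter> P" using z \<tau>Q[OF 1 w] w by simp
        have f: "w \<in> Bd" "z \<in> Bd" "enat m \<le> path_len w" "enat n \<le> path_len z"
          using w PB z len len' 1 by auto
        have o: "openin Tp (C \<inter> P)" using C op by blast
        obtain V where V: "openin Tp V" "z \<in> V" "V \<subseteq> Q" "\<And>z'. z' \<in> V \<Longrightarrow> \<exists>w'\<in>C \<inter> P. shift E m w' = shift E n z'"
          by (rule local_section[OF f w(2) o wC op(2) 1]) (rule that)
        have "\<tau> z' \<in> C" if z': "z' \<in> V" for z'
        proof -
          obtain w' where "w' \<in> C \<inter> P" "shift E m w' = shift E n z'" using V(4)[OF z'] by blast
          then show ?thesis using \<tau>Q[of z' w'] V(3) z' by auto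
        qed
        then show ?thesis using V(1,2) by blast
      next
        case 2
        then obtain w where w: "w \<in> Q" "shift E m z = shift E n w" using exQ by blast
        have wC: "w \<in> C \<inter> Q" using z \<tau>P[OF w(1) 2 w(2)] w by simp
        have f: "w \<in> Bd" "z \<in> Bd" "enat n \<le> path_len w" "enat m \<le> path_len z"
          using w PB z len len' 2 by auto
        have o: "openin Tp (C \<inter> Q)" using C op by blast
        obtain V where V: "openin Tp V" "z \<in> V" "V \<subseteq> P" "\<And>z'. z' \<in> V \<Longrightarrow> \<exists>w'\<in>C \<inter> Q. shift E n w' = shift E m z'"
          by (rule local_section[OF f w(2)[symmetric] o wC op(1) 2]) (rule that)
        have "\<tau> z' \<in> C" if z': "z' \<in> V" for z'
        proof -
          obtain w' where "w' \<in> C \<inter> Q" "shift E n w' = shift E m z'" using V(4)[OF z'] by blast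
          then show ?thesis using \<tau>P[of w' z'] V(3) z' by auto
        qed
        then show ?thesis using V(1,2) by blast
      next
        case 3
        \<comment> \<open>\<open>P\<close> and \<open>Q\<close> are closed as well as open, so the
          part fixed by definition is open and continuity can be checked on three open
          pieces.\<close>
        have "openin Tp (C - (P \<union> Q))" using C op by (meson closedin_Un openin_diff)
        moreover have "z \<in> C - (P \<union> Q)" using z fix0 3 by auto
        moreover have "\<forall>z'\<in>C - (P \<union> Q). \<tau> z' \<in> C" using fix0 C open_sub by fastforce
        ultimately show ?thesis by blast
      qed
      then obtain V where "openin Tp V" "z \<in> V" "\<forall>z'\<in>V. \<tau> z' \<in> C" by blast
      then show "\<exists>V. openin Tp V \<and> z \<in> V \<and> V \<subseteq> {z \<in> topspace Tp. \<tau> z \<in> C}" 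
        using openin_subset by blast
    qed
  qed
  have gQ: "germ \<tau> z k" if z: "z \<in> Q" for z
  proof (rule germI[OF op(2) z mn(6)])
    fix z assume z: "z \<in> Q"
    then obtain w where w: "w \<in> P" "shift E m w = shift E n z" using exP by blast
    then show "enat m \<le> path_len (\<tau> z) \<and> enat n \<le> path_len z \<and> shift E m (\<tau> z) = shift E n z"
      using \<tau>Q[OF z w] len len' z by simp
  qed
  have gP: "germ \<tau> z (- k)" if z: "z \<in> P" for z
  proof (rule germI[OF op(1) z, of _ n m])
    show "- k = int n - int m" using mn(6) by simp
    fix z assume z: "z \<in> P"
    then obtain w where w: "w \<in> Q" "shift E m z = shift E n w" using exQ by blast
    then show "enat n \<le> path_len (\<tau> z) \<and> enat m \<le> path_len z \<and> shift E n (\<tau> z) = shift E m z"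
      using \<tau>P[OF w(1) z w(2)] len len' z by simp
  qed
  have g0: "germ \<tau> z 0" if z: "z \<in> Bd" "z \<notin> P" "z \<notin> Q" for z
  proof (rule germ_id)
    show "openin Tp (Bd - (P \<union> Q))" using op by (metis closedin_Un openin_diff openin_topspace topspace_T)
    show "z \<in> Bd - (P \<union> Q)" using z by blast
  qed (use fix0 in auto)
  have "\<tau> \<in> FG"
    unfolding FG_def
  proof (intro CollectI conjI ballI)
    show "\<tau> \<in> extensional Bd" using PB by (auto simp: extensional_def \<tau>_def)
    have "homeomorphic_maps Tp Tp \<tau> \<tau>" unfolding homeomorphic_maps_def using cont invol by simp
    then show "homeomorphic_map Tp Tp \<tau>" using homeomorphic_maps_map by blast
    show "\<exists>k. germ \<tau> z k" if "z \<in> Bd" for z using gQ gP g0 that by blast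
    have "{z \<in> Bd. \<tau> z \<noteq> z} \<subseteq> P \<union> Q" using fix0 by blast
    then have "Tp closure_of {z \<in> Bd. \<tau> z \<noteq> z} \<subseteq> P \<union> Q"
      by (rule closure_of_minimal) (use op in \<open>auto intro: closedin_Un\<close>)
    then show "compactin Tp (Tp closure_of {z \<in> Bd. \<tau> z \<noteq> z})"
      using closed_compactin[OF compactin_Un[OF op(5,6)]] by simp
  qed
  moreover have "\<tau> y = x" using \<tau>Q[OF xy(2,1) mn(5)] .
  ultimately show ?thesis using that[of \<tau> P Q] xy jF(2,3) op invol fix0 gQ[OF xy(2)] PQ by blast
qed

abbreviation "DG \<equiv> commutator_subgroup FullG"

lemma DG_subgroup: "subgroup DG FullG"
  unfolding commutator_subgroup_def by (rule group.derived_is_subgroup[OF group_full]) simp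

lemma DG_FG: "DG \<subseteq> FG"
  using subgroup.subset[OF DG_subgroup] by simp

lemma openin_minus_point: "openin Tp A \<Longrightarrow> openin Tp (A - {x})"
proof (cases "x \<in> Bd")
  case True
  then have "closedin Tp {x}" using hausdorff_T by (simp add: closedin_Hausdorff_singleton)
  then show "openin Tp A \<Longrightarrow> openin Tp (A - {x})" by (rule openin_diff[rotated])
next
  case False
  then show "openin Tp A \<Longrightarrow> openin Tp (A - {x})" using open_sub by (metis Diff_empty Diff_insert0)
qed

text \<open>The commutator of the transpositions \<open>(w x)\<close> and \<open>(x y)\<close> is a 3-cycle, and it agrees with
  \<open>(x y)\<close> near \<open>y\<close>.\<close>

lemma three_cycle:
  assumes g: "(x, k, y) \<in> graph_groupoid E" "(w, l, x) \<in> graph_groupoid E"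
    and ne: "x \<noteq> y" "w \<noteq> x" "w \<noteq> y" and A: "openin Tp A" "x \<in> A" "y \<in> A" "w \<in> A"
  obtains c where "c \<in> DG" "c y = x" "c x = w" "c w = y" "germ c y k" "\<And>z. z \<in> Bd \<Longrightarrow> z \<notin> A \<Longrightarrow> c z = z"
proof -
  have B: "x \<in> Bd" "y \<in> Bd" "w \<in> Bd" using A open_sub by blast+
  \<comment> \<open>Keeping \<open>w\<close> out of the support of \<open>t\<close> and
    \<open>y\<close> out of that of \<open>s\<close> leaves \<open>x\<close> as the only one of the
    three points that both move.\<close>
  have o: "openin Tp (A - {w})" "openin Tp (A - {y})" using openin_minus_point A(1) by blast+
  obtain t P Q where t: "t \<in> FG" "x \<in> P" "P \<subseteq> A - {w}" "y \<in> Q" "Q \<subseteq> A - {w}" "closedin Tp P" "closedin Tp Q"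
    "\<And>z. z \<in> Bd \<Longrightarrow> t (t z) = z" "\<And>z. z \<in> Bd \<Longrightarrow> z \<notin> P \<Longrightarrow> z \<notin> Q \<Longrightarrow> t z = z" "t y = x" "germ t y k"
    by (rule transposition[OF g(1) ne(1) o(1) _ o(1)]) (use A ne in auto)
  obtain s P' Q' where s: "s \<in> FG" "w \<in> P'" "P' \<subseteq> A - {y}" "x \<in> Q'" "Q' \<subseteq> A - {y}" "closedin Tp P'" "closedin Tp Q'"
    "\<And>z. z \<in> Bd \<Longrightarrow> s (s z) = z" "\<And>z. z \<in> Bd \<Longrightarrow> z \<notin> P' \<Longrightarrow> z \<notin> Q' \<Longrightarrow> s z = z" "s x = w"
    by (rule transposition[OF g(2) ne(2) o(2) _ o(2)]) (use A ne in auto)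
  have iS: "inv\<^bsub>FullG\<^esub> s = s" by (rule inv_involution[OF s(1,8)])
  have iT: "inv\<^bsub>FullG\<^esub> t = t" by (rule inv_involution[OF t(1,8)])
  define c where "c = s \<otimes>\<^bsub>FullG\<^esub> t \<otimes>\<^bsub>FullG\<^esub> inv\<^bsub>FullG\<^esub> s \<otimes>\<^bsub>FullG\<^esub> inv\<^bsub>FullG\<^esub> t"
  have cz: "c z = s (t (s (t z)))" if "z \<in> Bd" for z
    using that fg_in[OF s(1)] fg_in[OF t(1)] by (simp add: c_def iS iT compose_def)
  have "c \<in> derived_set FullG (carrier FullG)" using s(1) t(1) unfolding c_def by auto
  then have cD: "c \<in> DG" unfolding commutator_subgroup_def derived_def by (rule generate.incl)
  then have cF: "c \<in> FG" using DG_FG by blast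
  have v: "t y = x" "t x = y" "t w = w" "s x = w" "s w = x" "s y = y"
    using t(8)[OF B(2)] t(9)[OF B(3)] t(3,5,10) s(8)[OF B(1)] s(9)[OF B(2)] s(3,5,10) by auto
  \<comment> \<open>On this neighbourhood of \<open>y\<close> the second application of
    \<open>t\<close> in \<open>s (t (s (t z)))\<close> does nothing, and the two applications of
    \<open>s\<close> cancel.\<close>
  let ?O = "{z \<in> Bd. s (t z) \<in> Bd - (P \<union> Q)}"
  have "continuous_map Tp Tp (s \<circ> t)" using continuous_map_compose[OF fg_cont[OF t(1)] fg_cont[OF s(1)]] .
  moreover have "openin Tp (Bd - (P \<union> Q))"
    using t(6,7) by (metis closedin_Un openin_diff openin_topspace topspace_T)
  ultimately have "openin Tp {z \<in> Bd. (s \<circ> t) z \<in> Bd - (P \<union> Q)}" by (rule cont_pre)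
  then have O: "openin Tp ?O" by (simp only: comp_def)
  moreover have "y \<in> ?O" using v B t(3,5) by auto
  moreover have "c z = t z" if z: "z \<in> ?O" for z
  proof -
    have "t (s (t z)) = s (t z)" using t(9) z by blast
    then show ?thesis using cz s(8)[of "t z"] z fg_in[OF t(1)] by auto
  qed
  ultimately have gk: "germ c y k" by (rule germ_cong[OF _ _ _ t(11)])
  have out: "c z = z" if "z \<in> Bd" "z \<notin> A" for z
  proof -
    have "t z = z" "s z = z" using t(3,5,9) s(3,5,9) that by blast+
    then show ?thesis using cz[OF that(1)] by simp
  qed
  have "c y = x" "c x = w" "c w = y" using cz B v by simp_all
  then show ?thesis by (rule that[OF cD _ _ _ gk out])
qed

text \<open>A third point of the orbit inside \<open>A\<close>, provided by \<open>escape\<close>,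
  completes the arrow to a 3-cycle with the same germ at \<open>y\<close>.\<close>

lemma mover:
  assumes g: "(x, k, y) \<in> graph_groupoid E" "x \<noteq> y" and A: "openin Tp A" "x \<in> A" "y \<in> A"
  obtains c where "c \<in> DG" "c y = x" "germ c y k" "\<And>z. z \<in> Bd \<Longrightarrow> z \<notin> A \<Longrightarrow> c z = z"
proof -
  obtain w l where w: "(w, l, x) \<in> graph_groupoid E" "w \<in> A - {y}" "w \<noteq> x"
    by (rule escape[OF openin_minus_point[OF A(1)], of x y]) (use A g in auto)
  then show ?thesis using three_cycle[OF g(1) w(1) g(2) w(3) _ A(1,2,3)] that by blast
qed

text \<open>An isotropy arrow is the quotient of two arrows into another point of the orbit.\<close>

lemma arrow_surj:
  assumes "g \<in> graph_groupoid E"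
  obtains c y where "c \<in> DG" "y \<in> Bd" "g = arrow c y"
proof -
  have ne: "\<exists>c\<in>DG. arrow c y = (x, k, y)" if g: "(x, k, y) \<in> graph_groupoid E" "x \<noteq> y" for x k y
  proof -
    have "x \<in> Bd" "y \<in> Bd" using g(1) groupoid_iff by blast+
    then obtain c where c: "c \<in> DG" "c y = x" "germ c y k"
      using mover[OF g openin_topspace] by (metis topspace_T)
    then show ?thesis using lag_eq[of c y k] DG_FG by (auto simp: arrow_def)
  qed
  obtain x k y where gxy: "g = (x, k, y)" by (cases g)
  have B: "x \<in> Bd" "y \<in> Bd" using assms gxy groupoid_iff by blast+
  show ?thesis
  proof (cases "x = y")
    case False
    then show ?thesis using ne[of x k y] assms gxy B that by metis
  next
    case True
    have "x \<in> topspace Tp" using B by simp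
    then obtain z l where z: "(z, l, x) \<in> graph_groupoid E" "z \<noteq> x" by (rule escape[OF openin_topspace])
    have z': "(z, l + k, x) \<in> graph_groupoid E" using groupoid_mult z(1) assms gxy True by blast
    obtain c d where cd: "c \<in> DG" "arrow c x = (z, l, x)" "d \<in> DG" "arrow d x = (z, l + k, x)"
      using ne[OF z] ne[OF z' z(2)] by blast
    have F: "c \<in> FG" "d \<in> FG" using cd DG_FG by blast+
    let ?i = "inv\<^bsub>FullG\<^esub> c"
    have iD: "?i \<in> DG" using subgroup.m_inv_closed[OF DG_subgroup cd(1)] .
    then have iF: "?i \<in> FG" using DG_FG by blast
    have "?i \<otimes>\<^bsub>FullG\<^esub> c = \<one>\<^bsub>FullG\<^esub>" using group.l_inv[OF group_full] F by simp
    then have ic: "compose Bd ?i c = restrict id Bd" by simp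
    have "?i (c x) = x" using fun_cong[OF ic, of x] B by (simp add: compose_def)
    then have iz: "?i z = x" using cd(2) by (simp add: arrow_def)
    have "lag ?i (c x) + lag c x = 0"
      using lag_compose[OF iF F(1) B(1)] lag_eq[OF fg_id germ_id[OF openin_topspace]] B ic by simp
    then have "lag ?i z = - l" using cd(2) by (simp add: arrow_def)
    \<comment> \<open>The lags add up to \<open>- l + (l + k)\<close>.\<close>
    then have "arrow (compose Bd ?i d) x = (x, k, x)"
      using lag_compose[OF iF F(2) B(1)] cd(4) iz B by (simp add: arrow_def compose_def)
    moreover have "compose Bd ?i d \<in> DG" using subgroup.m_closed[OF DG_subgroup iD cd(3)] by simp
    ultimately show ?thesis using that B gxy True by metis
  qed
qed

lemma clopen_nbhd:
  assumes "openin Tp U" "x \<in> U"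
  obtains V where "openin Tp V" "closedin Tp V" "x \<in> V" "V \<subseteq> U"
  using open_nb[OF assms] assms open_sub nb_open nb_closed nb_self by metis

text \<open>The mover is placed in a clopen neighbourhood so that the closure of its moved points
  cannot leave \<open>U\<close>.\<close>

lemma locally_moving_DG:
  assumes "openin Tp U" "x \<in> U"
  shows "\<exists>c\<in>DG. c x \<noteq> x \<and> Tp closure_of {z \<in> Bd. c z \<noteq> z} \<subseteq> U"
proof -
  obtain V where V: "openin Tp V" "closedin Tp V" "x \<in> V" "V \<subseteq> U" using clopen_nbhd[OF assms] .
  obtain y k where y: "(y, k, x) \<in> graph_groupoid E" "y \<in> V" "y \<noteq> x" using escape[OF V(1,3)] .
  obtain c where c: "c \<in> DG" "c x = y" "\<And>z. z \<in> Bd \<Longrightarrow> z \<notin> V \<Longrightarrow> c z = z"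
    using mover[OF y(1,3) V(1) y(2) V(3)] by metis
  have "Tp closure_of {z \<in> Bd. c z \<noteq> z} \<subseteq> V" by (rule closure_of_minimal[OF _ V(2)]) (use c in blast)
  then show ?thesis using c y V(4) by blast
qed

text \<open>The product of two 3-cycles with one common point is a 5-cycle.\<close>

lemma exponent12_DG:
  assumes U: "openin Tp U" "x \<in> U"
  shows "\<exists>c\<in>DG. (c ^^ 12) x \<noteq> x \<and> {z \<in> Bd. c z \<noteq> z} \<subseteq> U"
proof -
  have B: "x \<in> Bd" using U open_sub by blast
  \<comment> \<open>Escaping four times, each time with the points found so far removed, gives five
    distinct points of one orbit.\<close>
  obtain x1 k1 where 1: "(x1, k1, x) \<in> graph_groupoid E" "x1 \<in> U" "x1 \<noteq> x" using escape[OF U] .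
  have U1: "openin Tp (U - {x1})" "x \<in> U - {x1}" using U 1 openin_minus_point by auto
  obtain x2 k2 where 2: "(x2, k2, x) \<in> graph_groupoid E" "x2 \<in> U - {x1}" "x2 \<noteq> x" using escape[OF U1] .
  have U2: "openin Tp (U - {x1} - {x2})" "x \<in> U - {x1} - {x2}" using U1 2 openin_minus_point by auto
  obtain x4 k4 where 4: "(x4, k4, x) \<in> graph_groupoid E" "x4 \<in> U - {x1} - {x2}" "x4 \<noteq> x" using escape[OF U2] .
  have U3: "openin Tp (U - {x1} - {x2} - {x4})" "x \<in> U - {x1} - {x2} - {x4}" using U2 4 openin_minus_point by auto
  obtain x5 k5 where 5: "(x5, k5, x) \<in> graph_groupoid E" "x5 \<in> U - {x1} - {x2} - {x4}" "x5 \<noteq> x" using escape[OF U3] .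
  \<comment> \<open>\<open>c\<close> avoids \<open>x4\<close>, \<open>x5\<close> and
    \<open>d\<close> avoids \<open>x1\<close>, \<open>x2\<close>, so the two 3-cycles have only
    \<open>x\<close> in common.\<close>
  have U45: "openin Tp (U - {x4} - {x5})" using U openin_minus_point by blast
  obtain c where c: "c \<in> DG" "c x = x1" "c x1 = x2" "c x2 = x" "\<And>z. z \<in> Bd \<Longrightarrow> z \<notin> U - {x4} - {x5} \<Longrightarrow> c z = z"
    using three_cycle[OF 1(1) groupoid_mult[OF 2(1) groupoid_inv[OF 1(1)]] _ _ _ U45] 1 2 4 5 U by auto
  obtain d where d: "d \<in> DG" "d x = x4" "d x4 = x5" "d x5 = x" "\<And>z. z \<in> Bd \<Longrightarrow> z \<notin> U - {x1} - {x2} \<Longrightarrow> d z = z"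
    using three_cycle[OF 4(1) groupoid_mult[OF 5(1) groupoid_inv[OF 4(1)]] _ _ _ U2(1)] 1 2 4 5 U by auto
  have XB: "x1 \<in> Bd" "x2 \<in> Bd" "x4 \<in> Bd" "x5 \<in> Bd" using 1 2 4 5 groupoid_iff by blast+
  let ?g = "compose Bd c d"
  have fixed: "c x4 = x4" "c x5 = x5" "d x1 = x1" "d x2 = x2" using c(5) d(5) XB by auto
  have g: "?g x = x4" "?g x4 = x5" "?g x5 = x1" "?g x1 = x2" "?g x2 = x"
    using c d fixed XB B by (simp_all add: compose_def)
  \<comment> \<open>As 12 is 2 modulo 5, the twelfth power acts on these five points as the square
    of the 5-cycle.\<close>
  have "(?g ^^ 12) x = x5" by (simp add: eval_nat_numeral g)
  moreover have "?g \<in> DG" using subgroup.m_closed[OF DG_subgroup c(1) d(1)] by simp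
  moreover have "?g z = z" if "z \<in> Bd" "z \<notin> U" for z using c(5) d(5) that by (simp add: compose_def)
  ultimately show ?thesis using 5 by blast
qed

text \<open>Compact open supports are inherited from the full group above \<open>\<Gamma>\<close>,
  and the moving elements come from the commutator subgroup below it.\<close>

lemma rubin_action_full:
  assumes \<Gamma>: "subgroup \<Gamma> FullG" "DG \<subseteq> \<Gamma>"
  shows "rubin_action (FullG\<lparr>carrier := \<Gamma>\<rparr>) Tp (\<lambda>\<pi>. \<pi>)"
proof -
  have \<Gamma>F: "\<Gamma> \<subseteq> FG" using subgroup.subset[OF \<Gamma>(1)] by simp
  interpret G: group "FullG\<lparr>carrier := \<Gamma>\<rparr>" using subgroup.subgroup_is_group[OF \<Gamma>(1) group_full] .
  show ?thesis
  proof unfold_locales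
    show "Hausdorff_space Tp" by (rule hausdorff_T)
    fix g assume "g \<in> carrier (FullG\<lparr>carrier := \<Gamma>\<rparr>)"
    then have g: "g \<in> \<Gamma>" "g \<in> FG" using \<Gamma>F by auto
    show "continuous_map Tp Tp g" using fg_cont[OF g(2)] .
    show "compactin Tp (Tp closure_of {x \<in> topspace Tp. g x \<noteq> x})" using g(2) by (simp add: FG_def)
    show "openin Tp (Tp closure_of {x \<in> topspace Tp. g x \<noteq> x})"
      using supp_clopen[OF fg_cont[OF g(2)]] g(2) by (simp add: FG_def)
    fix h assume "h \<in> carrier (FullG\<lparr>carrier := \<Gamma>\<rparr>)"
    then have h: "h \<in> \<Gamma>" "h \<in> FG" using \<Gamma>F by auto
    show "(g \<otimes>\<^bsub>FullG\<lparr>carrier := \<Gamma>\<rparr>\<^esub> h) x = g (h x)" if "x \<in> topspace Tp" for x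
      using that by (simp add: compose_def)
    show "g = h" if "\<And>x. x \<in> topspace Tp \<Longrightarrow> g x = h x" using fg_eqI[OF g(2) h(2)] that by simp
  next
    show "\<one>\<^bsub>FullG\<lparr>carrier := \<Gamma>\<rparr>\<^esub> x = x" if "x \<in> topspace Tp" for x using that by simp
    fix U x assume U: "openin Tp U" "x \<in> U"
    show "\<exists>g\<in>carrier (FullG\<lparr>carrier := \<Gamma>\<rparr>). g x \<noteq> x \<and> Tp closure_of {x \<in> topspace Tp. g x \<noteq> x} \<subseteq> U"
      using locally_moving_DG[OF U] \<Gamma>(2) by auto
    obtain c where c: "c \<in> DG" "(c ^^ 12) x \<noteq> x" "{z \<in> Bd. c z \<noteq> z} \<subseteq> U" using exponent12_DG[OF U] by blast
    have cF: "c \<in> FG" using c(1) DG_FG by blast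
    have xB: "x \<in> Bd" using U open_sub by blast
    \<comment> \<open>Group powers agree with iterates only on the boundary, because the unit is the
      identity restricted to it.\<close>
    have pw: "(c [^]\<^bsub>FullG\<lparr>carrier := \<Gamma>\<rparr>\<^esub> (n::nat)) z = (c ^^ n) z" if "z \<in> Bd" for n z
      using that
    proof (induction n arbitrary: z)
      case (Suc n)
      have "c z \<in> Bd" using fg_in[OF cF Suc.prems] .
      then show ?case using Suc by (simp add: compose_def funpow_swap1)
    qed simp
    have "c [^]\<^bsub>FullG\<lparr>carrier := \<Gamma>\<rparr>\<^esub> (12::nat) \<noteq> \<one>\<^bsub>FullG\<lparr>carrier := \<Gamma>\<rparr>\<^esub>"
      using pw[OF xB, of 12] c(2) xB by auto
    then show "\<exists>g\<in>carrier (FullG\<lparr>carrier := \<Gamma>\<rparr>). g [^]\<^bsub>FullG\<lparr>carrier := \<Gamma>\<rparr>\<^esub> (12::nat) \<noteq> \<one>\<^bsub>FullG\<lparr>carrier := \<Gamma>\<rparr>\<^esub> \<and>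
       {x \<in> topspace Tp. g x \<noteq> x} \<subseteq> U"
      using c(1,3) \<Gamma>(2) by auto
  qed
qed

end

section \<open>Isomorphisms of graph groupoids\<close>

context kwi_graph
begin

text \<open>The right-hand side speaks only about the action on the space, so an equivariant
  homeomorphism preserves it.\<close>

lemma arrow_eq_iff:
  assumes "\<pi> \<in> FG" "\<rho> \<in> FG" "y \<in> Bd"
  shows "arrow \<pi> y = arrow \<rho> y' \<longleftrightarrow> y = y' \<and> (\<exists>V. openin Tp V \<and> y \<in> V \<and> (\<forall>z\<in>V. \<pi> z = \<rho> z))"
proof
  assume "arrow \<pi> y = arrow \<rho> y'"
  then have e: "y = y'" "\<pi> y = \<rho> y" "lag \<pi> y = lag \<rho> y" by (auto simp: arrow_def)
  have "germ \<rho> y (lag \<pi> y)" using germ_lag[OF assms(2,3)] e(3) by simp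
  then obtain V where "openin Tp V" "y \<in> V" "\<And>z. z \<in> V \<Longrightarrow> \<pi> z = \<rho> z"
    using eventually_equal[OF fg_cont[OF assms(1)] fg_cont[OF assms(2)] germ_lag[OF assms(1,3)] _ e(2)] by metis
  then show "y = y' \<and> (\<exists>V. openin Tp V \<and> y \<in> V \<and> (\<forall>z\<in>V. \<pi> z = \<rho> z))" using e(1) by blast
next
  assume "y = y' \<and> (\<exists>V. openin Tp V \<and> y \<in> V \<and> (\<forall>z\<in>V. \<pi> z = \<rho> z))"
  then obtain V where V: "y = y'" "openin Tp V" "y \<in> V" "\<And>z. z \<in> V \<Longrightarrow> \<pi> z = \<rho> z" by blast
  have "germ \<pi> y (lag \<rho> y)" by (rule germ_cong[OF V(2-4) germ_lag[OF assms(2,3)]])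
  then show "arrow \<pi> y = arrow \<rho> y'" using lag_eq[OF assms(1)] V by (simp add: arrow_def)
qed

text \<open>The arrow maps of elements of \<open>\<Gamma>\<close> are continuous and open, and
  together they reach every arrow. Hence the topology of the groupoid is determined by the action of
  \<open>\<Gamma>\<close>.\<close>

lemma openin_groupoid_iff:
  assumes \<Gamma>: "DG \<subseteq> \<Gamma>" "\<Gamma> \<subseteq> FG"
  shows "openin (groupoid_top E) W \<longleftrightarrow> W \<subseteq> graph_groupoid E \<and>
    (\<forall>\<pi>\<in>\<Gamma>. \<forall>y\<in>Bd. arrow \<pi> y \<in> W \<longrightarrow> (\<exists>V. openin Tp V \<and> y \<in> V \<and> arrow \<pi> ` V \<subseteq> W))"
proof
  assume W: "openin (groupoid_top E) W"
  have "\<exists>V. openin Tp V \<and> y \<in> V \<and> arrow \<pi> ` V \<subseteq> W" if p: "\<pi> \<in> \<Gamma>" "y \<in> Bd" "arrow \<pi> y \<in> W" for \<pi> y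
  proof -
    have "\<pi> \<in> FG" using p(1) \<Gamma> by blast
    then show ?thesis using arrow_cont[OF _ W p(2,3)] by metis
  qed
  then show "W \<subseteq> graph_groupoid E \<and>
    (\<forall>\<pi>\<in>\<Gamma>. \<forall>y\<in>Bd. arrow \<pi> y \<in> W \<longrightarrow> (\<exists>V. openin Tp V \<and> y \<in> V \<and> arrow \<pi> ` V \<subseteq> W))"
    using openin_subset[OF W] by simp
next
  assume R: "W \<subseteq> graph_groupoid E \<and>
    (\<forall>\<pi>\<in>\<Gamma>. \<forall>y\<in>Bd. arrow \<pi> y \<in> W \<longrightarrow> (\<exists>V. openin Tp V \<and> y \<in> V \<and> arrow \<pi> ` V \<subseteq> W))"
  show "openin (groupoid_top E) W"
  proof (subst openin_subopen, intro ballI)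
    fix g assume g: "g \<in> W"
    then obtain c y where c: "c \<in> DG" "y \<in> Bd" "g = arrow c y" using R arrow_surj by blast
    then obtain V where V: "openin Tp V" "y \<in> V" "arrow c ` V \<subseteq> W" using R g \<Gamma>(1) by blast
    have "c \<in> FG" using c(1) DG_FG by blast
    then have "openin (groupoid_top E) (arrow c ` V)" using arrow_open V(1) by blast
    then show "\<exists>T. openin (groupoid_top E) T \<and> g \<in> T \<and> T \<subseteq> W" using V c(3) by blast
  qed
qed

lemma arrow_mult:
  assumes "\<pi> \<in> FG" "\<rho> \<in> FG" "y \<in> Bd"
  shows "g_mult (arrow \<pi> (\<rho> y)) (arrow \<rho> y) = arrow (compose Bd \<pi> \<rho>) y"
  using lag_compose[OF assms] assms(3) by (simp add: g_mult_def arrow_def compose_def)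

text \<open>Units are the arrows of the identity. With the source map below, this turns a groupoid
  isomorphism into a continuous map of the unit spaces.\<close>

lemma continuous_map_unit: "continuous_map Tp (groupoid_top E) (\<lambda>x. (x, 0, x))"
  unfolding continuous_map_def
proof (intro conjI allI impI)
  show "(\<lambda>x. (x, 0, x)) \<in> topspace Tp \<rightarrow> topspace (groupoid_top E)" using groupoid_unit by simp
  fix W assume W: "openin (groupoid_top E) W"
  let ?i = "restrict id Bd"
  have a: "arrow ?i x = (x, 0, x)" if "x \<in> Bd" for x
    using lag_eq[OF fg_id germ_id[OF openin_topspace]] that by (simp add: arrow_def)
  show "openin Tp {x \<in> topspace Tp. (x, 0, x) \<in> W}"
  proof (subst openin_subopen, intro ballI)
    fix x assume x: "x \<in> {x \<in> topspace Tp. (x, 0, x) \<in> W}"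
    then obtain V where V: "openin Tp V" "x \<in> V" "arrow ?i ` V \<subseteq> W"
      using arrow_cont[OF fg_id W, of x] a by auto
    have "V \<subseteq> {x \<in> topspace Tp. (x, 0, x) \<in> W}"
    proof
      fix z assume z: "z \<in> V"
      then have zB: "z \<in> Bd" using V(1) open_sub by blast
      have "arrow ?i z \<in> W" using V(3) z by blast
      then have "(z, 0, z) \<in> W" unfolding a[OF zB] .
      then show "z \<in> {x \<in> topspace Tp. (x, 0, x) \<in> W}" using zB by simp
    qed
    then show "\<exists>T. openin Tp T \<and> x \<in> T \<and> T \<subseteq> {x \<in> topspace Tp. (x, 0, x) \<in> W}" using V by blast
  qed
qed

text \<open>Every arrow lies in an open set of arrows of one homeomorphism, where the source map
  inverts the arrow map.\<close>

lemma continuous_map_src: "continuous_map (groupoid_top E) Tp g_src"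
  unfolding continuous_map_def
proof (intro conjI allI impI)
  show "g_src \<in> topspace (groupoid_top E) \<rightarrow> topspace Tp" 
    using groupoid_iff by (auto simp: g_src_def)
  fix V assume V: "openin Tp V"
  show "openin (groupoid_top E) {g \<in> topspace (groupoid_top E). g_src g \<in> V}"
  proof (subst openin_subopen, intro ballI)
    fix g assume g: "g \<in> {g \<in> topspace (groupoid_top E). g_src g \<in> V}"
    then have "g \<in> graph_groupoid E" by simp
    then obtain c y where c: "c \<in> DG" "y \<in> Bd" "g = arrow c y" by (rule arrow_surj)
    have cF: "c \<in> FG" using c(1) DG_FG by blast
    have "arrow c ` V \<subseteq> {g \<in> topspace (groupoid_top E). g_src g \<in> V}"
      using arrow_in[OF cF] V open_sub by (auto simp: g_src_def arrow_def)
    moreover have "g \<in> arrow c ` V" using g c(3) by (auto simp: g_src_def arrow_def)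
    ultimately show "\<exists>T. openin (groupoid_top E) T \<and> g \<in> T \<and> T \<subseteq> {g \<in> topspace (groupoid_top E). g_src g \<in> V}"
      using arrow_open[OF cF V] by blast
  qed
qed

end

text \<open>The germ of \<open>\<pi>\<close> at \<open>y\<close> is mapped to the germ of \<open>i \<pi>\<close> at \<open>\<Phi> y\<close>.\<close>

lemma groupoids_isomorphic_if_spatial:
  assumes E: "kwi_graph E" and F: "kwi_graph F"
    and \<Gamma>: "subgroup \<Gamma> (full_group E)" "commutator_subgroup (full_group E) \<subseteq> \<Gamma>"
    and \<Lambda>: "subgroup \<Lambda> (full_group F)" "commutator_subgroup (full_group F) \<subseteq> \<Lambda>"
    and i: "i \<in> iso ((full_group E)\<lparr>carrier := \<Gamma>\<rparr>) ((full_group F)\<lparr>carrier := \<Lambda>\<rparr>)"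
    and h: "homeomorphic_map (boundary_top E) (boundary_top F) \<Phi>"
    and eqv: "\<And>\<pi> x. \<pi> \<in> \<Gamma> \<Longrightarrow> x \<in> boundary E \<Longrightarrow> \<Phi> (\<pi> x) = i \<pi> (\<Phi> x)"
  shows "groupoids_isomorphic E F"
proof -
  interpret E: kwi_graph E by fact
  interpret F: kwi_graph F by fact
  have \<Gamma>F: "\<Gamma> \<subseteq> E.FG" using subgroup.subset[OF \<Gamma>(1)] by simp
  have \<Lambda>F: "\<Lambda> \<subseteq> F.FG" using subgroup.subset[OF \<Lambda>(1)] by simp
  have i\<Lambda>: "i ` \<Gamma> = \<Lambda>" using i by (auto simp: iso_def bij_betw_def)
  have iF: "i \<pi> \<in> F.FG" if "\<pi> \<in> \<Gamma>" for \<pi> using that i\<Lambda> \<Lambda>F by blast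
  have imult: "i (compose E.Bd \<pi> \<rho>) = compose F.Bd (i \<pi>) (i \<rho>)" if "\<pi> \<in> \<Gamma>" "\<rho> \<in> \<Gamma>" for \<pi> \<rho>
    using i that by (auto simp: iso_def hom_def)
  have cont: "continuous_map E.Tp F.Tp \<Phi>" and op: "open_map E.Tp F.Tp \<Phi>"
    and inj: "inj_on \<Phi> E.Bd" and im: "\<Phi> ` E.Bd = F.Bd"
    using h by (auto simp: homeomorphic_eq_everything_map)
  have \<Phi>B: "\<Phi> x \<in> F.Bd" if "x \<in> E.Bd" for x using im that by blast
  have pre: "openin E.Tp {z \<in> E.Bd. \<Phi> z \<in> V}" if "openin F.Tp V" for V
    using openin_continuous_map_preimage[OF cont that] by simp
  have img: "openin F.Tp (\<Phi> ` V)" if "openin E.Tp V" for V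
    using op that by (simp add: open_map_def)
  \<comment> \<open>One direction will make the map on arrows well defined, the other one
    injective.\<close>
  have tr: "E.arrow \<pi> x = E.arrow \<rho> y \<longleftrightarrow> F.arrow (i \<pi>) (\<Phi> x) = F.arrow (i \<rho>) (\<Phi> y)"
    if p: "\<pi> \<in> \<Gamma>" "\<rho> \<in> \<Gamma>" "x \<in> E.Bd" "y \<in> E.Bd" for \<pi> \<rho> x y
  proof -
    have pF: "\<pi> \<in> E.FG" "\<rho> \<in> E.FG" using p \<Gamma>F by blast+
    have "(\<exists>V. openin E.Tp V \<and> x \<in> V \<and> (\<forall>z\<in>V. \<pi> z = \<rho> z)) \<longleftrightarrow>
       (\<exists>V. openin F.Tp V \<and> \<Phi> x \<in> V \<and> (\<forall>z\<in>V. i \<pi> z = i \<rho> z))" (is "?L \<longleftrightarrow> ?R")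
    proof
      assume ?L
      then obtain V where V: "openin E.Tp V" "x \<in> V" "\<forall>z\<in>V. \<pi> z = \<rho> z" by blast
      have "i \<pi> w = i \<rho> w" if w: "w \<in> \<Phi> ` V" for w
      proof -
        obtain z where z: "z \<in> V" "w = \<Phi> z" using w by blast
        then have "z \<in> E.Bd" using V(1) E.open_sub by blast
        then show ?thesis using eqv[OF p(1)] eqv[OF p(2)] z V(3) by metis
      qed
      then show ?R using img[OF V(1)] V(2) by blast
    next
      assume ?R
      then obtain V where V: "openin F.Tp V" "\<Phi> x \<in> V" "\<forall>z\<in>V. i \<pi> z = i \<rho> z" by blast
      have "\<pi> z = \<rho> z" if z: "z \<in> E.Bd" "\<Phi> z \<in> V" for z
      proof -
        have "\<Phi> (\<pi> z) = \<Phi> (\<rho> z)" using eqv[OF p(1) z(1)] eqv[OF p(2) z(1)] V(3) z(2) by simp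
        then show ?thesis using inj E.fg_in[OF pF(1) z(1)] E.fg_in[OF pF(2) z(1)] by (simp add: inj_on_eq_iff)
      qed
      then show ?L using pre[OF V(1)] V(2) p(3) by blast
    qed
    moreover have "\<Phi> x = \<Phi> y \<longleftrightarrow> x = y" using inj p(3,4) by (simp add: inj_on_eq_iff)
    ultimately show ?thesis
      unfolding E.arrow_eq_iff[OF pF p(3)] F.arrow_eq_iff[OF iF[OF p(1)] iF[OF p(2)] \<Phi>B[OF p(3)]] by simp
  qed
  have surjE: "\<exists>\<pi> y. \<pi> \<in> \<Gamma> \<and> y \<in> E.Bd \<and> g = E.arrow \<pi> y" if "g \<in> graph_groupoid E" for g
    by (rule E.arrow_surj[OF that]) (use \<Gamma>(2) in blast)
  have surjF: "\<exists>\<pi> y. \<pi> \<in> \<Gamma> \<and> y \<in> E.Bd \<and> g = F.arrow (i \<pi>) (\<Phi> y)" if g: "g \<in> graph_groupoid F" for g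
  proof -
    obtain c w where c: "c \<in> F.DG" "w \<in> F.Bd" "g = F.arrow c w" by (rule F.arrow_surj[OF g])
    then obtain \<pi> where "\<pi> \<in> \<Gamma>" "c = i \<pi>" using i\<Lambda> \<Lambda>(2) by blast
    moreover obtain y where "y \<in> E.Bd" "w = \<Phi> y" using c(2) im by blast
    ultimately show ?thesis using c(3) by blast
  qed
  \<comment> \<open>An arrow has many representations by elements of \<open>\<Gamma>\<close>; by
    \<open>tr\<close> they all prescribe the same value.\<close>
  have "\<exists>h. \<forall>\<pi>\<in>\<Gamma>. \<forall>y\<in>E.Bd. g = E.arrow \<pi> y \<longrightarrow> h = F.arrow (i \<pi>) (\<Phi> y)" if g: "g \<in> graph_groupoid E" for g
  proof -
    obtain \<rho> x where r: "\<rho> \<in> \<Gamma>" "x \<in> E.Bd" "g = E.arrow \<rho> x" using surjE[OF g] by blast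
    show ?thesis
      by (rule exI[of _ "F.arrow (i \<rho>) (\<Phi> x)"]) (use r tr in auto)
  qed
  then obtain \<phi> where \<phi>0: "\<And>g. g \<in> graph_groupoid E \<Longrightarrow>
      \<forall>\<pi>\<in>\<Gamma>. \<forall>y\<in>E.Bd. g = E.arrow \<pi> y \<longrightarrow> \<phi> g = F.arrow (i \<pi>) (\<Phi> y)" by metis
  have \<phi>: "\<phi> (E.arrow \<pi> y) = F.arrow (i \<pi>) (\<Phi> y)" if "\<pi> \<in> \<Gamma>" "y \<in> E.Bd" for \<pi> y
  proof -
    have "\<pi> \<in> E.FG" using that(1) \<Gamma>F by blast
    then show ?thesis using \<phi>0[OF E.arrow_in, of \<pi> y] that by blast
  qed
  have inj\<phi>: "inj_on \<phi> (graph_groupoid E)"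
  proof (rule inj_onI)
    fix g h assume gh: "g \<in> graph_groupoid E" "h \<in> graph_groupoid E" "\<phi> g = \<phi> h"
    obtain \<pi> x where p: "\<pi> \<in> \<Gamma>" "x \<in> E.Bd" "g = E.arrow \<pi> x" using surjE[OF gh(1)] by blast
    obtain \<rho> y where q: "\<rho> \<in> \<Gamma>" "y \<in> E.Bd" "h = E.arrow \<rho> y" using surjE[OF gh(2)] by blast
    show "g = h" using gh(3) unfolding p(3) q(3) \<phi>[OF p(1,2)] \<phi>[OF q(1,2)] tr[OF p(1) q(1) p(2) q(2)] .
  qed
  have in\<phi>: "\<phi> g \<in> graph_groupoid F" if g: "g \<in> graph_groupoid E" for g
  proof -
    obtain \<pi> x where p: "\<pi> \<in> \<Gamma>" "x \<in> E.Bd" "g = E.arrow \<pi> x" using surjE[OF g] by blast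
    show ?thesis unfolding p(3) \<phi>[OF p(1,2)] by (rule F.arrow_in[OF iF[OF p(1)] \<Phi>B[OF p(2)]])
  qed
  have im\<phi>: "\<phi> ` graph_groupoid E = graph_groupoid F"
  proof
    show "graph_groupoid F \<subseteq> \<phi> ` graph_groupoid E"
    proof
      fix g assume "g \<in> graph_groupoid F"
      then obtain \<pi> y where p: "\<pi> \<in> \<Gamma>" "y \<in> E.Bd" "g = F.arrow (i \<pi>) (\<Phi> y)" using surjF by blast
      have "E.arrow \<pi> y \<in> graph_groupoid E" using E.arrow_in p(1,2) \<Gamma>F by blast
      then show "g \<in> \<phi> ` graph_groupoid E" using \<phi>[OF p(1,2)] p(3) by (metis imageI)
    qed
  qed (use in\<phi> in blast)
  have cont\<phi>: "continuous_map (groupoid_top E) (groupoid_top F) \<phi>"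
    unfolding continuous_map_def
  proof (intro conjI allI impI)
    show "\<phi> \<in> topspace (groupoid_top E) \<rightarrow> topspace (groupoid_top F)" using in\<phi> by simp
    fix W assume W: "openin (groupoid_top F) W"
    show "openin (groupoid_top E) {g \<in> topspace (groupoid_top E). \<phi> g \<in> W}" (is "openin _ ?W")
      \<comment> \<open>By this criterion it suffices to follow the arrows of a single
        \<open>\<pi>\<close>, where the map is given by \<open>\<Phi>\<close> on sources and
        continuity of \<open>\<Phi>\<close> is all that is used.\<close>
      unfolding E.openin_groupoid_iff[OF \<Gamma>(2) \<Gamma>F]
    proof (intro conjI ballI impI)
      fix \<pi> y assume p: "\<pi> \<in> \<Gamma>" "y \<in> E.Bd" "E.arrow \<pi> y \<in> ?W"
      then have a: "F.arrow (i \<pi>) (\<Phi> y) \<in> W" using \<phi> by simp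
      obtain V where V: "openin F.Tp V" "\<Phi> y \<in> V" "F.arrow (i \<pi>) ` V \<subseteq> W"
        by (rule F.arrow_cont[OF iF[OF p(1)] W \<Phi>B[OF p(2)] a])
      have "E.arrow \<pi> ` {z \<in> E.Bd. \<Phi> z \<in> V} \<subseteq> ?W"
      proof
        fix g assume "g \<in> E.arrow \<pi> ` {z \<in> E.Bd. \<Phi> z \<in> V}"
        then obtain z where z: "z \<in> E.Bd" "\<Phi> z \<in> V" "g = E.arrow \<pi> z" by blast
        then have "\<phi> g \<in> W" using \<phi>[OF p(1) z(1)] V(3) by auto
        moreover have "g \<in> graph_groupoid E" using z E.arrow_in p(1) \<Gamma>F by blast
        ultimately show "g \<in> ?W" by simp
      qed
      then show "\<exists>V. openin E.Tp V \<and> y \<in> V \<and> E.arrow \<pi> ` V \<subseteq> ?W" using pre[OF V(1)] V(2) p(2) by blast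
    qed auto
  qed
  have op\<phi>: "open_map (groupoid_top E) (groupoid_top F) \<phi>"
    unfolding open_map_def
  proof (intro allI impI)
    fix W assume W: "openin (groupoid_top E) W"
    have WG: "W \<subseteq> graph_groupoid E" using openin_subset[OF W] by simp
    show "openin (groupoid_top F) (\<phi> ` W)"
      unfolding F.openin_groupoid_iff[OF \<Lambda>(2) \<Lambda>F]
    proof (intro conjI ballI impI)
      show "\<phi> ` W \<subseteq> graph_groupoid F" using WG in\<phi> by blast
      fix l w assume l: "l \<in> \<Lambda>" "w \<in> F.Bd" "F.arrow l w \<in> \<phi> ` W"
      obtain \<pi> y where p: "\<pi> \<in> \<Gamma>" "y \<in> E.Bd" "l = i \<pi>" "w = \<Phi> y" using l(1,2) i\<Lambda> im by blast
      have pG: "E.arrow \<pi> y \<in> graph_groupoid E" "\<pi> \<in> E.FG" using E.arrow_in p(1,2) \<Gamma>F by blast+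
      have "\<phi> (E.arrow \<pi> y) \<in> \<phi> ` W" using l(3) p \<phi> by metis
      then have a: "E.arrow \<pi> y \<in> W" using inj_on_image_mem_iff[OF inj\<phi> pG(1) WG] by blast
      obtain V where V: "openin E.Tp V" "y \<in> V" "E.arrow \<pi> ` V \<subseteq> W"
        by (rule E.arrow_cont[OF pG(2) W p(2) a])
      have "F.arrow l ` (\<Phi> ` V) \<subseteq> \<phi> ` W"
      proof
        fix g assume "g \<in> F.arrow l ` (\<Phi> ` V)"
        then obtain z where z: "z \<in> V" "g = F.arrow (i \<pi>) (\<Phi> z)" using p(3) by blast
        then have "g = \<phi> (E.arrow \<pi> z)" using \<phi>[OF p(1)] V(1) E.open_sub by metis
        then show "g \<in> \<phi> ` W" using z V(3) by blast
      qed
      then show "\<exists>V. openin F.Tp V \<and> w \<in> V \<and> F.arrow l ` V \<subseteq> \<phi> ` W" using img[OF V(1)] V(2) p(4) by blast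
    qed
  qed
  have hom: "homeomorphic_map (groupoid_top E) (groupoid_top F) \<phi>"
    by (rule bijective_open_imp_homeomorphic_map[OF cont\<phi> op\<phi>]) (use im\<phi> inj\<phi> in auto)
  have mult: "(g_src g = g_rng h \<longleftrightarrow> g_src (\<phi> g) = g_rng (\<phi> h)) \<and>
        (g_src g = g_rng h \<longrightarrow> \<phi> (g_mult g h) = g_mult (\<phi> g) (\<phi> h))"
    if gh: "g \<in> graph_groupoid E" "h \<in> graph_groupoid E" for g h
  proof -
    obtain \<pi> x \<rho> y where p: "\<pi> \<in> \<Gamma>" "x \<in> E.Bd" "g = E.arrow \<pi> x" "\<rho> \<in> \<Gamma>" "y \<in> E.Bd" "h = E.arrow \<rho> y"
      using surjE[OF gh(1)] surjE[OF gh(2)] by blast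
    have pF: "\<pi> \<in> E.FG" "\<rho> \<in> E.FG" using p \<Gamma>F by blast+
    have \<phi>gh: "\<phi> g = F.arrow (i \<pi>) (\<Phi> x)" "\<phi> h = F.arrow (i \<rho>) (\<Phi> y)" using p \<phi> by auto
    have sr: "g_src g = x" "g_rng h = \<rho> y" "g_src (\<phi> g) = \<Phi> x" "g_rng (\<phi> h) = \<Phi> (\<rho> y)"
      using p \<phi>gh eqv[OF p(4,5)] by (simp_all add: g_src_def g_rng_def E.arrow_def F.arrow_def)
    have ry: "\<rho> y \<in> E.Bd" using E.fg_in[OF pF(2) p(5)] .
    have "g_src g = g_rng h \<longleftrightarrow> g_src (\<phi> g) = g_rng (\<phi> h)"
      unfolding sr using inj p(2) ry by (simp add: inj_on_eq_iff)
    moreover have "\<phi> (g_mult g h) = g_mult (\<phi> g) (\<phi> h)" if "g_src g = g_rng h"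
    proof -
      have x: "x = \<rho> y" using that sr by simp
      have c: "compose E.Bd \<pi> \<rho> \<in> \<Gamma>" using subgroup.m_closed[OF \<Gamma>(1) p(1,4)] by simp
      have "g_mult g h = E.arrow (compose E.Bd \<pi> \<rho>) y"
        unfolding p(3,6) x by (rule E.arrow_mult[OF pF p(5)])
      then have "\<phi> (g_mult g h) = F.arrow (compose F.Bd (i \<pi>) (i \<rho>)) (\<Phi> y)"
        using \<phi>[OF c p(5)] imult[OF p(1,4)] by simp
      also have "\<dots> = g_mult (F.arrow (i \<pi>) (i \<rho> (\<Phi> y))) (F.arrow (i \<rho>) (\<Phi> y))"
        using F.arrow_mult[OF iF[OF p(1)] iF[OF p(4)] \<Phi>B[OF p(5)]] by simp
      also have "\<dots> = g_mult (\<phi> g) (\<phi> h)" unfolding \<phi>gh x eqv[OF p(4,5)] ..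
      finally show ?thesis .
    qed
    ultimately show ?thesis by blast
  qed
  have "groupoid_iso E F \<phi>"
    unfolding groupoid_iso_def using hom mult inj\<phi> im\<phi> by (auto simp: bij_betw_def)
  then show ?thesis unfolding groupoids_isomorphic_def by blast
qed

section \<open>From groupoid isomorphisms to isomorphisms of full groups\<close>

lemma groupoid_iso_inverse:
  assumes E: "kwi_graph E" and "groupoid_iso E F \<phi>"
  shows "groupoid_iso F E (inv_into (graph_groupoid E) \<phi>)"
  unfolding groupoid_iso_def
proof (intro conjI ballI)
  interpret E: kwi_graph E by fact
  let ?\<psi> = "inv_into (graph_groupoid E) \<phi>"
  have b: "bij_betw \<phi> (graph_groupoid E) (graph_groupoid F)" 
    and h: "homeomorphic_map (groupoid_top E) (groupoid_top F) \<phi>"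
    and m: "\<And>g h. g\<in>graph_groupoid E \<Longrightarrow> h\<in>graph_groupoid E \<Longrightarrow>
        (g_src g = g_rng h \<longleftrightarrow> g_src (\<phi> g) = g_rng (\<phi> h)) \<and>
        (g_src g = g_rng h \<longrightarrow> \<phi> (g_mult g h) = g_mult (\<phi> g) (\<phi> h))"
    using assms by (auto simp: groupoid_iso_def)
  show "bij_betw ?\<psi> (graph_groupoid F) (graph_groupoid E)" using b by (rule bij_betw_inv_into)
  have tE: "topspace (groupoid_top E) \<subseteq> graph_groupoid E" by (simp add: groupoid_top_def)
  have "homeomorphic_maps (groupoid_top E) (groupoid_top F) \<phi> ?\<psi>"
  proof -
    obtain \<psi> where \<psi>: "homeomorphic_maps (groupoid_top E) (groupoid_top F) \<phi> \<psi>"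
      using h homeomorphic_map_maps by blast
    \<comment> \<open>The inverse supplied by the homeomorphism is an unspecified function;
      injectivity of \<open>\<phi>\<close> identifies it with \<open>inv_into\<close> on the
      groupoid.\<close>
    have "\<psi> y = ?\<psi> y" if y: "y \<in> topspace (groupoid_top F)" for y
    proof -
      have "\<psi> y \<in> graph_groupoid E" "\<phi> (\<psi> y) = y"
        using \<psi> y tE by (auto simp: homeomorphic_maps_def continuous_map_def Pi_iff subset_iff)
      then show ?thesis using b by (metis bij_betw_def inv_into_f_f)
    qed
    then show ?thesis using homeomorphic_maps_eq[OF \<psi>, of \<phi> ?\<psi>] by simp
  qed
  then show "homeomorphic_map (groupoid_top F) (groupoid_top E) ?\<psi>"
    using homeomorphic_maps_map by blast
  fix g h assume gh: "g \<in> graph_groupoid F" "h \<in> graph_groupoid F"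
  obtain a c where ac: "a \<in> graph_groupoid E" "c \<in> graph_groupoid E" "g = \<phi> a" "h = \<phi> c"
  proof -
    have "g \<in> \<phi> ` graph_groupoid E" "h \<in> \<phi> ` graph_groupoid E" using gh b by (simp_all add: bij_betw_def)
    then show ?thesis using that by blast
  qed
  have inv: "?\<psi> g = a" "?\<psi> h = c" using ac b by (auto simp: bij_betw_def)
  show "g_src g = g_rng h \<longleftrightarrow> g_src (?\<psi> g) = g_rng (?\<psi> h)"
    unfolding inv unfolding ac using m[OF ac(1,2)] by simp
  show "g_src g = g_rng h \<longrightarrow> ?\<psi> (g_mult g h) = g_mult (?\<psi> g) (?\<psi> h)"
  proof
    assume e: "g_src g = g_rng h"
    then have s: "g_src a = g_rng c" "\<phi> (g_mult a c) = g_mult g h" using m[OF ac(1,2)] ac by auto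
    obtain x k y where a: "a = (x, k, y)" by (cases a)
    obtain l z where c: "c = (y, l, z)" using s(1) a by (cases c) (auto simp: g_src_def g_rng_def)
    \<comment> \<open>\<open>inv_into\<close> cancels \<open>\<phi>\<close> only on arrows, so the
      product has to be recognised as an arrow first.\<close>
    have "g_mult a c \<in> graph_groupoid E"
      using ac(1,2) E.groupoid_mult unfolding a c g_mult_def by simp
    then show "?\<psi> (g_mult g h) = g_mult (?\<psi> g) (?\<psi> h)"
      unfolding inv s(2)[symmetric] using b by (simp add: bij_betw_def)
  qed
qed


text \<open>The image of a unit is idempotent, and an idempotent arrow is a unit because squaring
  doubles its integer component.\<close>

lemma groupoid_iso_unit:
  assumes E: "kwi_graph E" and i: "groupoid_iso E F \<phi>" and x: "x \<in> boundary E"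
  shows "\<phi> (x, 0, x) = (g_src (\<phi> (x, 0, x)), 0, g_src (\<phi> (x, 0, x)))"
proof -
  interpret E: kwi_graph E by fact
  let ?u = "(x, 0, x)"
  have u: "?u \<in> graph_groupoid E" using E.groupoid_unit x by blast
  have "g_src ?u = g_rng ?u" "g_mult ?u ?u = ?u" by (simp_all add: g_src_def g_rng_def g_mult_def)
  then have "g_src (\<phi> ?u) = g_rng (\<phi> ?u)" "\<phi> ?u = g_mult (\<phi> ?u) (\<phi> ?u)"
    using i u unfolding groupoid_iso_def by metis+
  then show ?thesis by (cases "\<phi> ?u") (auto simp: g_src_def g_rng_def g_mult_def)
qed

text \<open>An isomorphism is only required to respect composability; composing with units recovers
  its effect on sources and ranges.\<close>

lemma groupoid_iso_src_rng:
  assumes E: "kwi_graph E" and i: "groupoid_iso E F \<phi>" and g: "g \<in> graph_groupoid E"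
  shows "g_src (\<phi> g) = g_src (\<phi> (g_src g, 0, g_src g))" "g_rng (\<phi> g) = g_src (\<phi> (g_rng g, 0, g_rng g))"
proof -
  interpret E: kwi_graph E by fact
  obtain x k y where gxy: "g = (x, k, y)" by (cases g)
  have B: "x \<in> E.Bd" "y \<in> E.Bd" using g gxy E.groupoid_iff by blast+
  have u: "(x, 0, x) \<in> graph_groupoid E" "(y, 0, y) \<in> graph_groupoid E" using E.groupoid_unit B by blast+
  have "g_src g = g_rng (y, 0, y)" "g_src (x, 0, x) = g_rng g" by (simp_all add: gxy g_src_def g_rng_def)
  then have "g_src (\<phi> g) = g_rng (\<phi> (y, 0, y))" "g_src (\<phi> (x, 0, x)) = g_rng (\<phi> g)"
    using i u g unfolding groupoid_iso_def by metis+
  moreover have "g_rng (\<phi> (y, 0, y)) = g_src (\<phi> (y, 0, y))"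
    using groupoid_iso_unit[OF E i B(2)] by (metis fst_conv g_rng_def)
  ultimately show "g_src (\<phi> g) = g_src (\<phi> (g_src g, 0, g_src g))" "g_rng (\<phi> g) = g_src (\<phi> (g_rng g, 0, g_rng g))"
    by (simp_all add: gxy g_src_def g_rng_def)
qed

lemma groupoid_iso_cont_units:
  assumes E: "kwi_graph E" and F: "kwi_graph F" and i: "groupoid_iso E F \<phi>"
  shows "continuous_map (boundary_top E) (boundary_top F) (\<lambda>x. g_src (\<phi> (x, 0, x)))"
proof -
  interpret E: kwi_graph E by fact
  interpret F: kwi_graph F by fact
  have "continuous_map (groupoid_top E) (groupoid_top F) \<phi>"
    using i by (auto simp: groupoid_iso_def homeomorphic_imp_continuous_map)
  then have "continuous_map E.Tp F.Tp (g_src \<circ> (\<phi> \<circ> (\<lambda>x. (x, 0, x))))"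
    by (rule continuous_map_compose[OF continuous_map_compose[OF E.continuous_map_unit] F.continuous_map_src])
  then show ?thesis by (simp add: comp_def)
qed

text \<open>The image under \<open>\<phi>\<close> of the arrows of \<open>\<pi>\<close> is a
  bisection that induces the conjugated homeomorphism. Openness is transported by
  \<open>\<phi>\<close> and compactness of the support by \<open>\<Phi>\<close>.\<close>

lemma full_group_conj:
  assumes E: "kwi_graph E" and F: "kwi_graph F" and i: "groupoid_iso E F \<phi>"
    and \<Phi>: "\<And>x. x \<in> boundary E \<Longrightarrow> \<Phi> x = g_src (\<phi> (x, 0, x))"
    and hm: "homeomorphic_maps (boundary_top E) (boundary_top F) \<Phi> \<Psi>"
    and p: "\<pi> \<in> full_group_carrier E"
  shows "(\<lambda>y\<in>boundary F. \<Phi> (\<pi> (\<Psi> y))) \<in> full_group_carrier F"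
proof -
  interpret E: kwi_graph E by fact
  interpret F: kwi_graph F by fact
  have pF: "\<pi> \<in> E.FG" using p E.full_group_carrier_eq by simp
  let ?p = "\<lambda>y\<in>F.Bd. \<Phi> (\<pi> (\<Psi> y))"
  let ?U = "\<phi> ` E.arrow \<pi> ` E.Bd"
  have inv: "\<And>x. x \<in> E.Bd \<Longrightarrow> \<Psi> (\<Phi> x) = x" "\<And>y. y \<in> F.Bd \<Longrightarrow> \<Phi> (\<Psi> y) = y"
    "\<And>x. x \<in> E.Bd \<Longrightarrow> \<Phi> x \<in> F.Bd" "\<And>y. y \<in> F.Bd \<Longrightarrow> \<Psi> y \<in> E.Bd"
    using hm by (auto simp: homeomorphic_maps_def continuous_map_def)
  have hom: "homeomorphic_map E.Tp F.Tp \<Phi>" using hm homeomorphic_maps_map by blast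
  have sr: "g_src (\<phi> (E.arrow \<pi> x)) = \<Phi> x" "g_rng (\<phi> (E.arrow \<pi> x)) = \<Phi> (\<pi> x)" if x: "x \<in> E.Bd" for x
    using groupoid_iso_src_rng[OF E i E.arrow_in[OF pF x]] \<Phi> x E.fg_in[OF pF x]
    by (simp_all add: g_src_def g_rng_def E.arrow_def)
  have "full_open_bisection F ?U"
    unfolding full_open_bisection_def
  proof (intro conjI)
    have "openin (groupoid_top E) (E.arrow \<pi> ` E.Bd)" using E.arrow_open[OF pF openin_topspace] by simp
    then show "openin (groupoid_top F) ?U"
      using i unfolding groupoid_iso_def by (metis homeomorphic_imp_open_map open_map_def)
    have inj: "x = y" if "x \<in> E.Bd" "y \<in> E.Bd" "\<Phi> x = \<Phi> y" for x y using inv(1) that by metis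
    show "inj_on g_src ?U"
    proof (rule inj_onI)
      fix a b assume ab: "a \<in> ?U" "b \<in> ?U" "g_src a = g_src b"
      obtain x y where xy: "x \<in> E.Bd" "y \<in> E.Bd" "a = \<phi> (E.arrow \<pi> x)" "b = \<phi> (E.arrow \<pi> y)" using ab by blast
      then have "x = y" using inj ab(3) sr by simp
      then show "a = b" using xy by simp
    qed
    show "inj_on g_rng ?U"
    proof (rule inj_onI)
      fix a b assume ab: "a \<in> ?U" "b \<in> ?U" "g_rng a = g_rng b"
      obtain x y where xy: "x \<in> E.Bd" "y \<in> E.Bd" "a = \<phi> (E.arrow \<pi> x)" "b = \<phi> (E.arrow \<pi> y)" using ab by blast
      then have "\<pi> x = \<pi> y" using inj E.fg_in[OF pF] ab(3) sr by simp
      then have "x = y" using inj_onD[OF E.fg_inj[OF pF]] xy by blast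
      then show "a = b" using xy by simp
    qed
    have "\<Phi> ` E.Bd = F.Bd" using hom by (simp add: homeomorphic_eq_everything_map)
    moreover have "g_src ` ?U = \<Phi> ` E.Bd" using sr by (auto simp: image_image cong: image_cong_simp)
    moreover have "g_rng ` ?U = \<Phi> ` \<pi> ` E.Bd" using sr by (auto simp: image_image cong: image_cong_simp)
    ultimately show "g_src ` ?U = F.Bd" "g_rng ` ?U = F.Bd" using E.fg_surj[OF pF] by simp_all
  qed
  moreover have "\<exists>k. (?p y, k, y) \<in> ?U" if y: "y \<in> F.Bd" for y
  proof -
    let ?g = "\<phi> (E.arrow \<pi> (\<Psi> y))"
    have "g_src ?g = y" "g_rng ?g = ?p y" using sr[OF inv(4)[OF y]] inv(2)[OF y] y by auto
    then have "?g = (?p y, fst (snd ?g), y)" by (cases ?g) (simp add: g_src_def g_rng_def)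
    moreover have "?g \<in> ?U" using inv(4)[OF y] by blast
    ultimately show ?thesis by metis
  qed
  moreover have "compactin F.Tp (F.Tp closure_of {y \<in> F.Bd. ?p y \<noteq> y})"
  proof -
    let ?M = "{x \<in> E.Bd. \<pi> x \<noteq> x}"
    have "{y \<in> F.Bd. ?p y \<noteq> y} = \<Phi> ` ?M"
    proof (intro equalityI subsetI)
      fix y assume y: "y \<in> {y \<in> F.Bd. ?p y \<noteq> y}"
      then have "\<pi> (\<Psi> y) \<noteq> \<Psi> y" using inv(2) by auto
      then show "y \<in> \<Phi> ` ?M" using inv(2,4) y by (metis (mono_tags, lifting) image_eqI mem_Collect_eq)
    next
      fix y assume "y \<in> \<Phi> ` ?M"
      then obtain x where x: "x \<in> E.Bd" "\<pi> x \<noteq> x" "y = \<Phi> x" by blast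
      then have "\<Phi> (\<pi> x) \<noteq> \<Phi> x" using inv(1) E.fg_in[OF pF] by metis
      then show "y \<in> {y \<in> F.Bd. ?p y \<noteq> y}" using x inv by simp
    qed
    then have "F.Tp closure_of {y \<in> F.Bd. ?p y \<noteq> y} = \<Phi> ` (E.Tp closure_of ?M)"
      using homeomorphic_map_closure_of[OF hom, of ?M] by auto
    moreover have "compactin E.Tp (E.Tp closure_of ?M)" using pF by (simp add: E.FG_def)
    then have "compactin F.Tp (\<Phi> ` (E.Tp closure_of ?M))"
      using homeomorphic_imp_continuous_map[OF hom] by (rule image_compactin)
    ultimately show ?thesis by simp
  qed
  ultimately show ?thesis unfolding full_group_carrier_def by blast
qed

text \<open>The isomorphism restricts to a homeomorphism of the unit spaces, and conjugation by it
  is a group isomorphism whose inverse is conjugation by the inverse homeomorphism.\<close>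

lemma full_groups_iso_if_groupoids_isomorphic:
  assumes E: "kwi_graph E" and F: "kwi_graph F" and i: "groupoids_isomorphic E F"
  shows "full_group E \<cong> full_group F"
proof -
  interpret E: kwi_graph E by fact
  interpret F: kwi_graph F by fact
  obtain \<phi> where \<phi>: "groupoid_iso E F \<phi>" using i by (auto simp: groupoids_isomorphic_def)
  define \<psi> where "\<psi> = inv_into (graph_groupoid E) \<phi>"
  have \<psi>: "groupoid_iso F E \<psi>" unfolding \<psi>_def by (rule groupoid_iso_inverse[OF E \<phi>])
  have b: "bij_betw \<phi> (graph_groupoid E) (graph_groupoid F)" using \<phi> by (simp add: groupoid_iso_def)
  define \<Phi> where "\<Phi> x = g_src (\<phi> (x, 0, x))" for x
  define \<Psi> where "\<Psi> x = g_src (\<psi> (x, 0, x))" for x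
  have u: "\<phi> (x, 0, x) = (\<Phi> x, 0, \<Phi> x)" if "x \<in> E.Bd" for x
    unfolding \<Phi>_def using groupoid_iso_unit[OF E \<phi> that] .
  have v: "\<psi> (x, 0, x) = (\<Psi> x, 0, \<Psi> x)" if "x \<in> F.Bd" for x
    unfolding \<Psi>_def using groupoid_iso_unit[OF F \<psi> that] .
  have c: "continuous_map E.Tp F.Tp \<Phi>" "continuous_map F.Tp E.Tp \<Psi>"
    using groupoid_iso_cont_units[OF E F \<phi>] groupoid_iso_cont_units[OF F E \<psi>]
    unfolding \<Phi>_def[abs_def] \<Psi>_def[abs_def] .
  have B: "\<Phi> x \<in> F.Bd" if "x \<in> E.Bd" for x using c(1) that by (auto simp: continuous_map_def)
  have B': "\<Psi> x \<in> E.Bd" if "x \<in> F.Bd" for x using c(2) that by (auto simp: continuous_map_def)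
  have inv: "\<Psi> (\<Phi> x) = x" if "x \<in> E.Bd" for x
  proof -
    have "\<psi> (\<phi> (x, 0, x)) = (x, 0, x)"
      unfolding \<psi>_def using b E.groupoid_unit[OF that] by (simp add: bij_betw_def)
    then show ?thesis using u[OF that] v[OF B[OF that]] by simp
  qed
  have inv': "\<Phi> (\<Psi> x) = x" if "x \<in> F.Bd" for x
  proof -
    have "\<phi> (\<psi> (x, 0, x)) = (x, 0, x)"
      unfolding \<psi>_def using b F.groupoid_unit[OF that] by (simp add: bij_betw_def f_inv_into_f)
    then show ?thesis using v[OF that] u[OF B'[OF that]] by simp
  qed
  have hm: "homeomorphic_maps E.Tp F.Tp \<Phi> \<Psi>" using c inv inv' by (simp add: homeomorphic_maps_def)
  then have hm': "homeomorphic_maps F.Tp E.Tp \<Psi> \<Phi>" by (rule homeomorphic_maps_sym[THEN iffD1])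
  define C where "C \<pi> = (\<lambda>y\<in>F.Bd. \<Phi> (\<pi> (\<Psi> y)))" for \<pi>
  define C' where "C' \<pi> = (\<lambda>y\<in>E.Bd. \<Psi> (\<pi> (\<Phi> y)))" for \<pi>
  have C: "C \<pi> \<in> F.FG" if "\<pi> \<in> E.FG" for \<pi>
    using full_group_conj[OF E F \<phi> \<Phi>_def hm, of \<pi>] that 
    unfolding C_def E.full_group_carrier_eq F.full_group_carrier_eq by blast
  have C': "C' \<pi> \<in> E.FG" if "\<pi> \<in> F.FG" for \<pi>
    using full_group_conj[OF F E \<psi> \<Psi>_def hm', of \<pi>] that 
    unfolding C'_def E.full_group_carrier_eq F.full_group_carrier_eq by blast
  have "C \<in> iso (full_group E) (full_group F)"
  proof (rule isoI)
    show "C \<in> hom (full_group E) (full_group F)"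
    proof (rule homI)
      fix \<pi> \<rho> assume "\<pi> \<in> carrier (full_group E)" "\<rho> \<in> carrier (full_group E)"
      then have pr: "\<pi> \<in> E.FG" "\<rho> \<in> E.FG" by auto
      then show "C \<pi> \<in> carrier (full_group F)" using C by simp
      have "C (compose E.Bd \<pi> \<rho>) = compose F.Bd (C \<pi>) (C \<rho>)"
      proof (rule F.fg_eqI)
        show "C (compose E.Bd \<pi> \<rho>) \<in> F.FG" "compose F.Bd (C \<pi>) (C \<rho>) \<in> F.FG"
          using pr C E.fg_compose F.fg_compose by blast+
        fix z assume "z \<in> F.Bd"
        then show "C (compose E.Bd \<pi> \<rho>) z = compose F.Bd (C \<pi>) (C \<rho>) z"
          using E.fg_in[OF pr(2)] B B' inv by (simp add: compose_def C_def)
      qed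
      then show "C (\<pi> \<otimes>\<^bsub>full_group E\<^esub> \<rho>) = C \<pi> \<otimes>\<^bsub>full_group F\<^esub> C \<rho>" by simp
    qed
    have "bij_betw C E.FG F.FG"
    proof (rule bij_betwI[of _ _ _ C'])
      show "C \<in> E.FG \<rightarrow> F.FG" "C' \<in> F.FG \<rightarrow> E.FG" using C C' by auto
      show "C' (C \<pi>) = \<pi>" if p: "\<pi> \<in> E.FG" for \<pi>
        by (rule E.fg_eqI[OF C'[OF C[OF p]] p]) (use E.fg_in[OF p] B inv in \<open>simp add: C_def C'_def\<close>)
      show "C (C' \<pi>) = \<pi>" if p: "\<pi> \<in> F.FG" for \<pi>
        by (rule F.fg_eqI[OF C[OF C'[OF p]] p]) (use F.fg_in[OF p] B' inv' in \<open>simp add: C_def C'_def\<close>)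
    qed
    then show "bij_betw C (carrier (full_group E)) (carrier (full_group F))" by simp
  qed
  then show ?thesis by (auto simp: is_iso_def)
qed

text \<open>A surjective homomorphism maps the derived subgroup onto the derived subgroup.\<close>

lemma derived_iso:
  assumes G: "group G" and H: "group H" and i: "G \<cong> H"
  shows "G\<lparr>carrier := commutator_subgroup G\<rparr> \<cong> H\<lparr>carrier := commutator_subgroup H\<rparr>"
proof -
  interpret G: group G by fact
  interpret H: group H by fact
  obtain h where h: "h \<in> iso G H" using i by (auto simp: is_iso_def)
  interpret group_hom G H h using h by unfold_locales (simp add: iso_def)
  have b: "inj_on h (carrier G)" "h ` carrier G = carrier H" using h by (auto simp: iso_def bij_betw_def)
  have sub: "commutator_subgroup G \<subseteq> carrier G"
    unfolding commutator_subgroup_def by (rule G.derived_in_carrier) simp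
  have im: "h ` commutator_subgroup G = commutator_subgroup H"
    unfolding commutator_subgroup_def using derived_img[of "carrier G"] b(2) by simp
  have "h \<in> iso (G\<lparr>carrier := commutator_subgroup G\<rparr>) (H\<lparr>carrier := commutator_subgroup H\<rparr>)"
  proof (rule isoI)
    show "h \<in> hom (G\<lparr>carrier := commutator_subgroup G\<rparr>) (H\<lparr>carrier := commutator_subgroup H\<rparr>)"
      by (rule homI) (use sub im in \<open>auto simp: subset_iff\<close>)
    show "bij_betw h (carrier (G\<lparr>carrier := commutator_subgroup G\<rparr>)) (carrier (H\<lparr>carrier := commutator_subgroup H\<rparr>))"
      using inj_on_subset[OF b(1) sub] im by (simp add: bij_betw_def)
  qed
  then show ?thesis by (auto simp: is_iso_def)
qed

section \<open>Reconstruction from an abstract isomorphism, and the equivalences\<close>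

lemma groupoids_isomorphic_if_iso:
  assumes E: "kwi_graph E" and F: "kwi_graph F"
    and \<Gamma>: "subgroup \<Gamma> (full_group E)" "commutator_subgroup (full_group E) \<subseteq> \<Gamma>"
    and \<Lambda>: "subgroup \<Lambda> (full_group F)" "commutator_subgroup (full_group F) \<subseteq> \<Lambda>"
    and i: "(full_group E)\<lparr>carrier := \<Gamma>\<rparr> \<cong> (full_group F)\<lparr>carrier := \<Lambda>\<rparr>"
  shows "groupoids_isomorphic E F"
proof -
  interpret E: kwi_graph E by fact
  interpret F: kwi_graph F by fact
  obtain h where h: "h \<in> iso ((full_group E)\<lparr>carrier := \<Gamma>\<rparr>) ((full_group F)\<lparr>carrier := \<Lambda>\<rparr>)"
    using i by (auto simp: is_iso_def)
  obtain \<Phi> where "homeomorphic_map (boundary_top E) (boundary_top F) \<Phi>"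
    "\<forall>g\<in>carrier ((full_group E)\<lparr>carrier := \<Gamma>\<rparr>). \<forall>x\<in>topspace (boundary_top E). \<Phi> (g x) = h g (\<Phi> x)"
    using spatial_realization[OF E.rubin_action_full[OF \<Gamma>] F.rubin_action_full[OF \<Lambda>] h] by blast
  then show ?thesis
    using groupoids_isomorphic_if_spatial[OF E F \<Gamma> \<Lambda> h, of \<Phi>] by simp
qed

theorem theorem10p10:
  fixes E :: "('v, 'e) graph" and F :: "('w, 'f) graph"
  assumes "wf_graph E" and "wf_graph F"
    and "no_sinks E" and "no_sinks F"
    and "condition_K E" and "condition_W E" and "condition_infty E"
    and "condition_K F" and "condition_W F" and "condition_infty F"
  shows "(\<forall>\<Gamma> \<Lambda>. subgroup \<Gamma> (full_group E) \<and> commutator_subgroup (full_group E) \<subseteq> \<Gamma> \<and>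
                 subgroup \<Lambda> (full_group F) \<and> commutator_subgroup (full_group F) \<subseteq> \<Lambda> \<and>
                 (full_group E)\<lparr>carrier := \<Gamma>\<rparr> \<cong> (full_group F)\<lparr>carrier := \<Lambda>\<rparr>
              \<longrightarrow> groupoids_isomorphic E F)
       \<and> (groupoids_isomorphic E F \<longleftrightarrow> full_group E \<cong> full_group F)
       \<and> (full_group E \<cong> full_group F \<longleftrightarrow>
            (full_group E)\<lparr>carrier := commutator_subgroup (full_group E)\<rparr> \<cong>
            (full_group F)\<lparr>carrier := commutator_subgroup (full_group F)\<rparr>)"
proof -
  have E: "kwi_graph E" and F: "kwi_graph F" by unfold_locales (use assms in auto)
  interpret E: kwi_graph E by fact
  interpret F: kwi_graph F by fact
  \<comment> \<open>The full groups are the largest admissible choices of \<open>\<Gamma>\<close>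
    and \<open>\<Lambda>\<close>; updating the carrier by itself leaves the group unchanged.\<close>
  have full: "groupoids_isomorphic E F" if "full_group E \<cong> full_group F"
  proof (rule groupoids_isomorphic_if_iso[OF E F])
    show "subgroup (carrier (full_group E)) (full_group E)" "subgroup (carrier (full_group F)) (full_group F)"
      using group.subgroup_self E.group_full F.group_full by blast+
    show "commutator_subgroup (full_group E) \<subseteq> carrier (full_group E)"
      "commutator_subgroup (full_group F) \<subseteq> carrier (full_group F)"
      using E.DG_FG F.DG_FG by simp_all
    have "(full_group E)\<lparr>carrier := carrier (full_group E)\<rparr> = full_group E"
      "(full_group F)\<lparr>carrier := carrier (full_group F)\<rparr> = full_group F" by simp_all
    then show "(full_group E)\<lparr>carrier := carrier (full_group E)\<rparr> \<cong> (full_group F)\<lparr>carrier := carrier (full_group F)\<rparr>"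
      using that by metis
  qed
  \<comment> \<open>The commutator subgroups are the smallest admissible choices.\<close>
  have comm: "groupoids_isomorphic E F" if "(full_group E)\<lparr>carrier := commutator_subgroup (full_group E)\<rparr> \<cong>
            (full_group F)\<lparr>carrier := commutator_subgroup (full_group F)\<rparr>"
    using groupoids_isomorphic_if_iso[OF E F E.DG_subgroup subset_refl F.DG_subgroup subset_refl that] .
  \<comment> \<open>The implications close up in a circle: a groupoid isomorphism conjugates the
    full groups, these restrict to their commutator subgroups, and from those the groupoid is
    reconstructed.\<close>
  show ?thesis
    using groupoids_isomorphic_if_iso[OF E F] full comm full_groups_iso_if_groupoids_isomorphic[OF E F]
      derived_iso[OF E.group_full F.group_full] by blast
qed

end
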